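(* Let $X$ be a metric space with a measure $\mu$ with full support, and let $\epsilon>0$. The restriction map $$\rho:\mathbb{P}_\epsilon(L^2(X))\to\mathcal{P}(E(\mathcal{R}_\epsilon))$$ from $\epsilon$-connected pure states on $\mathcal{K}(L^2(X))$ to pure states on $E(\mathcal{R}_\epsilon)$ is (well-defined and) bijective.
   Context: $(X,d)$ is a locally compact metric space and $\mu$ is a Radon measure on the Borel sets of $X$; full support means every nonempty open set has positive measure. Set $\mathcal{R}_\epsilon=\{(x,y)\in X\times X:d(x,y)<\epsilon\}$. $E(\mathcal{R}_\epsilon)\subseteq\mathcal{K}(L^2(X,\mu))$ is the norm closure of the space of integral operators $(\pi(F)\xi)(x)=\int_XF(x,y)\xi(y)\,d\mu(y)$ with kernels $F\in C_c(\mathcal{R}_\epsilon)$ (continuous, with compact support contained in $\mathcal{R}_\epsilon$), with order inherited from the compact operators $\mathcal{K}(L^2(X))$. A state on $E(\mathcal{R}_\epsilon)$ is a positive linear functional of norm one; $\mathcal{P}(E(\mathcal{R}_\epsilon))$ is the set of pure states, i.e. of extreme points of the convex set of states. A subset $Y$ of $X$ is $\epsilon$-connected if the equivalence relation on $Y$ generated by the relation $d(y,y')<\epsilon$ has only one equivalence class. $\mathbb{P}(L^2(X))$ is the set of pure states of $\mathcal{K}(L^2(X))$, i.e. of vector states $|\psi\rangle\langle\psi|: T\mapsto\langle\psi,T\psi\rangle$ with $\|\psi\|=1$, and $\mathbb{P}_\epsilon(L^2(X))$ is the subset of those $|\psi\rangle\langle\psi|$ for which the essential support of $\psi$ is $\epsilon$-connected.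 *)

theory Defs
  imports "HOL-Analysis.Analysis"
begin

text \<open>
  Convention for Radon measures: finite on compact sets, outer regular on all Borel sets and
  inner regular (with respect to compact sets) on open sets. No sigma-finiteness is assumed.
\<close>

definition radon_measure :: "'a::metric_space measure \<Rightarrow> bool" where
  "radon_measure \<mu> \<longleftrightarrow>
     sets \<mu> = sets borel \<and>
     (\<forall>K. compact K \<longrightarrow> emeasure \<mu> K < \<infinity>) \<and>
     (\<forall>A\<in>sets borel. emeasure \<mu> A = (INF U\<in>{U. open U \<and> A \<subseteq> U}. emeasure \<mu> U)) \<and>
     (\<forall>U. open U \<longrightarrow> emeasure \<mu> U = (SUP K\<in>{K. compact K \<and> K \<subseteq> U}. emeasure \<mu> K))"

definition full_support :: "'a::metric_space measure \<Rightarrow> bool" where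
  "full_support \<mu> \<longleftrightarrow> (\<forall>U. open U \<and> U \<noteq> {} \<longrightarrow> emeasure \<mu> U > 0)"

text \<open>
  Elements of the Hilbert space are represented by square-integrable functions, and operators by
  maps on such functions; the passage to almost-everywhere classes is not carried out, so
  \<open>l2_norm\<close> and \<open>op_norm\<close> are seminorms. A norm-bounded linear map automatically respects equality
  almost everywhere, and a norm-bounded linear functional takes the same value on operators at
  distance 0. Hence bounded functionals on a set of representatives that is closed under changing
  representatives (\<open>compact_ops\<close> and \<open>E_op\<close> below are) are exactly the bounded functionals on the
  corresponding space of operators on the genuine Hilbert space.
\<close>

definition l2_space :: "'a measure \<Rightarrow> ('a \<Rightarrow> complex) set" where
  "l2_space \<mu> = {f \<in> borel_measurable \<mu>. integrable \<mu> (\<lambda>x. (cmod (f x))\<^sup>2)}"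

definition l2_inner :: "'a measure \<Rightarrow> ('a \<Rightarrow> complex) \<Rightarrow> ('a \<Rightarrow> complex) \<Rightarrow> complex" where
  "l2_inner \<mu> f g = (LINT x|\<mu>. cnj (f x) * g x)"

definition l2_norm :: "'a measure \<Rightarrow> ('a \<Rightarrow> complex) \<Rightarrow> real" where
  "l2_norm \<mu> f = sqrt (LINT x|\<mu>. (cmod (f x))\<^sup>2)"

type_synonym 'a l2_op = "('a \<Rightarrow> complex) \<Rightarrow> ('a \<Rightarrow> complex)"

definition bounded_ops :: "'a measure \<Rightarrow> 'a l2_op set" where
  "bounded_ops \<mu> = {T \<in> l2_space \<mu> \<rightarrow> l2_space \<mu>.
     (\<forall>f\<in>l2_space \<mu>. \<forall>g\<in>l2_space \<mu>. \<forall>a b.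
        AE x in \<mu>. T (\<lambda>y. a * f y + b * g y) x = a * T f x + b * T g x) \<and>
     (\<exists>C. \<forall>f\<in>l2_space \<mu>. l2_norm \<mu> (T f) \<le> C * l2_norm \<mu> f)}"

text \<open>Meaningful on \<open>bounded_ops\<close> only: otherwise the supremum may range over an unbounded set.\<close>

definition op_norm :: "'a measure \<Rightarrow> 'a l2_op \<Rightarrow> real" where
  "op_norm \<mu> T = (SUP f\<in>{f \<in> l2_space \<mu>. l2_norm \<mu> f \<le> 1}. l2_norm \<mu> (T f))"

definition positive_op :: "'a measure \<Rightarrow> 'a l2_op \<Rightarrow> bool" where
  "positive_op \<mu> T \<longleftrightarrow> (\<forall>f\<in>l2_space \<mu>. l2_inner \<mu> f (T f) \<in> \<real>\<^sub>\<ge>\<^sub>0)"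

definition compact_ops :: "'a measure \<Rightarrow> 'a l2_op set" where
  "compact_ops \<mu> = {T \<in> bounded_ops \<mu>.
     \<forall>f :: nat \<Rightarrow> 'a \<Rightarrow> complex.
       (\<forall>n. f n \<in> l2_space \<mu> \<and> l2_norm \<mu> (f n) \<le> 1) \<longrightarrow>
       (\<exists>g\<in>l2_space \<mu>. \<exists>r. strict_mono r \<and>
          (\<lambda>n. l2_norm \<mu> (\<lambda>x. T (f (r n)) x - g x)) \<longlonglongrightarrow> 0)}"

definition tolerance :: "real \<Rightarrow> ('a::metric_space \<times> 'a) set" where
  "tolerance \<epsilon> = {(x, y). dist x y < \<epsilon>}"

text \<open>
  The tolerance relation is open in the product, so a compactly supported continuous function on
  it is the same as one on the whole product whose closed support is compact and contained in it.
\<close>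

definition Cc_tolerance :: "real \<Rightarrow> ('a::metric_space \<times> 'a \<Rightarrow> complex) set" where
  "Cc_tolerance \<epsilon> = {F. continuous_on UNIV F \<and>
     compact (closure {p. F p \<noteq> 0}) \<and> closure {p. F p \<noteq> 0} \<subseteq> tolerance \<epsilon>}"

definition kernel_op :: "'a measure \<Rightarrow> ('a \<times> 'a \<Rightarrow> complex) \<Rightarrow> 'a l2_op" where
  "kernel_op \<mu> F = (\<lambda>\<xi> x. LINT y|\<mu>. F (x, y) * \<xi> y)"

definition E_op :: "'a::metric_space measure \<Rightarrow> real \<Rightarrow> 'a l2_op set" where
  "E_op \<mu> \<epsilon> = {T \<in> compact_ops \<mu>. \<forall>\<delta>>0. \<exists>F\<in>Cc_tolerance \<epsilon>.
     op_norm \<mu> (\<lambda>\<xi> x. T \<xi> x - kernel_op \<mu> F \<xi> x) < \<delta>}"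

text \<open>
  Functionals on \<open>S\<close> are taken in \<open>extensional S\<close>, so that two of them are equal if and only if
  they agree on \<open>S\<close>. The last two conjuncts say that the functional is bounded and has norm one.
\<close>

definition states :: "'a measure \<Rightarrow> 'a l2_op set \<Rightarrow> ('a l2_op \<Rightarrow> complex) set" where
  "states \<mu> S = {\<phi> \<in> extensional S.
     (\<forall>T\<in>S. \<forall>U\<in>S. \<forall>a b. \<phi> (\<lambda>\<xi> x. a * T \<xi> x + b * U \<xi> x) = a * \<phi> T + b * \<phi> U) \<and>
     (\<forall>T\<in>S. positive_op \<mu> T \<longrightarrow> \<phi> T \<in> \<real>\<^sub>\<ge>\<^sub>0) \<and>
     (\<exists>C. \<forall>T\<in>S. cmod (\<phi> T) \<le> C * op_norm \<mu> T) \<and>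
     (SUP T\<in>{T \<in> S. op_norm \<mu> T \<le> 1}. cmod (\<phi> T)) = 1}"

text \<open>
  Extreme points of the set of states (\<open>extreme_point_of\<close> is unavailable, since the function type
  of functionals is not an instance of \<open>real_vector\<close>).
\<close>

definition pure_states :: "'a measure \<Rightarrow> 'a l2_op set \<Rightarrow> ('a l2_op \<Rightarrow> complex) set" where
  "pure_states \<mu> S = {\<phi> \<in> states \<mu> S.
     \<forall>\<phi>1\<in>states \<mu> S. \<forall>\<phi>2\<in>states \<mu> S. \<forall>t::real. 0 < t \<and> t < 1 \<and>
       (\<forall>T\<in>S. \<phi> T = of_real t * \<phi>1 T + of_real (1 - t) * \<phi>2 T) \<longrightarrow> \<phi>1 = \<phi> \<and> \<phi>2 = \<phi>}"

definition vector_state :: "'a measure \<Rightarrow> ('a \<Rightarrow> complex) \<Rightarrow> ('a l2_op \<Rightarrow> complex)" where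
  "vector_state \<mu> \<psi> = (\<lambda>T\<in>compact_ops \<mu>. l2_inner \<mu> \<psi> (T \<psi>))"

definition ess_support :: "'a::metric_space measure \<Rightarrow> ('a \<Rightarrow> complex) \<Rightarrow> 'a set" where
  "ess_support \<mu> \<psi> = - \<Union>{U. open U \<and> (AE x in \<mu>. x \<in> U \<longrightarrow> \<psi> x = 0)}"

text \<open>
  For \<open>\<epsilon> > 0\<close> the relation is reflexive on \<open>Y\<close> and symmetric, so its transitive closure is the
  equivalence relation on \<open>Y\<close> that it generates.
\<close>

definition eps_connected :: "real \<Rightarrow> 'a::metric_space set \<Rightarrow> bool" where
  "eps_connected \<epsilon> Y \<longleftrightarrow>
     is_singleton (Y // {(y, y'). y \<in> Y \<and> y' \<in> Y \<and> dist y y' < \<epsilon>}\<^sup>+)"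

definition eps_connected_pure_states ::
    "'a::metric_space measure \<Rightarrow> real \<Rightarrow> ('a l2_op \<Rightarrow> complex) set" where
  "eps_connected_pure_states \<mu> \<epsilon> = {\<omega> \<in> pure_states \<mu> (compact_ops \<mu>).
     \<exists>\<psi>\<in>l2_space \<mu>. l2_norm \<mu> \<psi> = 1 \<and> \<omega> = vector_state \<mu> \<psi> \<and>
       eps_connected \<epsilon> (ess_support \<mu> \<psi>)}"

end

theory Submission
  imports Defs
begin

text \<open>
  The operator space \<open>E_op \<mu> \<epsilon>\<close> is the closed linear span of the rank-one operators \<open>|f><g|\<close>
  (\<open>rank1 \<mu> f g\<close>) for which \<open>f\<close> and \<open>g\<close> live on a common small open set, that is on an open \<open>U\<close> with \<open>U \<times> U\<close> contained in the
  tolerance relation (\<open>E_op_generated\<close>). Hence the restriction of the vector state of \<open>p\<close> knows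
  precisely the products \<open><p, f> <g, p>\<close> for such pairs.

  Over a single small open set these products determine \<open>p\<close> up to a phase, and a positive
  functional that is dominated by the vector functional of \<open>p\<close> is a multiple of it
  (\<open>form_dominated_by_rank_one\<close>). The phases and factors belonging to two small open sets that share a
  point of the essential support of \<open>p\<close> agree, and any two points of the support at distance less
  than \<open>\<epsilon>\<close> lie in a common small open set. So if the support is \<open>\<epsilon>\<close>-connected, there is a single global
  factor (\<open>proportional_along_eps_chains\<close>). This yields injectivity
  (\<open>vector_state_determined_by_restriction\<close>) as well as purity of the restriction
  (\<open>vector_state_pure_on_E\<close>); for the latter one also needs that the restriction still has norm one
  (\<open>vector_functional_norming\<close>). If on the other hand the support is not \<open>\<epsilon>\<close>-connected, \<open>p\<close> splits into
  two parts between which no operator of \<open>E_op \<mu> \<epsilon>\<close> has a matrix entry, and the restriction is a proper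
  mixture (\<open>pure_vector_state_eps_connected\<close>).

  It remains to see that each pure state \<open>\<phi>\<close> of \<open>E_op \<mu> \<epsilon>\<close> comes from a vector
  (\<open>pure_state_is_vector_state\<close>). The order structure enters through the inequality
  \<open>Re (\<phi> T) \<le> sup Re <h, T h>\<close>, the supremum being over the unit ball
  (\<open>quasi_state_le_numerical_range\<close>): up to a small error, \<open>T\<close> is an operator on the span of finitely many
  indicator functions of disjoint sets of small diameter, and the projection onto that span is
  itself in \<open>E_op \<mu> \<epsilon>\<close> and serves as an order unit. By the Hahn-Banach theorem (\<open>extend_to_mean\<close>), \<open>\<phi>\<close> is
  then the average of the functionals \<open>T \<mapsto> <h, T h>\<close> with respect to a finitely additive
  probability measure \<open>m\<close> on the unit ball. The weak average \<open>p\<close> of \<open><h, g> h\<close>, for a suitable \<open>g\<close>, exists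
  by the Riesz representation theorem, and a variance computation shows that \<open>\<phi>\<close> is a convex
  combination of the normalised vector functional of \<open>p\<close> and another quasi-state. Purity does the rest.

  Operators act on functions rather than on classes of functions, so that the norms are
  seminorms and identities between operators often hold on square-integrable functions only.
\<close>

section \<open>The semi-inner product on square-integrable functions\<close>

lemma l2_spaceD:
  assumes "f \<in> l2_space M"
  shows "f \<in> borel_measurable M" "integrable M (\<lambda>x. (cmod (f x))\<^sup>2)"
  using assms by (auto simp: l2_space_def)

lemma l2_lincomb:
  assumes "f \<in> l2_space M" "g \<in> l2_space M"
  shows "(\<lambda>x. a * f x + b * g x) \<in> l2_space M"
proof -
  note [measurable] = l2_spaceD(1)[OF assms(1)] l2_spaceD(1)[OF assms(2)]
  have "integrable M (\<lambda>x. (cmod (a * f x + b * g x))\<^sup>2)"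
  proof (rule Bochner_Integration.integrable_bound)
    show "integrable M (\<lambda>x. 2 * (cmod a)\<^sup>2 * (cmod (f x))\<^sup>2 + 2 * (cmod b)\<^sup>2 * (cmod (g x))\<^sup>2)"
      using l2_spaceD(2)[OF assms(1)] l2_spaceD(2)[OF assms(2)] by simp
    show "AE x in M. norm ((cmod (a * f x + b * g x))\<^sup>2)
      \<le> norm (2 * (cmod a)\<^sup>2 * (cmod (f x))\<^sup>2 + 2 * (cmod b)\<^sup>2 * (cmod (g x))\<^sup>2)"
    proof (rule AE_I2)
      fix x
      have "(cmod (a * f x + b * g x))\<^sup>2 \<le> (cmod a * cmod (f x) + cmod b * cmod (g x))\<^sup>2"
        by (rule power_mono) (auto intro: order.trans[OF norm_triangle_ineq] simp: norm_mult)
      also have "\<dots> \<le> 2 * (cmod a * cmod (f x))\<^sup>2 + 2 * (cmod b * cmod (g x))\<^sup>2"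
        using sum_squares_bound[of "cmod a * cmod (f x)" "cmod b * cmod (g x)"]
        by (simp add: power2_sum)
      finally show "norm ((cmod (a * f x + b * g x))\<^sup>2)
          \<le> norm (2 * (cmod a)\<^sup>2 * (cmod (f x))\<^sup>2 + 2 * (cmod b)\<^sup>2 * (cmod (g x))\<^sup>2)"
        by (simp add: power_mult_distrib)
    qed
  qed simp
  then show ?thesis by (simp add: l2_space_def)
qed

lemma l2_zero: "(\<lambda>x. 0) \<in> l2_space M"
  by (simp add: l2_space_def)

lemma l2_scale: "f \<in> l2_space M \<Longrightarrow> (\<lambda>x. a * f x) \<in> l2_space M"
  using l2_lincomb[of f M f a 0] by simp

lemma l2_add: "f \<in> l2_space M \<Longrightarrow> g \<in> l2_space M \<Longrightarrow> (\<lambda>x. f x + g x) \<in> l2_space M"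
  using l2_lincomb[of f M g 1 1] by simp

lemma l2_diff: "f \<in> l2_space M \<Longrightarrow> g \<in> l2_space M \<Longrightarrow> (\<lambda>x. f x - g x) \<in> l2_space M"
  using l2_lincomb[of f M g 1 "-1"] by simp

lemma l2_sum: "(\<And>i. i \<in> I \<Longrightarrow> f i \<in> l2_space M) \<Longrightarrow> (\<lambda>x. \<Sum>i\<in>I. f i x) \<in> l2_space M"
  by (induction I rule: infinite_finite_induct) (auto simp: l2_zero intro: l2_add)

lemma l2_cutoff:
  assumes "f \<in> l2_space M" "A \<in> sets M"
  shows "(\<lambda>x. indicator A x * f x) \<in> l2_space M"
proof -
  note [measurable] = l2_spaceD(1)[OF assms(1)] assms(2)
  have "integrable M (\<lambda>x. (cmod (indicator A x * f x))\<^sup>2)"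
    by (rule Bochner_Integration.integrable_bound[OF l2_spaceD(2)[OF assms(1)]])
      (auto simp: indicator_def)
  then show ?thesis by (simp add: l2_space_def)
qed

lemma l2_indicator:
  assumes "A \<in> sets M" "emeasure M A < \<infinity>"
  shows "(indicator A :: 'a \<Rightarrow> complex) \<in> l2_space M"
proof -
  have eq: "(\<lambda>x. (cmod (indicator A x))\<^sup>2) = (indicator A :: 'a \<Rightarrow> real)"
    by (auto simp: indicator_def)
  show ?thesis
    using assms unfolding l2_space_def mem_Collect_eq eq
    by (auto intro!: integrable_real_indicator borel_measurable_indicator)
qed

lemma borel_measurable_cnj [measurable]:
  assumes "f \<in> borel_measurable M"
  shows "(\<lambda>x. cnj (f x)) \<in> borel_measurable M"
  by (rule borel_measurable_continuous_on[OF _ assms]) (intro continuous_intros)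

lemma l2_inner_integrable:
  assumes "f \<in> l2_space M" "g \<in> l2_space M"
  shows "integrable M (\<lambda>x. cnj (f x) * g x)"
proof (rule Bochner_Integration.integrable_bound)
  note [measurable] = l2_spaceD(1)[OF assms(1)] l2_spaceD(1)[OF assms(2)]
  show "integrable M (\<lambda>x. (cmod (f x))\<^sup>2 + (cmod (g x))\<^sup>2)"
    using l2_spaceD(2)[OF assms(1)] l2_spaceD(2)[OF assms(2)] by simp
  show "(\<lambda>x. cnj (f x) * g x) \<in> borel_measurable M" by simp
  show "AE x in M. norm (cnj (f x) * g x) \<le> norm ((cmod (f x))\<^sup>2 + (cmod (g x))\<^sup>2)"
  proof (rule AE_I2)
    fix x
    have "0 \<le> cmod (f x) * cmod (g x)" by simp
    moreover have "2 * (cmod (f x) * cmod (g x)) \<le> (cmod (f x))\<^sup>2 + (cmod (g x))\<^sup>2"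
      using sum_squares_bound[of "cmod (f x)" "cmod (g x)"] by (simp only: mult.assoc)
    ultimately have "cmod (f x) * cmod (g x) \<le> (cmod (f x))\<^sup>2 + (cmod (g x))\<^sup>2"
      by linarith
    then show "norm (cnj (f x) * g x) \<le> norm ((cmod (f x))\<^sup>2 + (cmod (g x))\<^sup>2)"
      by (simp add: norm_mult)
  qed
qed

lemma l2_inner_lincomb_right:
  assumes "f \<in> l2_space M" "g \<in> l2_space M" "h \<in> l2_space M"
  shows "l2_inner M h (\<lambda>x. a * f x + b * g x) = a * l2_inner M h f + b * l2_inner M h g"
proof -
  have "(\<lambda>x. cnj (h x) * (a * f x + b * g x))
      = (\<lambda>x. a * (cnj (h x) * f x) + b * (cnj (h x) * g x))"
    by (auto simp: algebra_simps)
  then show ?thesis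
    using l2_inner_integrable[OF assms(3,1)] l2_inner_integrable[OF assms(3,2)]
    by (simp add: l2_inner_def)
qed

lemma l2_inner_commute: "l2_inner M g f = cnj (l2_inner M f g)"
  unfolding l2_inner_def Bochner_Integration.integral_cnj[symmetric] by (simp add: mult.commute)

lemma l2_inner_lincomb_left:
  assumes "f \<in> l2_space M" "g \<in> l2_space M" "h \<in> l2_space M"
  shows "l2_inner M (\<lambda>x. a * f x + b * g x) h = cnj a * l2_inner M f h + cnj b * l2_inner M g h"
proof -
  have "l2_inner M (\<lambda>x. a * f x + b * g x) h = cnj (l2_inner M h (\<lambda>x. a * f x + b * g x))"
    by (rule l2_inner_commute)
  also have "\<dots> = cnj a * cnj (l2_inner M h f) + cnj b * cnj (l2_inner M h g)"
    by (simp only: l2_inner_lincomb_right[OF assms] complex_cnj_add complex_cnj_mult)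
  finally show ?thesis
    unfolding l2_inner_commute[of M f h, symmetric] l2_inner_commute[of M g h, symmetric] .
qed

lemma l2_inner_scale_right: "l2_inner M h (\<lambda>x. a * f x) = a * l2_inner M h f"
  unfolding l2_inner_def by (simp add: mult.left_commute)

lemma l2_inner_scale_left: "l2_inner M (\<lambda>x. a * f x) h = cnj a * l2_inner M f h"
  unfolding l2_inner_def by (simp add: mult.assoc)

lemma l2_inner_add_right:
  assumes "f \<in> l2_space M" "g \<in> l2_space M" "h \<in> l2_space M"
  shows "l2_inner M h (\<lambda>x. f x + g x) = l2_inner M h f + l2_inner M h g"
  using l2_inner_lincomb_right[OF assms, of 1 1] by simp

lemma l2_inner_diff_right:
  assumes "f \<in> l2_space M" "g \<in> l2_space M" "h \<in> l2_space M"
  shows "l2_inner M h (\<lambda>x. f x - g x) = l2_inner M h f - l2_inner M h g"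
  using l2_inner_lincomb_right[OF assms, of 1 "-1"] by simp

lemma l2_inner_diff_left:
  assumes "f \<in> l2_space M" "g \<in> l2_space M" "h \<in> l2_space M"
  shows "l2_inner M (\<lambda>x. f x - g x) h = l2_inner M f h - l2_inner M g h"
  using l2_inner_lincomb_left[OF assms, of 1 "-1"] by simp

lemma l2_inner_zero [simp]: "l2_inner M h (\<lambda>x. 0) = 0" "l2_inner M (\<lambda>x. 0) h = 0"
  by (simp_all add: l2_inner_def)

lemma l2_inner_sum_right:
  assumes "h \<in> l2_space M" "\<And>i. i \<in> I \<Longrightarrow> f i \<in> l2_space M"
  shows "l2_inner M h (\<lambda>x. \<Sum>i\<in>I. f i x) = (\<Sum>i\<in>I. l2_inner M h (f i))"
  using assms(2)
  by (induction I rule: infinite_finite_induct)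
    (auto simp: l2_inner_add_right[OF _ l2_sum assms(1)])

lemma l2_inner_cong_AE:
  assumes "AE x in M. f x = f' x" "AE x in M. g x = g' x"
    and "f \<in> borel_measurable M" "f' \<in> borel_measurable M"
      "g \<in> borel_measurable M" "g' \<in> borel_measurable M"
  shows "l2_inner M f g = l2_inner M f' g'"
  unfolding l2_inner_def
proof (rule integral_cong_AE)
  show "AE x in M. cnj (f x) * g x = cnj (f' x) * g' x"
    using assms(1,2) by eventually_elim simp
qed (use assms in auto)

lemma l2_norm_nonneg [simp]: "0 \<le> l2_norm M f"
  by (simp add: l2_norm_def)

lemma l2_norm_squared: "(l2_norm M f)\<^sup>2 = (LINT x|M. (cmod (f x))\<^sup>2)"
  by (simp add: l2_norm_def)

lemma l2_inner_self: "l2_inner M f f = of_real ((l2_norm M f)\<^sup>2)"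
  unfolding l2_norm_squared l2_inner_def integral_complex_of_real[symmetric]
  by (rule Bochner_Integration.integral_cong) (auto simp: mult.commute complex_norm_square[symmetric])

lemma l2_norm_cong_AE:
  assumes "AE x in M. f x = f' x" "f \<in> borel_measurable M" "f' \<in> borel_measurable M"
  shows "l2_norm M f = l2_norm M f'"
proof -
  have "(LINT x|M. (cmod (f x))\<^sup>2) = (LINT x|M. (cmod (f' x))\<^sup>2)"
  proof (rule integral_cong_AE)
    show "AE x in M. (cmod (f x))\<^sup>2 = (cmod (f' x))\<^sup>2"
      using assms(1) by eventually_elim simp
  qed (use assms in measurable)
  then show ?thesis by (simp add: l2_norm_def)
qed

lemma l2_norm_zero [simp]: "l2_norm M (\<lambda>x. 0) = 0"
  by (simp add: l2_norm_def)

lemma l2_norm_eq_0_AE: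
  assumes "f \<in> l2_space M"
  shows "l2_norm M f = 0 \<longleftrightarrow> (AE x in M. f x = 0)"
  using integral_nonneg_eq_0_iff_AE[OF l2_spaceD(2)[OF assms]] by (simp add: l2_norm_def)

lemma l2_norm_scale: "l2_norm M (\<lambda>x. a * f x) = cmod a * l2_norm M f"
  by (simp add: l2_norm_def norm_mult power_mult_distrib real_sqrt_mult)

lemma l2_norm_lincomb_squared:
  assumes "f \<in> l2_space M" "g \<in> l2_space M"
  shows "(l2_norm M (\<lambda>x. f x + a * g x))\<^sup>2
    = (l2_norm M f)\<^sup>2 + 2 * Re (a * l2_inner M f g) + (cmod a)\<^sup>2 * (l2_norm M g)\<^sup>2"
proof -
  let ?h = "\<lambda>x. 1 * f x + a * g x"
  have h: "?h \<in> l2_space M" by (rule l2_lincomb[OF assms])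
  have "complex_of_real ((l2_norm M ?h)\<^sup>2)
     = l2_inner M f f + a * l2_inner M f g + cnj a * (l2_inner M g f + a * l2_inner M g g)"
    unfolding l2_inner_self[symmetric]
    by (subst l2_inner_lincomb_right[OF assms h], subst (1 2) l2_inner_lincomb_left)
      (use assms in \<open>simp_all add: algebra_simps\<close>)
  also have "\<dots> = of_real ((l2_norm M f)\<^sup>2) + (a * l2_inner M f g + cnj (a * l2_inner M f g))
      + (a * cnj a) * of_real ((l2_norm M g)\<^sup>2)"
    by (subst l2_inner_commute[of M g f]) (simp add: l2_inner_self algebra_simps)
  also have "\<dots> = of_real ((l2_norm M f)\<^sup>2 + 2 * Re (a * l2_inner M f g)
      + (cmod a)\<^sup>2 * (l2_norm M g)\<^sup>2)"
    unfolding complex_add_cnj complex_norm_square[symmetric] by simp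
  finally show ?thesis unfolding of_real_eq_iff by simp
qed

lemma l2_norm_minus_commute: "l2_norm M (\<lambda>x. f x - g x) = l2_norm M (\<lambda>x. g x - f x)"
  by (simp add: l2_norm_def norm_minus_commute)

lemma l2_cauchy_schwarz:
  assumes f: "f \<in> l2_space M" and g: "g \<in> l2_space M"
  shows "cmod (l2_inner M f g) \<le> l2_norm M f * l2_norm M g"
proof (cases "l2_norm M g = 0")
  case True
  then have "AE x in M. g x = 0" using l2_norm_eq_0_AE[OF g] by simp
  then have "l2_inner M f g = l2_inner M f (\<lambda>x. 0)"
    using l2_spaceD(1)[OF f] l2_spaceD(1)[OF g] by (intro l2_inner_cong_AE) auto
  then show ?thesis by simp
next
  case False
  define z where "z = l2_inner M f g"
  define n where "n = (l2_norm M g)\<^sup>2"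
  have n: "n > 0" using False by (simp add: n_def)
  have "0 \<le> (l2_norm M (\<lambda>x. f x + (- cnj z / of_real n) * g x))\<^sup>2" by simp
  also have "\<dots> = (l2_norm M f)\<^sup>2 + 2 * Re (- cnj z / of_real n * z)
      + (cmod (- cnj z / of_real n))\<^sup>2 * n"
    unfolding l2_norm_lincomb_squared[OF f g] z_def n_def by simp
  also have "Re (- cnj z / of_real n * z) = - (cmod z)\<^sup>2 / n"
    by (simp add: cmod_power2) (simp add: power2_eq_square add_divide_distrib diff_divide_distrib)
  also have "(cmod (- cnj z / of_real n))\<^sup>2 * n = (cmod z)\<^sup>2 / n"
    using n by (simp add: norm_divide power_divide power2_eq_square[of n])
  finally have "(cmod z)\<^sup>2 / n \<le> (l2_norm M f)\<^sup>2" by simp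
  then have "(cmod z)\<^sup>2 \<le> (l2_norm M f * l2_norm M g)\<^sup>2"
    using n by (simp add: field_simps n_def power_mult_distrib)
  then show ?thesis unfolding z_def by (rule power2_le_imp_le) simp
qed

lemma l2_norm_triangle:
  assumes f: "f \<in> l2_space M" and g: "g \<in> l2_space M"
  shows "l2_norm M (\<lambda>x. f x + g x) \<le> l2_norm M f + l2_norm M g"
proof (rule power2_le_imp_le)
  have "Re (l2_inner M f g) \<le> l2_norm M f * l2_norm M g"
    using l2_cauchy_schwarz[OF f g] complex_Re_le_cmod order.trans by blast
  then show "(l2_norm M (\<lambda>x. f x + g x))\<^sup>2 \<le> (l2_norm M f + l2_norm M g)\<^sup>2"
    using l2_norm_lincomb_squared[OF f g, of 1] by (simp add: power2_sum)
qed simp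

lemma l2_norm_triangle_via:
  assumes "f \<in> l2_space M" "g \<in> l2_space M" "h \<in> l2_space M"
  shows "l2_norm M (\<lambda>x. f x - h x) \<le> l2_norm M (\<lambda>x. f x - g x) + l2_norm M (\<lambda>x. g x - h x)"
  using l2_norm_triangle[OF l2_diff[OF assms(1,2)] l2_diff[OF assms(2,3)]] by simp

lemma l2_norm_triangle_reverse:
  assumes f: "f \<in> l2_space M" and g: "g \<in> l2_space M"
  shows "l2_norm M f \<le> l2_norm M g + l2_norm M (\<lambda>x. f x - g x)"
  using l2_norm_triangle[OF g l2_diff[OF f g]] by simp

lemma l2_norm_mono:
  assumes "f \<in> borel_measurable M" "g \<in> l2_space M" "\<And>x. cmod (f x) \<le> C * cmod (g x)" "C \<ge> 0"
  shows "f \<in> l2_space M" "l2_norm M f \<le> C * l2_norm M g"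
proof -
  have le: "(cmod (f x))\<^sup>2 \<le> C\<^sup>2 * (cmod (g x))\<^sup>2" for x
    using power_mono[OF assms(3)[of x] norm_ge_zero, of 2] by (simp add: power_mult_distrib)
  have i: "integrable M (\<lambda>x. C\<^sup>2 * (cmod (g x))\<^sup>2)" using l2_spaceD(2)[OF assms(2)] by simp
  have "integrable M (\<lambda>x. (cmod (f x))\<^sup>2)"
    using assms(1) le by (intro Bochner_Integration.integrable_bound[OF i]) auto
  then show f: "f \<in> l2_space M" using assms(1) by (simp add: l2_space_def)
  have "(LINT x|M. (cmod (f x))\<^sup>2) \<le> (LINT x|M. C\<^sup>2 * (cmod (g x))\<^sup>2)"
    by (rule integral_mono[OF l2_spaceD(2)[OF f] i le])
  then have "(l2_norm M f)\<^sup>2 \<le> (C * l2_norm M g)\<^sup>2"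
    by (simp add: l2_norm_squared power_mult_distrib)
  then show "l2_norm M f \<le> C * l2_norm M g"
    using assms(4) by (auto intro: power2_le_imp_le)
qed

section \<open>Completeness and the Riesz representation\<close>

lemma l2_norm_le_of_nn_integral:
  assumes "f \<in> borel_measurable M" "(\<integral>\<^sup>+x. ennreal ((cmod (f x))\<^sup>2) \<partial>M) \<le> ennreal (e\<^sup>2)" "e \<ge> 0"
  shows "f \<in> l2_space M" "l2_norm M f \<le> e"
proof -
  have i: "integrable M (\<lambda>x. (cmod (f x))\<^sup>2)"
  proof (rule integrableI_bounded)
    show "(\<integral>\<^sup>+x. ennreal (norm ((cmod (f x))\<^sup>2)) \<partial>M) < \<infinity>"
      using assms(2) by (auto intro: le_less_trans)
  qed (use assms(1) in simp)
  then show "f \<in> l2_space M" using assms(1) by (simp add: l2_space_def)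
  have "ennreal (LINT x|M. (cmod (f x))\<^sup>2) \<le> ennreal (e\<^sup>2)"
    using assms(2) nn_integral_eq_integral[OF i] by simp
  then have "(l2_norm M f)\<^sup>2 \<le> e\<^sup>2" by (simp add: l2_norm_squared)
  then show "l2_norm M f \<le> e" using assms(3) by (auto intro: power2_le_imp_le)
qed

lemma nn_integral_l2_norm:
  assumes "f \<in> l2_space M"
  shows "(\<integral>\<^sup>+x. ennreal ((cmod (f x))\<^sup>2) \<partial>M) = ennreal ((l2_norm M f)\<^sup>2)"
  unfolding l2_norm_squared by (rule nn_integral_eq_integral[OF l2_spaceD(2)[OF assms]]) simp

text \<open>
  With \<open>D\<^sub>k = |f\<^sub>k\<^sub>+\<^sub>1 - f\<^sub>k|\<close>, the integral of \<open>\<Sum>k. 2\<^sup>k D\<^sub>k\<^sup>2\<close> is finite, so that this sum is finite almost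
  everywhere; and \<open>D\<^sub>k \<le> 2\<^sup>-\<^sup>k + 2\<^sup>k D\<^sub>k\<^sup>2\<close>, so that the increments are absolutely summable there.
\<close>

lemma l2_fast_cauchy_converges_AE:
  assumes f: "\<And>k. f k \<in> l2_space M"
    and fast: "\<And>k. l2_norm M (\<lambda>x. f (Suc k) x - f k x) \<le> (1/4)^k"
  shows "AE x in M. convergent (\<lambda>k. f k x)"
proof -
  note [measurable] = l2_spaceD(1)[OF f]
  define D where "D k x = cmod (f (Suc k) x - f k x)" for k x
  have [measurable]: "D k \<in> borel_measurable M" for k unfolding D_def by measurable
  have le: "2^k * (l2_norm M (\<lambda>x. f (Suc k) x - f k x))\<^sup>2 \<le> (1/8)^k" for k
  proof -
    have "(l2_norm M (\<lambda>x. f (Suc k) x - f k x))\<^sup>2 \<le> ((1/4)^k)\<^sup>2"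
      by (rule power_mono[OF fast]) simp
    then have "2^k * (l2_norm M (\<lambda>x. f (Suc k) x - f k x))\<^sup>2 \<le> 2^k * ((1/4)^k)\<^sup>2" by simp
    also have "((1/4::real)^k)\<^sup>2 = (1/16)^k"
      unfolding power2_eq_square power_mult_distrib[symmetric] by simp
    also have "2^k * (1/16)^k = (1/8::real)^k"
      unfolding power_mult_distrib[symmetric] by simp
    finally show ?thesis .
  qed
  have "(\<integral>\<^sup>+x. (\<Sum>k. ennreal (2^k * (D k x)\<^sup>2)) \<partial>M) = (\<Sum>k. \<integral>\<^sup>+x. ennreal (2^k * (D k x)\<^sup>2) \<partial>M)"
    by (rule nn_integral_suminf) measurable
  also have "\<dots> = (\<Sum>k. ennreal (2^k * (l2_norm M (\<lambda>x. f (Suc k) x - f k x))\<^sup>2))"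
    using nn_integral_l2_norm[OF l2_diff[OF f f]]
    by (simp add: ennreal_mult' nn_integral_cmult D_def)
  also have "\<dots> \<le> (\<Sum>k. ennreal ((1/8)^k))"
    using le by (intro suminf_le) (auto intro: ennreal_leI)
  also have "\<dots> = ennreal (\<Sum>k. (1/8)^k)"
    by (rule suminf_ennreal2) (auto intro: summable_geometric)
  finally have "(\<integral>\<^sup>+x. (\<Sum>k. ennreal (2^k * (D k x)\<^sup>2)) \<partial>M) \<noteq> \<infinity>"
    by (auto simp: top_unique)
  then have "AE x in M. (\<Sum>k. ennreal (2^k * (D k x)\<^sup>2)) \<noteq> \<infinity>"
    by (intro nn_integral_PInf_AE) measurable
  then show ?thesis
  proof eventually_elim
    case (elim x)
    have s: "summable (\<lambda>k. 2^k * (D k x)\<^sup>2)"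
      using elim by (intro summable_suminf_not_top) auto
    have "summable (\<lambda>k. (1/2)^k + 2^k * (D k x)\<^sup>2)"
      by (intro summable_add s summable_geometric) simp
    moreover have "norm (f (Suc k) x - f k x) \<le> (1/2)^k + 2^k * (D k x)\<^sup>2" for k
    proof -
      define a where "a = 2^k * D k x"
      have "a \<le> 1 + a\<^sup>2" using sum_squares_bound[of a "1/2"] by (simp add: power2_eq_square)
      then have "(1/2)^k * a \<le> (1/2)^k * (1 + a\<^sup>2)" by (intro mult_left_mono) auto
      moreover have "(1/2)^k * a = D k x" by (simp add: a_def power_one_over)
      moreover have "(1/2)^k * (1 + a\<^sup>2) = (1/2)^k + 2^k * (D k x)\<^sup>2"
        by (simp add: a_def power_one_over power2_eq_square field_simps)
      ultimately show ?thesis by (simp add: D_def)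
    qed
    ultimately have "summable (\<lambda>k. f (Suc k) x - f k x)"
      by (rule summable_comparison_test'[where N = 0])
    then have "convergent (\<lambda>n. \<Sum>k<n. f (Suc k) x - f k x)" by (simp add: summable_iff_convergent)
    then have "convergent (\<lambda>n. (f n x - f 0 x) + f 0 x)"
      unfolding sum_lessThan_telescope[of "\<lambda>k. f k x"] by (intro convergent_add convergent_const)
    then show ?case by simp
  qed
qed

text \<open>
  A rapidly Cauchy subsequence converges almost everywhere, and Fatou's lemma turns the
  Cauchy estimates for it into estimates for the distance to the pointwise limit.
\<close>

lemma l2_complete:
  assumes f: "\<And>n. f n \<in> l2_space M"
    and cauchy: "\<And>e. e > 0 \<Longrightarrow> \<exists>N. \<forall>m\<ge>N. \<forall>n\<ge>N. l2_norm M (\<lambda>x. f m x - f n x) < e"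
  shows "\<exists>g\<in>l2_space M. (\<lambda>n. l2_norm M (\<lambda>x. f n x - g x)) \<longlonglongrightarrow> 0"
proof -
  have "\<forall>k. \<exists>N. \<forall>m\<ge>N. \<forall>n\<ge>N. l2_norm M (\<lambda>x. f m x - f n x) < (1/4)^k"
    using cauchy by simp
  then obtain N where N: "\<And>k m n. m \<ge> N k \<Longrightarrow> n \<ge> N k \<Longrightarrow> l2_norm M (\<lambda>x. f m x - f n x) < (1/4)^k"
    by metis
  \<comment> \<open>Summation makes the indices exceed all earlier thresholds; they need not be distinct.\<close>
  define r where "r k = (\<Sum>i\<le>k. N i)" for k
  have r: "N j \<le> r k" if "j \<le> k" for j k
    unfolding r_def using that by (intro member_le_sum) auto
  note [measurable] = l2_spaceD(1)[OF f]
  define g where "g x = lim (\<lambda>k. f (r k) x)" for x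
  have [measurable]: "g \<in> borel_measurable M" unfolding g_def by (rule borel_measurable_lim_metric) simp
  have AE: "AE x in M. (\<lambda>k. f (r k) x) \<longlonglongrightarrow> g x"
    using l2_fast_cauchy_converges_AE[of "\<lambda>k. f (r k)" M, OF f less_imp_le[OF N[OF r r]]]
    by (simp add: g_def convergent_LIMSEQ_iff)
  have close: "(\<lambda>x. f n x - g x) \<in> l2_space M \<and> l2_norm M (\<lambda>x. f n x - g x) \<le> (1/4)^j"
    if n: "n \<ge> N j" for n j
  proof -
    have "(\<integral>\<^sup>+x. ennreal ((cmod (f n x - g x))\<^sup>2) \<partial>M)
        = (\<integral>\<^sup>+x. liminf (\<lambda>k. ennreal ((cmod (f n x - f (r k) x))\<^sup>2)) \<partial>M)"
    proof (rule nn_integral_cong_AE)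
      show "AE x in M. ennreal ((cmod (f n x - g x))\<^sup>2)
          = liminf (\<lambda>k. ennreal ((cmod (f n x - f (r k) x))\<^sup>2))"
        using AE
      proof eventually_elim
        case (elim x)
        have "(\<lambda>k. ennreal ((cmod (f n x - f (r k) x))\<^sup>2)) \<longlonglongrightarrow> ennreal ((cmod (f n x - g x))\<^sup>2)"
          by (intro tendsto_intros tendsto_ennrealI elim)
        then show ?case by (intro lim_imp_Liminf[symmetric]) auto
      qed
    qed
    also have "\<dots> \<le> liminf (\<lambda>k. \<integral>\<^sup>+x. ennreal ((cmod (f n x - f (r k) x))\<^sup>2) \<partial>M)"
      by (rule nn_integral_liminf) measurable
    also have "\<dots> = liminf (\<lambda>k. ennreal ((l2_norm M (\<lambda>x. f n x - f (r k) x))\<^sup>2))"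
      by (simp add: nn_integral_l2_norm[OF l2_diff[OF f f]])
    also have "\<dots> \<le> liminf (\<lambda>k::nat. ennreal (((1/4)^j)\<^sup>2))"
    proof (rule Liminf_mono)
      show "\<forall>\<^sub>F k in sequentially. ennreal ((l2_norm M (\<lambda>x. f n x - f (r k) x))\<^sup>2)
          \<le> ennreal (((1/4)^j)\<^sup>2)"
        using eventually_ge_at_top[of j]
      proof eventually_elim
        case (elim k)
        show ?case
          using N[OF n r[OF elim]] by (intro ennreal_leI power_mono) auto
      qed
    qed
    also have "\<dots> = ennreal (((1/4)^j)\<^sup>2)" by (simp add: Liminf_const)
    finally show ?thesis
      using l2_norm_le_of_nn_integral[of "\<lambda>x. f n x - g x" M "(1/4)^j"] by simp
  qed
  have "(\<lambda>x. f (N 0) x - (f (N 0) x - g x)) \<in> l2_space M"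
    by (rule l2_diff[OF f]) (use close[of 0] in simp)
  then have "g \<in> l2_space M" by simp
  moreover have "(\<lambda>n. l2_norm M (\<lambda>x. f n x - g x)) \<longlonglongrightarrow> 0"
  proof (rule LIMSEQ_I)
    fix e :: real assume "e > 0"
    then obtain j where j: "(1/4::real)^j < e" using real_arch_pow_inv[of e "1/4"] by auto
    then have "\<forall>n\<ge>N j. norm (l2_norm M (\<lambda>x. f n x - g x) - 0) < e"
      using close[of j] by (auto intro: le_less_trans)
    then show "\<exists>N. \<forall>n\<ge>N. norm (l2_norm M (\<lambda>x. f n x - g x) - 0) < e" by blast
  qed
  ultimately show ?thesis by blast
qed

lemma l2_inner_tendsto_left:
  assumes "\<And>n. f n \<in> l2_space M" "g \<in> l2_space M" "h \<in> l2_space M"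
    and "(\<lambda>n. l2_norm M (\<lambda>x. f n x - g x)) \<longlonglongrightarrow> 0"
  shows "(\<lambda>n. l2_inner M (f n) h) \<longlonglongrightarrow> l2_inner M g h"
proof -
  have "(\<lambda>n. l2_inner M (f n) h - l2_inner M g h) \<longlonglongrightarrow> 0"
  proof (rule Lim_null_comparison)
    show "\<forall>\<^sub>F n in sequentially. norm (l2_inner M (f n) h - l2_inner M g h)
        \<le> l2_norm M (\<lambda>x. f n x - g x) * l2_norm M h"
      unfolding l2_inner_diff_left[OF assms(1,2,3), symmetric]
      by (intro always_eventually allI l2_cauchy_schwarz l2_diff assms)
    show "(\<lambda>n. l2_norm M (\<lambda>x. f n x - g x) * l2_norm M h) \<longlonglongrightarrow> 0"
      using tendsto_mult_right[OF assms(4)] by simp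
  qed
  then show ?thesis by (simp add: LIM_zero_iff)
qed

lemma zero_of_quadratic_bound:
  fixes w :: complex
  assumes "\<And>t. 0 \<le> 2 * Re (t * w) + (cmod t)\<^sup>2 * N" "N \<ge> 0"
  shows "w = 0"
proof (rule ccontr)
  assume w: "w \<noteq> 0"
  define s where "s = 1 / (1 + N)"
  have s: "s > 0" "s * N \<le> 1" using assms(2) by (auto simp: s_def)
  have "0 \<le> 2 * Re (- of_real s * cnj w * w) + (cmod (- of_real s * cnj w))\<^sup>2 * N"
    by (rule assms(1))
  also have "- of_real s * cnj w * w = of_real (- s * (cmod w)\<^sup>2)"
    by (simp only: of_real_mult complex_norm_square) simp
  also have "(cmod (- of_real s * cnj w))\<^sup>2 = s\<^sup>2 * (cmod w)\<^sup>2"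
    by (simp add: norm_mult power_mult_distrib)
  also have "2 * Re (of_real (- s * (cmod w)\<^sup>2)) + s\<^sup>2 * (cmod w)\<^sup>2 * N
      = s * (cmod w)\<^sup>2 * (s * N - 2)"
    by (simp add: power2_eq_square algebra_simps)
  finally have "0 \<le> s * (cmod w)\<^sup>2 * (s * N - 2)" .
  moreover have "s * (cmod w)\<^sup>2 * (s * N - 2) < 0"
    using s w by (intro mult_pos_neg mult_pos_pos) auto
  ultimately show False by simp
qed

text \<open>
  Minimising \<open>\<parallel>f\<parallel>\<^sup>2 - 2 Re (l f)\<close>: by the parallelogram law a minimising sequence is Cauchy, and the
  first-order condition at its limit says that the limit represents \<open>l\<close>.
\<close>

lemma l2_riesz_representation:
  fixes l :: "('a \<Rightarrow> complex) \<Rightarrow> complex"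
  assumes lin: "\<And>f g a b. f \<in> l2_space M \<Longrightarrow> g \<in> l2_space M \<Longrightarrow>
      l (\<lambda>x. a * f x + b * g x) = a * l f + b * l g"
    and bd: "\<And>f. f \<in> l2_space M \<Longrightarrow> cmod (l f) \<le> C * l2_norm M f"
  shows "\<exists>p\<in>l2_space M. \<forall>f\<in>l2_space M. l f = l2_inner M p f"
proof -
  define J where "J f = (l2_norm M f)\<^sup>2 - 2 * Re (l f)" for f
  have J_lower: "- C\<^sup>2 \<le> J f" if "f \<in> l2_space M" for f
  proof -
    have "Re (l f) \<le> C * l2_norm M f" using bd[OF that] complex_Re_le_cmod order.trans by blast
    moreover have "2 * C * l2_norm M f \<le> C\<^sup>2 + (l2_norm M f)\<^sup>2" by (rule sum_squares_bound)
    ultimately show ?thesis by (simp add: J_def)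
  qed
  define I where "I = Inf (J ` l2_space M)"
  have I_le: "I \<le> J f" if "f \<in> l2_space M" for f
    unfolding I_def using J_lower that by (intro cInf_lower) (auto simp: bdd_below_def)
  have "\<exists>f\<in>l2_space M. J f < I + 1 / real (Suc n)" for n
  proof -
    have "Inf (J ` l2_space M) < I + 1 / real (Suc n)" by (simp add: I_def)
    moreover have "J ` l2_space M \<noteq> {}" using l2_zero[of M] by blast
    ultimately obtain y where "y \<in> J ` l2_space M" "y < I + 1 / real (Suc n)"
      by (metis cInf_lessD)
    then show ?thesis by auto
  qed
  then have "\<forall>n. \<exists>f. f \<in> l2_space M \<and> J f < I + 1 / real (Suc n)" by blast
  from choice[OF this] obtain f
    where f: "\<And>n. f n \<in> l2_space M" and fJ: "\<And>n. J (f n) < I + 1 / real (Suc n)"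
    by blast
  have par: "(l2_norm M (\<lambda>x. f m x - f n x))\<^sup>2 \<le> 2 / real (Suc m) + 2 / real (Suc n)" for m n
  proof -
    define h where "h = (\<lambda>x. (1/2) * f m x + (1/2) * f n x)"
    have h: "h \<in> l2_space M" unfolding h_def by (rule l2_lincomb[OF f f])
    have "l2_norm M h = 1/2 * l2_norm M (\<lambda>x. f m x + 1 * f n x)"
      using l2_norm_scale[of M "1/2" "\<lambda>x. f m x + f n x"] by (simp add: h_def distrib_left)
    then have "(l2_norm M h)\<^sup>2 = (1/2 * l2_norm M (\<lambda>x. f m x + 1 * f n x))\<^sup>2" by (rule arg_cong)
    then have "4 * (l2_norm M h)\<^sup>2 = (l2_norm M (\<lambda>x. f m x + 1 * f n x))\<^sup>2"
      by (simp only: power_mult_distrib) (simp add: power2_eq_square)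
    moreover have "Re (l h) = (Re (l (f m)) + Re (l (f n))) / 2" unfolding h_def lin[OF f f] by simp
    ultimately have "4 * J h = (l2_norm M (\<lambda>x. f m x + 1 * f n x))\<^sup>2 - 4 * Re (l (f m)) - 4 * Re (l (f n))"
      by (simp add: J_def right_diff_distrib)
    moreover have "(l2_norm M (\<lambda>x. f m x + (-1) * f n x))\<^sup>2 + (l2_norm M (\<lambda>x. f m x + 1 * f n x))\<^sup>2
        = 2 * (l2_norm M (f m))\<^sup>2 + 2 * (l2_norm M (f n))\<^sup>2"
      unfolding l2_norm_lincomb_squared[OF f f] by simp
    ultimately have "(l2_norm M (\<lambda>x. f m x - f n x))\<^sup>2 = 2 * J (f m) + 2 * J (f n) - 4 * J h"
      by (simp add: J_def)
    also have "\<dots> \<le> 2 / real (Suc m) + 2 / real (Suc n)"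
      using fJ[of m] fJ[of n] I_le[OF h] by simp
    finally show ?thesis .
  qed
  have "\<exists>N. \<forall>m\<ge>N. \<forall>n\<ge>N. l2_norm M (\<lambda>x. f m x - f n x) < e" if e: "e > 0" for e
  proof -
    have e4: "e\<^sup>2 / 4 > 0" using e by simp
    obtain N where N: "1 / real (Suc N) < e\<^sup>2 / 4" using nat_approx_posE[OF e4] by metis
    have small: "1 / real (Suc m) < e\<^sup>2 / 4" if "m \<ge> N" for m
    proof -
      have "1 / real (Suc m) \<le> 1 / real (Suc N)" using that by (simp add: frac_le)
      then show ?thesis using N by simp
    qed
    have "l2_norm M (\<lambda>x. f m x - f n x) < e" if "m \<ge> N" "n \<ge> N" for m n
    proof -
      have "(l2_norm M (\<lambda>x. f m x - f n x))\<^sup>2 < e\<^sup>2"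
        using par[of m n] small[OF that(1)] small[OF that(2)] by simp
      then show ?thesis using e by (auto intro: power2_less_imp_less)
    qed
    then show ?thesis by blast
  qed
  from l2_complete[OF f this] obtain p where p: "p \<in> l2_space M"
    and lim: "(\<lambda>n. l2_norm M (\<lambda>x. f n x - p x)) \<longlonglongrightarrow> 0" by blast
  have "l h = l2_inner M p h" if h: "h \<in> l2_space M" for h
  proof -
    have "0 \<le> 2 * Re (t * (l2_inner M p h - l h)) + (cmod t)\<^sup>2 * (l2_norm M h)\<^sup>2" for t
    proof (rule LIMSEQ_le_const)
      show "\<exists>N. \<forall>n\<ge>N. 0 \<le> 2 * Re (t * (l2_inner M (f n) h - l h))
          + (cmod t)\<^sup>2 * (l2_norm M h)\<^sup>2 + 1 / real (Suc n)"
      proof (intro exI allI impI)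
        fix n :: nat
        have "I \<le> J (\<lambda>x. 1 * f n x + t * h x)" by (rule I_le[OF l2_lincomb[OF f h]])
        also have "\<dots> = J (f n) + 2 * Re (t * l2_inner M (f n) h) + (cmod t)\<^sup>2 * (l2_norm M h)\<^sup>2
            - 2 * Re (t * l h)"
          unfolding J_def lin[OF f h] using l2_norm_lincomb_squared[OF f h, of n t] by simp
        finally show "0 \<le> 2 * Re (t * (l2_inner M (f n) h - l h))
            + (cmod t)\<^sup>2 * (l2_norm M h)\<^sup>2 + 1 / real (Suc n)"
          using fJ[of n] by (simp add: right_diff_distrib)
      qed
      have "(\<lambda>n. 1 / real (Suc n)) \<longlonglongrightarrow> 0" using LIMSEQ_inverse_real_of_nat by (simp add: inverse_eq_divide)
      then have "(\<lambda>n. 2 * Re (t * (l2_inner M (f n) h - l h))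
          + (cmod t)\<^sup>2 * (l2_norm M h)\<^sup>2 + 1 / real (Suc n))
          \<longlonglongrightarrow> 2 * Re (t * (l2_inner M p h - l h)) + (cmod t)\<^sup>2 * (l2_norm M h)\<^sup>2 + 0"
        by (intro tendsto_intros l2_inner_tendsto_left[OF f p h lim])
      then show "(\<lambda>n. 2 * Re (t * (l2_inner M (f n) h - l h))
          + (cmod t)\<^sup>2 * (l2_norm M h)\<^sup>2 + 1 / real (Suc n))
          \<longlonglongrightarrow> 2 * Re (t * (l2_inner M p h - l h)) + (cmod t)\<^sup>2 * (l2_norm M h)\<^sup>2"
        by simp
    qed
    then have "l2_inner M p h - l h = 0" by (rule zero_of_quadratic_bound) simp
    then show ?thesis by simp
  qed
  with p show ?thesis by blast
qed

section \<open>Means on a set\<close>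

definition bounded_fun_on :: "'b set \<Rightarrow> ('b \<Rightarrow> real) \<Rightarrow> bool" where
  "bounded_fun_on B v \<longleftrightarrow> (\<exists>K. \<forall>x\<in>B. \<bar>v x\<bar> \<le> K)"

text \<open>
  Integration of bounded functions against a finitely additive probability measure on \<open>B\<close>.
\<close>

definition mean_on :: "'b set \<Rightarrow> (('b \<Rightarrow> real) \<Rightarrow> real) \<Rightarrow> bool" where
  "mean_on B m \<longleftrightarrow>
     (\<forall>v w a b. bounded_fun_on B v \<longrightarrow> bounded_fun_on B w \<longrightarrow>
        m (\<lambda>x. a * v x + b * w x) = a * m v + b * m w) \<and>
     (\<forall>v c. bounded_fun_on B v \<longrightarrow> (\<forall>x\<in>B. v x \<le> c) \<longrightarrow> m v \<le> c)"

lemma bounded_fun_on_lincomb: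
  assumes "bounded_fun_on B v" "bounded_fun_on B w"
  shows "bounded_fun_on B (\<lambda>x. a * v x + b * w x)"
proof -
  obtain K K' where "\<forall>x\<in>B. \<bar>v x\<bar> \<le> K" "\<forall>x\<in>B. \<bar>w x\<bar> \<le> K'"
    using assms unfolding bounded_fun_on_def by blast
  then have "\<bar>a * v x + b * w x\<bar> \<le> \<bar>a\<bar> * K + \<bar>b\<bar> * K'" if "x \<in> B" for x
    using that by (intro order.trans[OF abs_triangle_ineq] add_mono) (auto simp: abs_mult intro: mult_left_mono)
  then show ?thesis unfolding bounded_fun_on_def by blast
qed

text \<open>
  A Hahn-Banach theorem for the sublinear functional \<open>v \<mapsto> sup v(B)\<close>. A linear functional on a
  subspace is given by its graph \<open>L\<close>; a maximal dominated graph is defined on all bounded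
  functions, since otherwise there is room for a value \<open>\<alpha>\<close> at a further function.
\<close>

lemma extend_to_mean:
  fixes B :: "'b set" and L :: "(('b \<Rightarrow> real) \<times> real) set"
  assumes ne: "L \<noteq> {}"
    and lin: "\<And>v r w s a b. (v, r) \<in> L \<Longrightarrow> (w, s) \<in> L \<Longrightarrow> (\<lambda>x. a * v x + b * w x, a * r + b * s) \<in> L"
    and bdd: "\<And>v r. (v, r) \<in> L \<Longrightarrow> bounded_fun_on B v"
    and dom: "\<And>v r c. (v, r) \<in> L \<Longrightarrow> (\<forall>x\<in>B. v x \<le> c) \<Longrightarrow> r \<le> c"
  shows "\<exists>m. mean_on B m \<and> (\<forall>(v, r)\<in>L. m v = r)"
proof -
  define A where "A = {G. L \<subseteq> G \<and>
     (\<forall>v r w s a b. (v, r) \<in> G \<longrightarrow> (w, s) \<in> G \<longrightarrow> (\<lambda>x. a * v x + b * w x, a * r + b * s) \<in> G) \<and>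
     (\<forall>v r. (v, r) \<in> G \<longrightarrow> bounded_fun_on B v) \<and>
     (\<forall>v r c. (v, r) \<in> G \<longrightarrow> (\<forall>x\<in>B. v x \<le> c) \<longrightarrow> r \<le> c)}"
  have "L \<in> A" unfolding A_def using lin bdd dom by auto
  then have "A \<noteq> {}" by blast
  then have "\<exists>G\<in>A. \<forall>X\<in>A. G \<subseteq> X \<longrightarrow> X = G"
  proof (rule subset_Zorn_nonempty)
    fix \<C> assume ne: "\<C> \<noteq> {}" and ch: "subset.chain A \<C>"
    have sub: "\<C> \<subseteq> A" and tot: "\<And>X Y. X \<in> \<C> \<Longrightarrow> Y \<in> \<C> \<Longrightarrow> X \<subseteq> Y \<or> Y \<subseteq> X"
      using ch unfolding subset.chain_def by auto
    have "L \<subseteq> \<Union>\<C>" using ne sub unfolding A_def by blast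
    moreover have "(\<lambda>x. a * v x + b * w x, a * r + b * s) \<in> \<Union>\<C>"
      if "(v, r) \<in> \<Union>\<C>" "(w, s) \<in> \<Union>\<C>" for v r w s a b
    proof -
      obtain X Y where XY: "X \<in> \<C>" "Y \<in> \<C>" "(v, r) \<in> X" "(w, s) \<in> Y" using \<open>(v, r) \<in> \<Union>\<C>\<close> \<open>(w, s) \<in> \<Union>\<C>\<close> by blast
      then obtain Z where Z: "Z \<in> \<C>" "(v, r) \<in> Z" "(w, s) \<in> Z" using tot by blast
      then have "(\<lambda>x. a * v x + b * w x, a * r + b * s) \<in> Z" using sub unfolding A_def by blast
      then show ?thesis using Z by blast
    qed
    moreover have "bounded_fun_on B v" if "(v, r) \<in> \<Union>\<C>" for v r
      using that sub unfolding A_def by blast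
    moreover have "r \<le> c" if vr: "(v, r) \<in> \<Union>\<C>" and "\<forall>x\<in>B. v x \<le> c" for v r c
    proof -
      obtain Z where "Z \<in> A" "(v, r) \<in> Z" using vr sub by blast
      then show ?thesis using \<open>\<forall>x\<in>B. v x \<le> c\<close> unfolding A_def by simp
    qed
    ultimately show "\<Union>\<C> \<in> A" unfolding A_def by blast
  qed
  then obtain G where "G \<in> A" and max: "\<And>X. X \<in> A \<Longrightarrow> G \<subseteq> X \<Longrightarrow> X = G" by blast
  note G_A = \<open>G \<in> A\<close>[unfolded A_def mem_Collect_eq]
  have G_L: "L \<subseteq> G" using G_A by (rule conjunct1)
  have G_lin: "(\<lambda>x. a * v x + b * w x, a * r + b * s) \<in> G" if "(v, r) \<in> G" "(w, s) \<in> G" for v r w s a b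
    using conjunct1[OF conjunct2[OF G_A]] that by blast
  have G_bdd: "bounded_fun_on B v" if "(v, r) \<in> G" for v r
    using conjunct1[OF conjunct2[OF conjunct2[OF G_A]]] that by blast
  have G_dom: "r \<le> c" if "(v, r) \<in> G" "\<forall>x\<in>B. v x \<le> c" for v r c
    using conjunct2[OF conjunct2[OF conjunct2[OF G_A]]] that by simp
  have G_0: "(\<lambda>x. 0, 0) \<in> G"
  proof -
    obtain v r where "(v, r) \<in> G" using ne G_L by (metis ex_in_conv subsetD surj_pair)
    from G_lin[OF this this, of 0 0] show ?thesis by simp
  qed
  have single: "r \<le> s" if "(v, r) \<in> G" "(v, s) \<in> G" for v r s
    using G_dom[OF G_lin[OF that, of 1 "-1"], of 0] by simp
  have total: "\<exists>r. (v0, r) \<in> G" if v0: "bounded_fun_on B v0" for v0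
  proof -
    obtain K where K: "\<And>x. x \<in> B \<Longrightarrow> \<bar>v0 x\<bar> \<le> K" using v0 unfolding bounded_fun_on_def by blast
    \<comment> \<open>The lower bounds that domination on \<open>v - v0\<close> imposes on the value at \<open>v0\<close>.\<close>
    define S where "S = {r - c |v r c. (v, r) \<in> G \<and> (\<forall>x\<in>B. v x - v0 x \<le> c)}"
    have S_le: "y \<le> c' - r'" if "y \<in> S" "(v', r') \<in> G" "\<forall>x\<in>B. v' x + v0 x \<le> c'" for y v' r' c'
    proof -
      obtain v r c where y: "y = r - c" and vr: "(v, r) \<in> G" and le: "\<forall>x\<in>B. v x - v0 x \<le> c"
        using \<open>y \<in> S\<close> unfolding S_def by blast
      have "\<forall>x\<in>B. 1 * v x + 1 * v' x \<le> c + c'"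
      proof
        fix x assume "x \<in> B"
        then show "1 * v x + 1 * v' x \<le> c + c'"
          using bspec[OF le, of x] bspec[OF that(3), of x] by linarith
      qed
      from G_dom[OF G_lin[OF vr that(2)] this] y show ?thesis by simp
    qed
    have "- v0 x \<le> K" "v0 x \<le> K" if "x \<in> B" for x using K[OF that] by auto
    then have "\<forall>x\<in>B. (0::real) - v0 x \<le> K" "\<forall>x\<in>B. (0::real) + v0 x \<le> K" by auto
    moreover from this(1) have "0 - K \<in> S" unfolding S_def using G_0 by blast
    ultimately have "0 - K \<in> S" "\<forall>x\<in>B. (0::real) + v0 x \<le> K" by auto
    then have S_ne: "S \<noteq> {}" and "bdd_above S"
      using S_le[OF _ G_0] unfolding bdd_above_def by blast+
    define \<alpha> where "\<alpha> = Sup S"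
    have \<alpha>_up: "r + \<alpha> \<le> c" if "(v, r) \<in> G" "\<forall>x\<in>B. v x + v0 x \<le> c" for v r c
      using cSup_least[OF S_ne, of "c - r"] S_le[OF _ that] by (simp add: \<alpha>_def algebra_simps)
    have \<alpha>_low: "r - \<alpha> \<le> c" if "(v, r) \<in> G" "\<forall>x\<in>B. v x - v0 x \<le> c" for v r c
    proof -
      have "r - c \<in> S" unfolding S_def using that by blast
      from cSup_upper[OF this \<open>bdd_above S\<close>] show ?thesis by (simp add: \<alpha>_def algebra_simps)
    qed
    define G' where "G' = {(\<lambda>x. v x + t * v0 x, r + t * \<alpha>) |v r t. (v, r) \<in> G}"
    have G'_I: "(\<lambda>x. v x + t * v0 x, r + t * \<alpha>) \<in> G'" if "(v, r) \<in> G" for v r t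
      unfolding G'_def using that by blast
    have "G \<subseteq> G'"
    proof
      fix y assume "y \<in> G"
      then show "y \<in> G'" using G'_I[of "fst y" "snd y" 0] by simp
    qed
    moreover have "G' \<in> A" unfolding A_def mem_Collect_eq
    proof (intro conjI allI impI)
      show "L \<subseteq> G'" using G_L \<open>G \<subseteq> G'\<close> by blast
    next
      fix v r w s a b assume "(v, r) \<in> G'" "(w, s) \<in> G'"
      then obtain v1 r1 t w1 s1 u where
        1: "v = (\<lambda>x. v1 x + t * v0 x)" "r = r1 + t * \<alpha>" "(v1, r1) \<in> G" and
        2: "w = (\<lambda>x. w1 x + u * v0 x)" "s = s1 + u * \<alpha>" "(w1, s1) \<in> G"
        unfolding G'_def by blast
      have "(\<lambda>x. a * v x + b * w x) = (\<lambda>x. (a * v1 x + b * w1 x) + (a * t + b * u) * v0 x)"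
        "a * r + b * s = (a * r1 + b * s1) + (a * t + b * u) * \<alpha>"
        unfolding 1 2 by (simp_all add: algebra_simps)
      then show "(\<lambda>x. a * v x + b * w x, a * r + b * s) \<in> G'"
        using G'_I[OF G_lin[OF 1(3) 2(3), of a b], of "a * t + b * u"] by (simp only:)
    next
      fix v r assume "(v, r) \<in> G'"
      then obtain v1 r1 t where 1: "v = (\<lambda>x. v1 x + t * v0 x)" "(v1, r1) \<in> G"
        unfolding G'_def by blast
      show "bounded_fun_on B v"
        using bounded_fun_on_lincomb[OF G_bdd[OF 1(2)] v0, of 1 t] by (simp add: 1(1))
    next
      fix v r c assume "(v, r) \<in> G'" and le: "\<forall>x\<in>B. v x \<le> c"
      then obtain v1 r1 t where v: "v = (\<lambda>x. v1 x + t * v0 x)" and r: "r = r1 + t * \<alpha>"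
        and G1: "(v1, r1) \<in> G"
        unfolding G'_def by blast
      have scaled: "(\<lambda>x. d * v1 x, d * r1) \<in> G" for d using G_lin[OF G1 G_0, of d 0] by simp
      consider "t = 0" | "t > 0" | "t < 0" by linarith
      then show "r \<le> c"
      proof cases
        case 1
        then show ?thesis using G_dom[OF G1] le by (simp add: v r)
      next
        case 2
        have "\<forall>x\<in>B. (1/t) * v1 x + v0 x \<le> c / t"
        proof
          fix x assume "x \<in> B"
          then have "(v1 x + t * v0 x) / t \<le> c / t" using le 2 by (intro divide_right_mono) (auto simp: v)
          moreover have "(v1 x + t * v0 x) / t = (1/t) * v1 x + v0 x" using 2 by (simp add: field_simps)
          ultimately show "(1/t) * v1 x + v0 x \<le> c / t" by simp
        qed
        from \<alpha>_up[OF scaled this] have "((1/t) * r1 + \<alpha>) * t \<le> c / t * t"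
          using 2 by (intro mult_right_mono) auto
        moreover have "((1/t) * r1 + \<alpha>) * t = r" "c / t * t = c"
          using 2 by (simp_all add: r field_simps)
        ultimately show ?thesis by simp
      next
        case 3
        have "\<forall>x\<in>B. (1/(-t)) * v1 x - v0 x \<le> c / (-t)"
        proof
          fix x assume "x \<in> B"
          then have "(v1 x + t * v0 x) / (-t) \<le> c / (-t)" using le 3 by (intro divide_right_mono) (auto simp: v)
          moreover have "(v1 x + t * v0 x) / (-t) = (1/(-t)) * v1 x - v0 x" using 3 by (simp add: field_simps)
          ultimately show "(1/(-t)) * v1 x - v0 x \<le> c / (-t)" by simp
        qed
        from \<alpha>_low[OF scaled this] have "((1/(-t)) * r1 - \<alpha>) * (-t) \<le> c / (-t) * (-t)"
          using 3 by (intro mult_right_mono) auto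
        moreover have "((1/(-t)) * r1 - \<alpha>) * (-t) = r" "c / (-t) * (-t) = c"
          using 3 by (simp_all add: r field_simps)
        ultimately show ?thesis by simp
      qed
    qed
    ultimately have "G' = G" using max by blast
    moreover have "(v0, \<alpha>) \<in> G'" using G'_I[OF G_0, of 1] by simp
    ultimately show ?thesis by blast
  qed
  define m where "m v = (SOME r. (v, r) \<in> G)" for v
  have m: "(v, m v) \<in> G" if "bounded_fun_on B v" for v
    unfolding m_def using total[OF that] by (rule someI_ex)
  have m_eq: "m v = r" if "(v, r) \<in> G" for v r
    using single[OF that m] single[OF m that] G_bdd[OF that] by (simp add: order.antisym)
  have "mean_on B m" unfolding mean_on_def
  proof (intro conjI allI impI)
    fix v w a b assume "bounded_fun_on B v" "bounded_fun_on B w"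
    then show "m (\<lambda>x. a * v x + b * w x) = a * m v + b * m w"
      by (intro m_eq G_lin m)
  next
    fix v c assume "bounded_fun_on B v" "\<forall>x\<in>B. v x \<le> c"
    then show "m v \<le> c" using G_dom m by blast
  qed
  moreover have "\<forall>(v, r)\<in>L. m v = r" using m_eq G_L by auto
  ultimately show ?thesis by blast
qed

lemma mean_on_lincomb:
  "mean_on B m \<Longrightarrow> bounded_fun_on B v \<Longrightarrow> bounded_fun_on B w \<Longrightarrow>
    m (\<lambda>x. a * v x + b * w x) = a * m v + b * m w"
  unfolding mean_on_def by blast

lemma mean_on_le: "mean_on B m \<Longrightarrow> bounded_fun_on B v \<Longrightarrow> (\<And>x. x \<in> B \<Longrightarrow> v x \<le> c) \<Longrightarrow> m v \<le> c"
  unfolding mean_on_def by blast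

lemma mean_on_mono:
  assumes "mean_on B m" "bounded_fun_on B v" "bounded_fun_on B w" "\<And>x. x \<in> B \<Longrightarrow> v x \<le> w x"
  shows "m v \<le> m w"
  using mean_on_lincomb[OF assms(1-3), of 1 "-1"]
    mean_on_le[OF assms(1) bounded_fun_on_lincomb[OF assms(2,3), of 1 "-1"], of 0] assms(4)
  by simp

definition complex_mean :: "(('b \<Rightarrow> real) \<Rightarrow> real) \<Rightarrow> ('b \<Rightarrow> complex) \<Rightarrow> complex" where
  "complex_mean m u = Complex (m (\<lambda>x. Re (u x))) (m (\<lambda>x. Im (u x)))"

lemma bounded_fun_on_Re_Im:
  assumes "bounded_fun_on B (\<lambda>x. cmod (u x))"
  shows "bounded_fun_on B (\<lambda>x. Re (u x))" "bounded_fun_on B (\<lambda>x. Im (u x))"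
  using assms unfolding bounded_fun_on_def
  by (meson abs_norm_cancel abs_Re_le_cmod abs_Im_le_cmod order.trans abs_ge_self)+

lemma bounded_fun_on_cmod_lincomb:
  assumes "bounded_fun_on B (\<lambda>x. cmod (u x))" "bounded_fun_on B (\<lambda>x. cmod (v x))"
  shows "bounded_fun_on B (\<lambda>x. cmod (a * u x + b * v x))"
proof -
  obtain K where K: "\<forall>x\<in>B. \<bar>cmod a * cmod (u x) + cmod b * cmod (v x)\<bar> \<le> K"
    using bounded_fun_on_lincomb[OF assms, of "cmod a" "cmod b"] unfolding bounded_fun_on_def by blast
  have "\<bar>cmod (a * u x + b * v x)\<bar> \<le> \<bar>cmod a * cmod (u x) + cmod b * cmod (v x)\<bar>" for x
    using norm_triangle_ineq[of "a * u x" "b * v x"] by (simp add: norm_mult)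
  with K show ?thesis unfolding bounded_fun_on_def by (meson order.trans)
qed

lemma complex_mean_lincomb:
  assumes m: "mean_on B m"
    and u: "bounded_fun_on B (\<lambda>x. cmod (u x))" and v: "bounded_fun_on B (\<lambda>x. cmod (v x))"
  shows "complex_mean m (\<lambda>x. a * u x + b * v x) = a * complex_mean m u + b * complex_mean m v"
proof -
  note [simp] = bounded_fun_on_Re_Im[OF u] bounded_fun_on_Re_Im[OF v]
  have four: "m (\<lambda>x. (p * f x + q * g x) + (r * f' x + s * g' x))
      = (p * m f + q * m g) + (r * m f' + s * m g')"
    if "bounded_fun_on B f" "bounded_fun_on B g" "bounded_fun_on B f'" "bounded_fun_on B g'"
    for p q r s f g f' g'
    using mean_on_lincomb[OF m bounded_fun_on_lincomb[OF that(1,2), of p q]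
        bounded_fun_on_lincomb[OF that(3,4), of r s], of 1 1]
      mean_on_lincomb[OF m that(1,2), of p q] mean_on_lincomb[OF m that(3,4), of r s] by simp
  have "(\<lambda>x. Re (a * u x + b * v x))
      = (\<lambda>x. (Re a * Re (u x) + (- Im a) * Im (u x)) + (Re b * Re (v x) + (- Im b) * Im (v x)))"
    "(\<lambda>x. Im (a * u x + b * v x))
      = (\<lambda>x. (Re a * Im (u x) + Im a * Re (u x)) + (Re b * Im (v x) + Im b * Re (v x)))"
    by (auto simp: algebra_simps)
  then show ?thesis
    unfolding complex_mean_def by (simp only: four bounded_fun_on_Re_Im[OF u] bounded_fun_on_Re_Im[OF v])
      (simp add: complex_eq_iff)
qed

lemma complex_mean_cnj:
  assumes m: "mean_on B m" and u: "bounded_fun_on B (\<lambda>x. cmod (u x))"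
  shows "complex_mean m (\<lambda>x. cnj (u x)) = cnj (complex_mean m u)"
  using mean_on_lincomb[OF m bounded_fun_on_Re_Im(2)[OF u] bounded_fun_on_Re_Im(2)[OF u], of "-1" 0]
  by (simp add: complex_mean_def complex_eq_iff)

lemma complex_mean_of_real:
  assumes m: "mean_on B m" and v: "bounded_fun_on B v"
  shows "complex_mean m (\<lambda>x. of_real (v x)) = of_real (m v)"
  using mean_on_lincomb[OF m v v, of 0 0] by (simp add: complex_mean_def complex_eq_iff)

text \<open>
  Multiplying \<open>u\<close> by a phase makes its mean real and nonnegative, and the mean is monotone.
\<close>

lemma cmod_complex_mean_le:
  assumes m: "mean_on B m" and u: "bounded_fun_on B (\<lambda>x. cmod (u x))" and v: "bounded_fun_on B v"
    and le: "\<And>x. x \<in> B \<Longrightarrow> cmod (u x) \<le> v x"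
  shows "cmod (complex_mean m u) \<le> m v"
proof -
  define z where "z = complex_mean m u"
  define a where "a = (if z = 0 then 0 else cnj z / of_real (cmod z))"
  have a: "cmod a \<le> 1" "a * z = of_real (cmod z)"
    using complex_norm_square[of z] by (auto simp: a_def norm_divide power2_eq_square field_simps)
  have "complex_mean m (\<lambda>x. a * u x) = a * z"
    using complex_mean_lincomb[OF m u u, of a 0] by (simp add: z_def)
  then have "cmod z = m (\<lambda>x. Re (a * u x))" using a(2) by (simp add: complex_mean_def complex_eq_iff)
  also have "\<dots> \<le> m v"
  proof (rule mean_on_mono[OF m _ v])
    have "bounded_fun_on B (\<lambda>x. cmod (a * u x))"
      using bounded_fun_on_cmod_lincomb[OF u u, of a 0] by simp
    then show "bounded_fun_on B (\<lambda>x. Re (a * u x))" by (rule bounded_fun_on_Re_Im)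
    fix x assume "x \<in> B"
    have "Re (a * u x) \<le> cmod a * cmod (u x)" by (metis complex_Re_le_cmod norm_mult)
    also have "\<dots> \<le> cmod (u x)" using mult_right_mono[OF a(1), of "cmod (u x)"] by simp
    finally show "Re (a * u x) \<le> v x" using le[OF \<open>x \<in> B\<close>] by simp
  qed
  finally show ?thesis by (simp add: z_def)
qed

lemma complex_mean_cong:
  assumes m: "mean_on B m" and u: "bounded_fun_on B (\<lambda>x. cmod (u x))"
    and eq: "\<And>x. x \<in> B \<Longrightarrow> u x = u' x"
  shows "complex_mean m u = complex_mean m u'"
proof -
  have u': "bounded_fun_on B (\<lambda>x. cmod (u' x))" using u eq by (simp add: bounded_fun_on_def)
  have b0: "bounded_fun_on B (\<lambda>x. 0)" by (auto simp: bounded_fun_on_def)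
  have "cmod (complex_mean m (\<lambda>x. 1 * u x + (-1) * u' x)) \<le> m (\<lambda>x. 0)"
    by (rule cmod_complex_mean_le[OF m bounded_fun_on_cmod_lincomb[OF u u'] b0]) (simp add: eq)
  also have "\<dots> = 0" using mean_on_lincomb[OF m b0 b0, of 0 0] by simp
  finally show ?thesis unfolding complex_mean_lincomb[OF m u u'] by simp
qed

section \<open>Bounded operators and rank-one operators\<close>

lemma bounded_opsD:
  assumes "T \<in> bounded_ops M"
  shows "f \<in> l2_space M \<Longrightarrow> T f \<in> l2_space M"
    and "f \<in> l2_space M \<Longrightarrow> g \<in> l2_space M \<Longrightarrow>
      AE x in M. T (\<lambda>y. a * f y + b * g y) x = a * T f x + b * T g x"
    and "\<exists>C. \<forall>f\<in>l2_space M. l2_norm M (T f) \<le> C * l2_norm M f"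
proof -
  note * = assms[unfolded bounded_ops_def mem_Collect_eq]
  show "f \<in> l2_space M \<Longrightarrow> T f \<in> l2_space M" using * by (auto simp: Pi_iff)
  show "f \<in> l2_space M \<Longrightarrow> g \<in> l2_space M \<Longrightarrow>
      AE x in M. T (\<lambda>y. a * f y + b * g y) x = a * T f x + b * T g x"
    using conjunct1[OF conjunct2[OF *]] by simp
  show "\<exists>C. \<forall>f\<in>l2_space M. l2_norm M (T f) \<le> C * l2_norm M f" using * by blast
qed

lemma l2_inner_op_lincomb:
  assumes T: "T \<in> bounded_ops M" and f: "f \<in> l2_space M" and g: "g \<in> l2_space M"
    and h: "h \<in> l2_space M"
  shows "l2_inner M h (T (\<lambda>y. a * f y + b * g y)) = a * l2_inner M h (T f) + b * l2_inner M h (T g)"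
proof -
  note l2 = bounded_opsD(1)[OF T f] bounded_opsD(1)[OF T g]
  have "l2_inner M h (T (\<lambda>y. a * f y + b * g y)) = l2_inner M h (\<lambda>x. a * T f x + b * T g x)"
    using bounded_opsD(2)[OF T f g] l2_spaceD(1)[OF h] l2_spaceD(1)[OF l2_lincomb[OF l2]]
      l2_spaceD(1)[OF bounded_opsD(1)[OF T l2_lincomb[OF f g]]]
    by (intro l2_inner_cong_AE) auto
  then show ?thesis by (simp add: l2_inner_lincomb_right[OF l2 h])
qed

lemma l2_norm_op_lincomb:
  assumes T: "T \<in> bounded_ops M" and f: "f \<in> l2_space M" and g: "g \<in> l2_space M"
  shows "l2_norm M (T (\<lambda>y. a * f y + b * g y)) = l2_norm M (\<lambda>x. a * T f x + b * T g x)"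
  by (rule l2_norm_cong_AE[OF bounded_opsD(2)[OF T f g]])
    (intro l2_spaceD(1) l2_lincomb bounded_opsD(1)[OF T] f g)+

lemma op_norm_le:
  assumes "C \<ge> 0" "\<And>f. f \<in> l2_space M \<Longrightarrow> l2_norm M (T f) \<le> C * l2_norm M f"
  shows "op_norm M T \<le> C"
  unfolding op_norm_def
proof (rule cSUP_least)
  show "{f \<in> l2_space M. l2_norm M f \<le> 1} \<noteq> {}" using l2_zero[of M] by force
  fix f assume "f \<in> {f \<in> l2_space M. l2_norm M f \<le> 1}"
  then have "f \<in> l2_space M" "l2_norm M f \<le> 1" by auto
  then have "l2_norm M (T f) \<le> C * l2_norm M f" "C * l2_norm M f \<le> C"
    using assms mult_left_mono[of "l2_norm M f" 1 C] by auto
  then show "l2_norm M (T f) \<le> C" by simp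
qed

lemma op_norm_upper:
  assumes T: "T \<in> bounded_ops M" and f: "f \<in> l2_space M" "l2_norm M f \<le> 1"
  shows "l2_norm M (T f) \<le> op_norm M T"
proof -
  obtain C where C: "\<And>f. f \<in> l2_space M \<Longrightarrow> l2_norm M (T f) \<le> C * l2_norm M f"
    using bounded_opsD(3)[OF T] by blast
  have "l2_norm M (T f) \<le> \<bar>C\<bar>" if "f \<in> l2_space M" "l2_norm M f \<le> 1" for f
  proof -
    have "C * l2_norm M f \<le> \<bar>C\<bar> * 1" using that by (intro mult_mono) auto
    then show ?thesis using C[OF that(1)] by simp
  qed
  then have "bdd_above ((\<lambda>f. l2_norm M (T f)) ` {f \<in> l2_space M. l2_norm M f \<le> 1})"
    by (auto simp: bdd_above_def)
  then show ?thesis unfolding op_norm_def using f by (intro cSUP_upper) auto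
qed

lemma op_norm_nonneg:
  assumes "T \<in> bounded_ops M"
  shows "0 \<le> op_norm M T"
  using order.trans[OF l2_norm_nonneg op_norm_upper[OF assms l2_zero]] by simp

lemma op_norm_bound:
  assumes T: "T \<in> bounded_ops M" and f: "f \<in> l2_space M"
  shows "l2_norm M (T f) \<le> op_norm M T * l2_norm M f"
proof (cases "l2_norm M f = 0")
  case True
  obtain C where "l2_norm M (T f) \<le> C * l2_norm M f" using bounded_opsD(3)[OF T] f by blast
  then show ?thesis using True by simp
next
  case False
  define s where "s = l2_norm M f"
  have s: "s > 0" using False unfolding s_def by (simp add: order.not_eq_order_implies_strict)
  let ?f = "\<lambda>x. of_real (1/s) * f x + 0 * f x"
  have "l2_norm M ?f \<le> 1" using l2_norm_scale[of M "of_real (1/s)" f] s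
    by (simp add: s_def norm_divide)
  then have "l2_norm M (T ?f) \<le> op_norm M T" by (rule op_norm_upper[OF T l2_lincomb[OF f f]])
  moreover have "l2_norm M (T ?f) = l2_norm M (T f) / s"
    using l2_norm_op_lincomb[OF T f f, of "of_real (1/s)" 0] l2_norm_scale[of M "of_real (1/s)" "T f"] s
    by (simp add: norm_divide)
  ultimately show ?thesis using s by (simp add: field_simps s_def)
qed

lemma l2_inner_op_bound:
  assumes T: "T \<in> bounded_ops M" and f: "f \<in> l2_space M" and g: "g \<in> l2_space M"
  shows "cmod (l2_inner M f (T g)) \<le> op_norm M T * (l2_norm M f * l2_norm M g)"
proof -
  have "cmod (l2_inner M f (T g)) \<le> l2_norm M f * l2_norm M (T g)"
    by (rule l2_cauchy_schwarz[OF f bounded_opsD(1)[OF T g]])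
  also have "\<dots> \<le> l2_norm M f * (op_norm M T * l2_norm M g)"
    by (rule mult_left_mono[OF op_norm_bound[OF T g]]) simp
  finally show ?thesis by (simp add: mult_ac)
qed

lemma bounded_opsI:
  assumes "\<And>f. f \<in> l2_space M \<Longrightarrow> T f \<in> l2_space M"
    and "\<And>f g a b. f \<in> l2_space M \<Longrightarrow> g \<in> l2_space M \<Longrightarrow>
      AE x in M. T (\<lambda>y. a * f y + b * g y) x = a * T f x + b * T g x"
    and "\<And>f. f \<in> l2_space M \<Longrightarrow> l2_norm M (T f) \<le> C * l2_norm M f"
  shows "T \<in> bounded_ops M"
  unfolding bounded_ops_def mem_Collect_eq
proof (intro conjI ballI allI)
  show "\<exists>C. \<forall>f\<in>l2_space M. l2_norm M (T f) \<le> C * l2_norm M f" using assms(3) by blast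
qed (use assms(1,2) in auto)

lemma op_lincomb_bound:
  assumes T: "T \<in> bounded_ops M" and U: "U \<in> bounded_ops M" and f: "f \<in> l2_space M"
  shows "l2_norm M (\<lambda>x. a * T f x + b * U f x)
    \<le> (cmod a * op_norm M T + cmod b * op_norm M U) * l2_norm M f"
proof -
  have "l2_norm M (\<lambda>x. a * T f x + b * U f x) \<le> l2_norm M (\<lambda>x. a * T f x) + l2_norm M (\<lambda>x. b * U f x)"
    by (intro l2_norm_triangle l2_scale bounded_opsD(1)[OF T f] bounded_opsD(1)[OF U f])
  also have "\<dots> \<le> cmod a * (op_norm M T * l2_norm M f) + cmod b * (op_norm M U * l2_norm M f)"
    unfolding l2_norm_scale
    by (intro add_mono mult_left_mono op_norm_bound T U f) auto
  finally show ?thesis by (simp add: algebra_simps)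
qed

lemma bounded_ops_lincomb:
  assumes T: "T \<in> bounded_ops M" and U: "U \<in> bounded_ops M"
  shows "(\<lambda>\<xi> x. a * T \<xi> x + b * U \<xi> x) \<in> bounded_ops M"
proof (rule bounded_opsI)
  fix f assume f: "f \<in> l2_space M"
  show "(\<lambda>x. a * T f x + b * U f x) \<in> l2_space M" by (intro l2_lincomb bounded_opsD(1)[OF T f] bounded_opsD(1)[OF U f])
  show "l2_norm M (\<lambda>x. a * T f x + b * U f x)
    \<le> (cmod a * op_norm M T + cmod b * op_norm M U) * l2_norm M f"
    by (rule op_lincomb_bound[OF T U f])
next
  fix f g c d assume f: "f \<in> l2_space M" and g: "g \<in> l2_space M"
  show "AE x in M. a * T (\<lambda>y. c * f y + d * g y) x + b * U (\<lambda>y. c * f y + d * g y) x =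
      c * (a * T f x + b * U f x) + d * (a * T g x + b * U g x)"
    using bounded_opsD(2)[OF T f g, of c d] bounded_opsD(2)[OF U f g, of c d]
    by eventually_elim (simp add: algebra_simps)
qed

lemma op_norm_lincomb:
  assumes T: "T \<in> bounded_ops M" and U: "U \<in> bounded_ops M"
  shows "op_norm M (\<lambda>\<xi> x. a * T \<xi> x + b * U \<xi> x) \<le> cmod a * op_norm M T + cmod b * op_norm M U"
  using op_norm_nonneg[OF T] op_norm_nonneg[OF U]
  by (intro op_norm_le op_lincomb_bound T U add_nonneg_nonneg mult_nonneg_nonneg norm_ge_zero)

lemma op_norm_scale_le:
  assumes T: "T \<in> bounded_ops M"
  shows "op_norm M (\<lambda>\<xi> x. a * T \<xi> x) \<le> cmod a * op_norm M T"
  using op_norm_lincomb[OF T T, of a 0] by simp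

lemma bounded_ops_diff:
  "T \<in> bounded_ops M \<Longrightarrow> U \<in> bounded_ops M \<Longrightarrow> (\<lambda>\<xi> x. T \<xi> x - U \<xi> x) \<in> bounded_ops M"
  using bounded_ops_lincomb[of T M U 1 "-1"] by simp

lemma op_norm_triangle:
  "T \<in> bounded_ops M \<Longrightarrow> U \<in> bounded_ops M \<Longrightarrow>
    op_norm M (\<lambda>\<xi> x. T \<xi> x + U \<xi> x) \<le> op_norm M T + op_norm M U"
  using op_norm_lincomb[of T M U 1 1] by simp

lemma op_norm_triangle_via:
  assumes "T \<in> bounded_ops M" "U \<in> bounded_ops M" "W \<in> bounded_ops M"
  shows "op_norm M (\<lambda>\<xi> x. T \<xi> x - W \<xi> x)
    \<le> op_norm M (\<lambda>\<xi> x. T \<xi> x - U \<xi> x) + op_norm M (\<lambda>\<xi> x. U \<xi> x - W \<xi> x)"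
  using op_norm_triangle[OF bounded_ops_diff[OF assms(1,2)] bounded_ops_diff[OF assms(2,3)]] by simp

lemma bounded_op_adjoint:
  assumes T: "T \<in> bounded_ops M" and p: "p \<in> l2_space M"
  shows "\<exists>q\<in>l2_space M. \<forall>f\<in>l2_space M. l2_inner M p (T f) = l2_inner M q f"
proof (rule l2_riesz_representation)
  fix f assume f: "f \<in> l2_space M"
  show "cmod (l2_inner M p (T f)) \<le> (op_norm M T * l2_norm M p) * l2_norm M f"
    using l2_inner_op_bound[OF T p f] by (simp add: mult_ac)
qed (rule l2_inner_op_lincomb[OF T _ _ p])

definition rank1 :: "'a measure \<Rightarrow> ('a \<Rightarrow> complex) \<Rightarrow> ('a \<Rightarrow> complex) \<Rightarrow> 'a l2_op" where
  "rank1 M f g = (\<lambda>\<xi> x. f x * l2_inner M g \<xi>)"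

lemma rank1_l2: "f \<in> l2_space M \<Longrightarrow> rank1 M f g \<xi> \<in> l2_space M"
  unfolding rank1_def using l2_scale[of f M "l2_inner M g \<xi>"] by (simp add: mult.commute)

lemma l2_norm_rank1: "l2_norm M (rank1 M f g \<xi>) = cmod (l2_inner M g \<xi>) * l2_norm M f"
  unfolding rank1_def using l2_norm_scale[of M "l2_inner M g \<xi>" f] by (simp add: mult.commute)

lemma l2_norm_rank1_le:
  "g \<in> l2_space M \<Longrightarrow> \<xi> \<in> l2_space M \<Longrightarrow>
    l2_norm M (rank1 M f g \<xi>) \<le> (l2_norm M f * l2_norm M g) * l2_norm M \<xi>"
  unfolding l2_norm_rank1
  using mult_right_mono[OF l2_cauchy_schwarz[of g M \<xi>] l2_norm_nonneg[of M f]] by (simp add: mult_ac)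

lemma l2_inner_rank1: "l2_inner M h (rank1 M f g \<xi>) = l2_inner M h f * l2_inner M g \<xi>"
  unfolding rank1_def using l2_inner_scale_right[of M h "l2_inner M g \<xi>" f] by (simp add: mult.commute)

lemma rank1_bounded:
  assumes f: "f \<in> l2_space M" and g: "g \<in> l2_space M"
  shows "rank1 M f g \<in> bounded_ops M"
proof (rule bounded_opsI[OF rank1_l2[OF f] _ l2_norm_rank1_le[OF g]])
  fix h k a b assume "h \<in> l2_space M" "k \<in> l2_space M"
  then show "AE x in M. rank1 M f g (\<lambda>y. a * h y + b * k y) x
      = a * rank1 M f g h x + b * rank1 M f g k x"
    unfolding rank1_def l2_inner_lincomb_right[OF \<open>h \<in> l2_space M\<close> \<open>k \<in> l2_space M\<close> g]
    by (simp add: algebra_simps)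
qed

lemma positive_rank1: "positive_op M (rank1 M f f)"
  unfolding positive_op_def l2_inner_rank1
proof
  fix h
  have "l2_inner M h f * l2_inner M f h = of_real ((cmod (l2_inner M f h))\<^sup>2)"
    by (subst l2_inner_commute[of M h f]) (simp add: complex_norm_square[symmetric] mult.commute)
  then show "l2_inner M h f * l2_inner M f h \<in> \<real>\<^sub>\<ge>\<^sub>0" by simp
qed

lemma rank1_compact:
  assumes f: "f \<in> l2_space M" and g: "g \<in> l2_space M"
  shows "rank1 M f g \<in> compact_ops M"
proof -
  have "\<exists>k\<in>l2_space M. \<exists>r. strict_mono r \<and>
      (\<lambda>n. l2_norm M (\<lambda>x. rank1 M f g (h (r n)) x - k x)) \<longlonglongrightarrow> 0"
    if h: "\<And>n. h n \<in> l2_space M \<and> l2_norm M (h n) \<le> 1" for h :: "nat \<Rightarrow> 'a \<Rightarrow> complex"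
  proof -
    have "cmod (l2_inner M g (h n)) \<le> l2_norm M g" for n
      using l2_cauchy_schwarz[OF g, of "h n"] mult_left_mono[of "l2_norm M (h n)" 1 "l2_norm M g"] h[of n]
      by simp
    then have "bounded (range (\<lambda>n. l2_inner M g (h n)))" by (auto simp: bounded_iff)
    then obtain z r where r: "strict_mono r" and z: "((\<lambda>n. l2_inner M g (h n)) \<circ> r) \<longlonglongrightarrow> z"
      using bounded_imp_convergent_subsequence by blast
    have "l2_norm M (\<lambda>x. rank1 M f g (h (r n)) x - z * f x) = cmod (l2_inner M g (h (r n)) - z) * l2_norm M f" for n
      unfolding rank1_def l2_norm_scale[symmetric] by (simp add: algebra_simps)
    moreover have "(\<lambda>n. cmod (l2_inner M g (h (r n)) - z) * l2_norm M f) \<longlonglongrightarrow> cmod (z - z) * l2_norm M f"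
      using z unfolding comp_def by (intro tendsto_intros)
    ultimately have "(\<lambda>n. l2_norm M (\<lambda>x. rank1 M f g (h (r n)) x - z * f x)) \<longlonglongrightarrow> 0" by simp
    then show ?thesis using r l2_scale[OF f, of z]
      by (intro bexI[of _ "\<lambda>x. z * f x"] exI[of _ r] conjI)
  qed
  then show ?thesis unfolding compact_ops_def using rank1_bounded[OF f g] by blast
qed

lemma compact_ops_bounded: "T \<in> compact_ops M \<Longrightarrow> T \<in> bounded_ops M"
  by (simp add: compact_ops_def)

lemma compact_opsD:
  fixes f :: "nat \<Rightarrow> 'a \<Rightarrow> complex"
  assumes "T \<in> compact_ops M" "\<And>n. f n \<in> l2_space M" "\<And>n. l2_norm M (f n) \<le> 1"
  obtains g r where "g \<in> l2_space M" "strict_mono (r :: nat \<Rightarrow> nat)"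
    "(\<lambda>n. l2_norm M (\<lambda>x. T (f (r n)) x - g x)) \<longlonglongrightarrow> 0"
  using assms unfolding compact_ops_def by blast

lemma compact_ops_lincomb:
  assumes T: "T \<in> compact_ops M" and U: "U \<in> compact_ops M"
  shows "(\<lambda>\<xi> x. a * T \<xi> x + b * U \<xi> x) \<in> compact_ops M"
proof -
  have "\<exists>k\<in>l2_space M. \<exists>r. strict_mono r \<and>
      (\<lambda>n. l2_norm M (\<lambda>x. (a * T (h (r n)) x + b * U (h (r n)) x) - k x)) \<longlonglongrightarrow> 0"
    if h: "\<And>n. h n \<in> l2_space M \<and> l2_norm M (h n) \<le> 1" for h :: "nat \<Rightarrow> 'a \<Rightarrow> complex"
  proof -
    obtain g1 r1 where g1: "g1 \<in> l2_space M" and r1: "strict_mono r1"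
      and lim1: "(\<lambda>n. l2_norm M (\<lambda>x. T (h (r1 n)) x - g1 x)) \<longlonglongrightarrow> 0"
      using compact_opsD[OF T, of h] h by blast
    obtain g2 r2 where g2: "g2 \<in> l2_space M" and r2: "strict_mono r2"
      and lim2: "(\<lambda>n. l2_norm M (\<lambda>x. U (h (r1 (r2 n))) x - g2 x)) \<longlonglongrightarrow> 0"
      using compact_opsD[OF U, of "\<lambda>n. h (r1 n)"] h by blast
    let ?r = "\<lambda>n. r1 (r2 n)"
    have r: "strict_mono ?r" using strict_mono_o[OF r1 r2] by (simp add: comp_def)
    have lim1': "(\<lambda>n. l2_norm M (\<lambda>x. T (h (?r n)) x - g1 x)) \<longlonglongrightarrow> 0"
      using LIMSEQ_subseq_LIMSEQ[OF lim1 r2] by (simp add: comp_def)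
    have "(\<lambda>n. l2_norm M (\<lambda>x. (a * T (h (?r n)) x + b * U (h (?r n)) x) - (a * g1 x + b * g2 x))) \<longlonglongrightarrow> 0"
    proof (rule Lim_null_comparison)
      show "(\<lambda>n. cmod a * l2_norm M (\<lambda>x. T (h (?r n)) x - g1 x)
          + cmod b * l2_norm M (\<lambda>x. U (h (?r n)) x - g2 x)) \<longlonglongrightarrow> 0"
        using tendsto_add[OF tendsto_mult_left[OF lim1', of "cmod a"] tendsto_mult_left[OF lim2, of "cmod b"]]
        by simp
      show "\<forall>\<^sub>F n in sequentially. norm (l2_norm M (\<lambda>x. (a * T (h (?r n)) x + b * U (h (?r n)) x) - (a * g1 x + b * g2 x)))
        \<le> cmod a * l2_norm M (\<lambda>x. T (h (?r n)) x - g1 x) + cmod b * l2_norm M (\<lambda>x. U (h (?r n)) x - g2 x)"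
      proof (intro always_eventually allI)
        fix n
        have "(\<lambda>x. T (h (?r n)) x - g1 x) \<in> l2_space M" "(\<lambda>x. U (h (?r n)) x - g2 x) \<in> l2_space M"
          using h
          by (auto intro!: l2_diff g1 g2 bounded_opsD(1)[OF compact_ops_bounded[OF T]]
              bounded_opsD(1)[OF compact_ops_bounded[OF U]])
        from l2_norm_triangle[OF l2_scale[OF this(1), of a] l2_scale[OF this(2), of b]]
        have "l2_norm M (\<lambda>x. a * (T (h (?r n)) x - g1 x) + b * (U (h (?r n)) x - g2 x))
          \<le> cmod a * l2_norm M (\<lambda>x. T (h (?r n)) x - g1 x) + cmod b * l2_norm M (\<lambda>x. U (h (?r n)) x - g2 x)"
          by (simp only: l2_norm_scale)
        moreover have "(\<lambda>x. a * (T (h (?r n)) x - g1 x) + b * (U (h (?r n)) x - g2 x))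
            = (\<lambda>x. (a * T (h (?r n)) x + b * U (h (?r n)) x) - (a * g1 x + b * g2 x))"
          by (auto simp: algebra_simps)
        ultimately show "norm (l2_norm M (\<lambda>x. (a * T (h (?r n)) x + b * U (h (?r n)) x) - (a * g1 x + b * g2 x)))
          \<le> cmod a * l2_norm M (\<lambda>x. T (h (?r n)) x - g1 x) + cmod b * l2_norm M (\<lambda>x. U (h (?r n)) x - g2 x)"
          by simp
      qed
    qed
    then show ?thesis using r l2_lincomb[OF g1 g2, of a b]
      by (intro bexI[of _ "\<lambda>x. a * g1 x + b * g2 x"] exI[of _ ?r] conjI)
  qed
  then show ?thesis
    unfolding compact_ops_def
    using bounded_ops_lincomb[OF compact_ops_bounded[OF T] compact_ops_bounded[OF U]] by blast
qed

section \<open>Operator spaces and positive functionals\<close>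

definition op_space :: "'a measure \<Rightarrow> 'a l2_op set \<Rightarrow> bool" where
  "op_space M S \<longleftrightarrow> S \<noteq> {} \<and> S \<subseteq> bounded_ops M \<and>
     (\<forall>T\<in>S. \<forall>U\<in>S. \<forall>a b. (\<lambda>\<xi> x. a * T \<xi> x + b * U \<xi> x) \<in> S)"

lemma op_space_bounded: "op_space M S \<Longrightarrow> T \<in> S \<Longrightarrow> T \<in> bounded_ops M"
  by (auto simp: op_space_def)

lemma op_space_lincomb:
  assumes "op_space M S" "T \<in> S" "U \<in> S"
  shows "(\<lambda>\<xi> x. a * T \<xi> x + b * U \<xi> x) \<in> S"
  by (rule assms(1)[unfolded op_space_def, THEN conjunct2, THEN conjunct2, rule_format, OF assms(2,3)])

lemma op_space_scale: "op_space M S \<Longrightarrow> T \<in> S \<Longrightarrow> (\<lambda>\<xi> x. a * T \<xi> x) \<in> S"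
  using op_space_lincomb[of M S T T a 0] by (simp only: mult_zero_left add_0_right)

lemma op_space_add: "op_space M S \<Longrightarrow> T \<in> S \<Longrightarrow> U \<in> S \<Longrightarrow> (\<lambda>\<xi> x. T \<xi> x + U \<xi> x) \<in> S"
  using op_space_lincomb[of M S T U 1 1] by (simp only: mult_1)

lemma op_space_diff: "op_space M S \<Longrightarrow> T \<in> S \<Longrightarrow> U \<in> S \<Longrightarrow> (\<lambda>\<xi> x. T \<xi> x - U \<xi> x) \<in> S"
  using op_space_lincomb[of M S T U 1 "-1"] by (simp only: mult_1 mult_minus1 add_uminus_conv_diff)

lemma op_space_zero:
  assumes "op_space M S"
  shows "(\<lambda>\<xi> x. 0) \<in> S"
proof -
  obtain T where "T \<in> S" using assms by (auto simp: op_space_def)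
  from op_space_lincomb[OF assms this this, of 0 0] show ?thesis by (simp only: mult_zero_left add_0_right)
qed

definition linear_functional_on :: "'a l2_op set \<Rightarrow> ('a l2_op \<Rightarrow> complex) \<Rightarrow> bool" where
  "linear_functional_on S \<phi> \<longleftrightarrow>
     (\<forall>T\<in>S. \<forall>U\<in>S. \<forall>a b. \<phi> (\<lambda>\<xi> x. a * T \<xi> x + b * U \<xi> x) = a * \<phi> T + b * \<phi> U)"

lemma functional_lincomb:
  assumes "linear_functional_on S \<phi>" "T \<in> S" "U \<in> S"
  shows "\<phi> (\<lambda>\<xi> x. a * T \<xi> x + b * U \<xi> x) = a * \<phi> T + b * \<phi> U"
  by (rule assms(1)[unfolded linear_functional_on_def, rule_format, OF assms(2,3)])

lemma functional_scale:
  "linear_functional_on S \<phi> \<Longrightarrow> T \<in> S \<Longrightarrow> \<phi> (\<lambda>\<xi> x. a * T \<xi> x) = a * \<phi> T"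
  using functional_lincomb[of S \<phi> T T a 0] by (simp only: mult_zero_left add_0_right)

lemma functional_add:
  "linear_functional_on S \<phi> \<Longrightarrow> T \<in> S \<Longrightarrow> U \<in> S \<Longrightarrow> \<phi> (\<lambda>\<xi> x. T \<xi> x + U \<xi> x) = \<phi> T + \<phi> U"
  using functional_lincomb[of S \<phi> T U 1 1] by (simp only: mult_1)

lemma functional_diff:
  "linear_functional_on S \<phi> \<Longrightarrow> T \<in> S \<Longrightarrow> U \<in> S \<Longrightarrow> \<phi> (\<lambda>\<xi> x. T \<xi> x - U \<xi> x) = \<phi> T - \<phi> U"
  using functional_lincomb[of S \<phi> T U 1 "-1"]
  by (simp only: mult_1 mult_minus1 add_uminus_conv_diff)

definition quasi_state :: "'a measure \<Rightarrow> 'a l2_op set \<Rightarrow> ('a l2_op \<Rightarrow> complex) \<Rightarrow> bool" where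
  "quasi_state M S \<phi> \<longleftrightarrow> linear_functional_on S \<phi> \<and>
     (\<forall>T\<in>S. positive_op M T \<longrightarrow> \<phi> T \<in> \<real>\<^sub>\<ge>\<^sub>0) \<and> (\<forall>T\<in>S. cmod (\<phi> T) \<le> op_norm M T)"

text \<open>
  By scaling. Where the seminorm vanishes, so does the functional, being bounded by some multiple
  of the seminorm.
\<close>

lemma functional_le_op_norm:
  assumes S: "op_space M S" and lin: "linear_functional_on S \<phi>"
    and C: "\<And>T. T \<in> S \<Longrightarrow> cmod (\<phi> T) \<le> C * op_norm M T"
    and sup: "(SUP T\<in>{T \<in> S. op_norm M T \<le> 1}. cmod (\<phi> T)) \<le> 1"
    and T: "T \<in> S"
  shows "cmod (\<phi> T) \<le> op_norm M T"
proof (cases "op_norm M T = 0")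
  case True
  then show ?thesis using C[OF T] by simp
next
  case False
  define s where "s = op_norm M T"
  have s: "s > 0" using False op_norm_nonneg[OF op_space_bounded[OF S T]] by (simp add: s_def)
  have bdd: "bdd_above ((\<lambda>T. cmod (\<phi> T)) ` {T \<in> S. op_norm M T \<le> 1})"
  proof (rule bdd_aboveI2)
    fix U assume "U \<in> {T \<in> S. op_norm M T \<le> 1}"
    then have U: "U \<in> S" "op_norm M U \<le> 1" by auto
    have "C * op_norm M U \<le> \<bar>C\<bar> * 1"
      using U op_norm_nonneg[OF op_space_bounded[OF S U(1)]] by (intro mult_mono) auto
    then show "cmod (\<phi> U) \<le> \<bar>C\<bar>" using C[OF U(1)] by simp
  qed
  let ?U = "\<lambda>\<xi> x. of_real (1/s) * T \<xi> x"
  have "op_norm M ?U \<le> cmod (of_real (1/s)) * op_norm M T"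
    by (rule op_norm_scale_le[OF op_space_bounded[OF S T]])
  then have "op_norm M ?U \<le> 1" using s by (simp add: s_def norm_divide)
  then have "cmod (\<phi> ?U) \<le> (SUP T\<in>{T \<in> S. op_norm M T \<le> 1}. cmod (\<phi> T))"
    by (intro cSUP_upper[OF _ bdd] CollectI conjI op_space_scale[OF S T])
  then have "cmod (\<phi> ?U) \<le> 1" using sup by simp
  moreover have "\<phi> ?U = of_real (1/s) * \<phi> T" by (rule functional_scale[OF lin T])
  ultimately have "cmod (\<phi> T) / s \<le> 1" using s by (simp add: norm_mult norm_divide)
  then show ?thesis using s by (simp add: s_def)
qed

lemma states_iff:
  "\<phi> \<in> states M S \<longleftrightarrow> \<phi> \<in> extensional S \<and> linear_functional_on S \<phi> \<and>
     (\<forall>T\<in>S. positive_op M T \<longrightarrow> \<phi> T \<in> \<real>\<^sub>\<ge>\<^sub>0) \<and>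
     (\<exists>C. \<forall>T\<in>S. cmod (\<phi> T) \<le> C * op_norm M T) \<and>
     (SUP T\<in>{T \<in> S. op_norm M T \<le> 1}. cmod (\<phi> T)) = 1"
  unfolding states_def linear_functional_on_def mem_Collect_eq by (rule refl)

lemma states_imp_quasi_state:
  assumes S: "op_space M S" and \<phi>: "\<phi> \<in> states M S"
  shows "quasi_state M S \<phi>"
proof -
  note \<phi>' = \<phi>[unfolded states_iff]
  then have lin: "linear_functional_on S \<phi>" by blast
  obtain C where C: "\<And>T. T \<in> S \<Longrightarrow> cmod (\<phi> T) \<le> C * op_norm M T"
    using \<phi>' by blast
  have "cmod (\<phi> T) \<le> op_norm M T" if "T \<in> S" for T
    using \<phi>' by (intro functional_le_op_norm[OF S lin C _ that]) auto
  then show ?thesis using \<phi>' unfolding quasi_state_def by blast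
qed

lemma quasi_stateD:
  assumes "quasi_state M S \<phi>"
  shows "linear_functional_on S \<phi>"
    and "T \<in> S \<Longrightarrow> positive_op M T \<Longrightarrow> \<phi> T \<in> \<real>\<^sub>\<ge>\<^sub>0"
    and "T \<in> S \<Longrightarrow> cmod (\<phi> T) \<le> op_norm M T"
  using assms unfolding quasi_state_def by auto

lemma quasi_state_le_1:
  assumes "quasi_state M S \<phi>" "T \<in> S" "op_norm M T \<le> 1"
  shows "cmod (\<phi> T) \<le> 1"
  using quasi_stateD(3)[OF assms(1,2)] assms(3) by simp

lemma bdd_above_quasi_state:
  assumes "quasi_state M S \<phi>"
  shows "bdd_above ((\<lambda>T. cmod (\<phi> T)) ` {T \<in> S. op_norm M T \<le> 1})"
  using quasi_state_le_1[OF assms] by (intro bdd_aboveI2[where M = 1]) simp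

lemma op_norm_zero: "op_norm M (\<lambda>\<xi> x. 0) \<le> 0"
  by (rule op_norm_le) auto

lemma states_norm_attained:
  assumes S: "op_space M S" and \<phi>: "\<phi> \<in> states M S" and e: "e < 1"
  shows "\<exists>T\<in>S. op_norm M T \<le> 1 \<and> e < cmod (\<phi> T)"
proof -
  have "e < (SUP T\<in>{T \<in> S. op_norm M T \<le> 1}. cmod (\<phi> T))" using \<phi> e by (simp add: states_iff)
  moreover have "{T \<in> S. op_norm M T \<le> 1} \<noteq> {}"
    using op_space_zero[OF S] op_norm_zero[of M] by force
  ultimately show ?thesis
    using less_cSUP_iff[OF _ bdd_above_quasi_state[OF states_imp_quasi_state[OF S \<phi>]], of e] by auto
qed

lemma statesI:
  assumes S: "op_space M S" and q: "quasi_state M S \<phi>" and ext: "\<phi> \<in> extensional S"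
    and att: "\<And>e. e < 1 \<Longrightarrow> \<exists>T\<in>S. op_norm M T \<le> 1 \<and> e < cmod (\<phi> T)"
  shows "\<phi> \<in> states M S"
proof -
  have ne: "{T \<in> S. op_norm M T \<le> 1} \<noteq> {}"
    using op_space_zero[OF S] op_norm_zero[of M] by force
  have "(SUP T\<in>{T \<in> S. op_norm M T \<le> 1}. cmod (\<phi> T)) = 1"
  proof (rule antisym)
    show "(SUP T\<in>{T \<in> S. op_norm M T \<le> 1}. cmod (\<phi> T)) \<le> 1"
      using quasi_state_le_1[OF q] by (intro cSUP_least[OF ne]) auto
    show "1 \<le> (SUP T\<in>{T \<in> S. op_norm M T \<le> 1}. cmod (\<phi> T))"
    proof (rule dense_le)
      fix e :: real assume "e < 1"
      from att[OF this] obtain T where "T \<in> S" "op_norm M T \<le> 1" "e < cmod (\<phi> T)" by blast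
      then show "e \<le> (SUP T\<in>{T \<in> S. op_norm M T \<le> 1}. cmod (\<phi> T))"
        by (intro cSUP_upper2[where x = T, OF bdd_above_quasi_state[OF q]]) auto
    qed
  qed
  moreover have "\<exists>C. \<forall>T\<in>S. cmod (\<phi> T) \<le> C * op_norm M T"
    using q unfolding quasi_state_def by (intro exI[of _ 1]) simp
  ultimately show ?thesis
    using q ext unfolding states_iff quasi_state_def by blast
qed

lemma quasi_state_restrict:
  assumes S: "op_space M S" and q: "quasi_state M S \<phi>"
  shows "quasi_state M S (restrict \<phi> S)"
  unfolding quasi_state_def linear_functional_on_def
proof (intro conjI ballI allI impI)
  fix T U a b assume "T \<in> S" "U \<in> S"
  then show "restrict \<phi> S (\<lambda>\<xi> x. a * T \<xi> x + b * U \<xi> x) = a * restrict \<phi> S T + b * restrict \<phi> S U"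
    by (simp only: restrict_apply' op_space_lincomb[OF S] functional_lincomb[OF quasi_stateD(1)[OF q]])
next
  fix T assume "T \<in> S" "positive_op M T"
  then show "restrict \<phi> S T \<in> \<real>\<^sub>\<ge>\<^sub>0"
    by (simp only: restrict_apply' quasi_stateD(2)[OF q])
next
  fix T assume "T \<in> S"
  then show "cmod (restrict \<phi> S T) \<le> op_norm M T"
    by (simp only: restrict_apply' quasi_stateD(3)[OF q])
qed

text \<open>
  If a state is a proper convex combination of quasi-states, then these have norm one: otherwise
  the combination would have norm less than one.
\<close>

lemma convex_component_is_state:
  assumes S: "op_space M S" and \<phi>: "\<phi> \<in> states M S"
    and q1: "quasi_state M S \<phi>1" and q2: "quasi_state M S \<phi>2" and t: "0 < t" "t < 1"
    and comb: "\<And>T. T \<in> S \<Longrightarrow> \<phi> T = of_real t * \<phi>1 T + of_real (1 - t) * \<phi>2 T"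
  shows "restrict \<phi>1 S \<in> states M S"
proof (rule statesI[OF S quasi_state_restrict[OF S q1]])
  fix e :: real assume e: "e < 1"
  have "1 - t * (1 - e) < 1" using e t by simp
  from states_norm_attained[OF S \<phi> this]
  obtain T where T: "T \<in> S" "op_norm M T \<le> 1" "1 - t * (1 - e) < cmod (\<phi> T)" by blast
  have "cmod (\<phi> T) \<le> t * cmod (\<phi>1 T) + (1 - t) * cmod (\<phi>2 T)"
  proof -
    have "0 < 1 - t" using t by simp
    then have "cmod (of_real t * \<phi>1 T) = t * cmod (\<phi>1 T)"
      "cmod (of_real (1 - t) * \<phi>2 T) = (1 - t) * cmod (\<phi>2 T)"
      using t by (simp_all only: norm_mult norm_of_real abs_of_pos)
    then show ?thesis unfolding comb[OF T(1)] by (metis norm_triangle_ineq)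
  qed
  also have "\<dots> \<le> t * cmod (\<phi>1 T) + (1 - t) * 1"
    using quasi_state_le_1[OF q2 T(1,2)] t by (intro add_left_mono mult_left_mono) auto
  finally have "t * e < t * cmod (\<phi>1 T)" using T(3) by (simp add: algebra_simps)
  then have "e < cmod (\<phi>1 T)" using t by simp
  then show "\<exists>T\<in>S. op_norm M T \<le> 1 \<and> e < cmod (restrict \<phi>1 S T)" using T by auto
qed simp

lemma pure_state_convex_component:
  assumes S: "op_space M S" and \<phi>: "\<phi> \<in> pure_states M S"
    and q1: "quasi_state M S \<phi>1" and q2: "quasi_state M S \<phi>2" and t: "0 < t" "t < 1"
    and comb: "\<And>T. T \<in> S \<Longrightarrow> \<phi> T = of_real t * \<phi>1 T + of_real (1 - t) * \<phi>2 T"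
    and T: "T \<in> S"
  shows "\<phi>1 T = \<phi> T" "\<phi>2 T = \<phi> T"
proof -
  have \<phi>': "\<phi> \<in> states M S" using \<phi> by (simp add: pure_states_def)
  have s1: "restrict \<phi>1 S \<in> states M S"
    by (rule convex_component_is_state[OF S \<phi>' q1 q2 t comb])
  have s2: "restrict \<phi>2 S \<in> states M S"
  proof (rule convex_component_is_state[OF S \<phi>' q2 q1, of "1 - t"])
    fix T assume "T \<in> S"
    then show "\<phi> T = of_real (1 - t) * \<phi>2 T + of_real (1 - (1 - t)) * \<phi>1 T" using comb by simp
  qed (use t in auto)
  have "\<forall>T\<in>S. \<phi> T = of_real t * restrict \<phi>1 S T + of_real (1 - t) * restrict \<phi>2 S T"
    by (intro ballI) (simp only: restrict_apply' comb)
  with t have "0 < t \<and> t < 1 \<and> (\<forall>T\<in>S. \<phi> T = of_real t * restrict \<phi>1 S T + of_real (1 - t) * restrict \<phi>2 S T)"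
    by (intro conjI)
  from \<phi>[unfolded pure_states_def mem_Collect_eq, THEN conjunct2, rule_format, OF s1 s2 this]
  have "restrict \<phi>1 S = \<phi> \<and> restrict \<phi>2 S = \<phi>" .
  then show "\<phi>1 T = \<phi> T" "\<phi>2 T = \<phi> T" using T by (metis restrict_apply')+
qed

lemma vector_functional_quasi_state:
  assumes S: "op_space M S" and p: "p \<in> l2_space M" "l2_norm M p \<le> 1"
  shows "quasi_state M S (\<lambda>T. l2_inner M p (T p))"
  unfolding quasi_state_def linear_functional_on_def
proof (intro conjI ballI allI impI)
  fix T U a b assume "T \<in> S" "U \<in> S"
  then show "l2_inner M p (\<lambda>x. a * T p x + b * U p x) = a * l2_inner M p (T p) + b * l2_inner M p (U p)"
    by (intro l2_inner_lincomb_right bounded_opsD(1)[OF op_space_bounded[OF S] p(1)] p(1))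
next
  fix T assume "T \<in> S" "positive_op M T"
  then show "l2_inner M p (T p) \<in> \<real>\<^sub>\<ge>\<^sub>0" using p unfolding positive_op_def by blast
next
  fix T assume "T \<in> S"
  then have T: "T \<in> bounded_ops M" by (rule op_space_bounded[OF S])
  have "cmod (l2_inner M p (T p)) \<le> op_norm M T * (l2_norm M p * l2_norm M p)"
    by (rule l2_inner_op_bound[OF T p(1) p(1)])
  also have "\<dots> \<le> op_norm M T * (1 * 1)"
    using p by (intro mult_left_mono mult_mono op_norm_nonneg[OF T]) auto
  finally show "cmod (l2_inner M p (T p)) \<le> op_norm M T" by simp
qed

text \<open>
  Operators are functions on all of \<open>'a \<Rightarrow> complex\<close>, while only their values on square-integrable
  functions are meaningful. Identities such as the antilinearity of \<open>rank1\<close> in its second argument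
  hold for the latter only, and a quasi-state does not see the difference.
\<close>

lemma functional_cong:
  assumes S: "op_space M S" and q: "quasi_state M S \<phi>" and T: "T \<in> S" and U: "U \<in> S"
    and eq: "\<And>\<xi>. \<xi> \<in> l2_space M \<Longrightarrow> T \<xi> = U \<xi>"
  shows "\<phi> T = \<phi> U"
proof -
  have "op_norm M (\<lambda>\<xi> x. T \<xi> x - U \<xi> x) \<le> 0" by (rule op_norm_le) (auto simp: eq)
  moreover have "cmod (\<phi> (\<lambda>\<xi> x. T \<xi> x - U \<xi> x)) \<le> op_norm M (\<lambda>\<xi> x. T \<xi> x - U \<xi> x)"
    using q op_space_diff[OF S T U] unfolding quasi_state_def by blast
  moreover have "\<phi> (\<lambda>\<xi> x. T \<xi> x - U \<xi> x) = \<phi> T - \<phi> U"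
    using q T U unfolding quasi_state_def by (intro functional_diff) auto
  ultimately show ?thesis
    by (metis order.trans norm_le_zero_iff right_minus_eq)
qed

inductive_set rank_span :: "'a measure \<Rightarrow> (('a \<Rightarrow> complex) \<times> ('a \<Rightarrow> complex)) set \<Rightarrow> 'a l2_op set"
  for M G where
  rank_span_zero: "(\<lambda>\<xi> x. 0) \<in> rank_span M G"
| rank_span_add: "(f, g) \<in> G \<Longrightarrow> T \<in> rank_span M G \<Longrightarrow>
    (\<lambda>\<xi> x. rank1 M f g \<xi> x + T \<xi> x) \<in> rank_span M G"

lemma rank_span_sum:
  assumes "finite I" "\<And>i. i \<in> I \<Longrightarrow> (f i, g i) \<in> G"
  shows "(\<lambda>\<xi> x. \<Sum>i\<in>I. rank1 M (f i) (g i) \<xi> x) \<in> rank_span M G"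
  using assms by (induction I rule: finite_induct) (auto intro: rank_span.intros)

text \<open>
  Density of the span is what makes a bounded functional on \<open>S\<close> determined by its values at the
  rank-one operators given by \<open>G\<close>.
\<close>

definition rank1_generated ::
    "'a measure \<Rightarrow> 'a l2_op set \<Rightarrow> (('a \<Rightarrow> complex) \<times> ('a \<Rightarrow> complex)) set \<Rightarrow> bool" where
  "rank1_generated M S G \<longleftrightarrow> op_space M S \<and> (\<forall>(f, g)\<in>G. rank1 M f g \<in> S) \<and>
     (\<forall>T\<in>S. \<forall>\<delta>>0. \<exists>R\<in>rank_span M G. op_norm M (\<lambda>\<xi> x. T \<xi> x - R \<xi> x) < \<delta>)"

lemma rank_span_subset:
  assumes "op_space M S" "\<And>f g. (f, g) \<in> G \<Longrightarrow> rank1 M f g \<in> S" "T \<in> rank_span M G"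
  shows "T \<in> S"
  using assms(3)
  by induction (auto intro: op_space_add[OF assms(1)] op_space_zero[OF assms(1)] assms(2))

lemma functionals_proportional_if_on_generators:
  assumes gen: "rank1_generated M S G"
    and q1: "quasi_state M S \<phi>" and q2: "quasi_state M S \<phi>'"
    and eq: "\<And>f g. (f, g) \<in> G \<Longrightarrow> \<phi> (rank1 M f g) = c * \<phi>' (rank1 M f g)"
    and T: "T \<in> S"
  shows "\<phi> T = c * \<phi>' T"
proof -
  have S: "op_space M S" and G: "\<And>f g. (f, g) \<in> G \<Longrightarrow> rank1 M f g \<in> S"
    using gen unfolding rank1_generated_def by auto
  have l1: "linear_functional_on S \<phi>" and l2: "linear_functional_on S \<phi>'"
    and b1: "\<And>T. T \<in> S \<Longrightarrow> cmod (\<phi> T) \<le> op_norm M T"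
    and b2: "\<And>T. T \<in> S \<Longrightarrow> cmod (\<phi>' T) \<le> op_norm M T"
    using q1 q2 unfolding quasi_state_def by auto
  note sub = rank_span_subset[OF S G]
  have span: "\<phi> R = c * \<phi>' R" if "R \<in> rank_span M G" for R
    using that
  proof induction
    case rank_span_zero
    then show ?case
      using functional_lincomb[OF l1 T T, of 0 0] functional_lincomb[OF l2 T T, of 0 0] by simp
  next
    case (rank_span_add f g R)
    then show ?case
      using eq G sub
      by (simp add: functional_add[OF l1] functional_add[OF l2] distrib_left)
  qed
  have "cmod (\<phi> T - c * \<phi>' T) \<le> \<delta>" if \<delta>: "\<delta> > 0" for \<delta>
  proof -
    define \<eta> where "\<eta> = \<delta> / (1 + cmod c)"
    have c: "1 + cmod c > 0" by (simp add: add_pos_nonneg)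
    then have "\<eta> > 0" using \<delta> by (simp add: \<eta>_def)
    then obtain R where R: "R \<in> rank_span M G" and small: "op_norm M (\<lambda>\<xi> x. T \<xi> x - R \<xi> x) < \<eta>"
      using gen T unfolding rank1_generated_def by blast
    have RS: "R \<in> S" and D: "(\<lambda>\<xi> x. T \<xi> x - R \<xi> x) \<in> S"
      using sub[OF _ R] op_space_diff[OF S T] by auto
    have "\<phi> T - c * \<phi>' T = \<phi> (\<lambda>\<xi> x. T \<xi> x - R \<xi> x) - c * \<phi>' (\<lambda>\<xi> x. T \<xi> x - R \<xi> x)"
      using span[OF R]
      by (simp add: functional_diff[OF l1 T RS] functional_diff[OF l2 T RS] algebra_simps)
    also have "cmod \<dots> \<le> \<eta> + cmod c * \<eta>"
      using b1[OF D] b2[OF D] small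
      by (intro order.trans[OF norm_triangle_ineq4] add_mono) (auto simp: norm_mult intro!: mult_left_mono)
    also have "\<dots> = (1 + cmod c) * \<eta>" by (simp add: algebra_simps)
    also have "\<dots> = \<delta>" using c unfolding \<eta>_def by simp
    finally show ?thesis .
  qed
  then have "cmod (\<phi> T - c * \<phi>' T) \<le> 0" by (rule field_le_epsilon[of _ 0, simplified])
  then show ?thesis by simp
qed

section \<open>Density of compactly supported continuous functions\<close>

definition l2_on :: "'a measure \<Rightarrow> 'a set \<Rightarrow> ('a \<Rightarrow> complex) set" where
  "l2_on M U = {f \<in> l2_space M. \<forall>x. x \<notin> U \<longrightarrow> f x = 0}"

lemma l2_on_l2: "f \<in> l2_on M U \<Longrightarrow> f \<in> l2_space M"
  by (simp add: l2_on_def)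

lemma l2_on_mono: "U \<subseteq> V \<Longrightarrow> l2_on M U \<subseteq> l2_on M V"
  by (auto simp: l2_on_def)

lemma l2_on_lincomb:
  assumes "f \<in> l2_on M U" "g \<in> l2_on M U"
  shows "(\<lambda>x. a * f x + b * g x) \<in> l2_on M U"
  using assms l2_lincomb[OF assms[THEN l2_on_l2], of a b] by (simp add: l2_on_def)

lemma l2_on_cutoff:
  assumes "f \<in> l2_space M" "A \<in> sets M" "A \<subseteq> U"
  shows "(\<lambda>x. indicator A x * f x) \<in> l2_on M U"
  using l2_cutoff[OF assms(1,2)] assms(3) by (auto simp: l2_on_def indicator_eq_0_iff)

definition Cc_on :: "'a::metric_space set \<Rightarrow> ('a \<Rightarrow> complex) set" where
  "Cc_on U = {f. continuous_on UNIV f \<and> compact (closure {x. f x \<noteq> 0}) \<and> closure {x. f x \<noteq> 0} \<subseteq> U}"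

lemma l2_norm_indicator:
  assumes "A \<in> sets M"
  shows "l2_norm M (indicator A :: 'a \<Rightarrow> complex) = sqrt (measure M A)"
proof -
  have eq: "(\<lambda>x. (cmod (indicator A x))\<^sup>2) = (indicator A :: 'a \<Rightarrow> real)"
    by (auto simp: indicator_def)
  show ?thesis
    unfolding l2_norm_def eq using assms by simp
qed

lemma compact_imp_Urysohn_cutoff:
  fixes K :: "'a::metric_space set"
  assumes lc: "locally compact (UNIV :: 'a set)" and K: "compact K" and V: "open V" "K \<subseteq> V"
  shows "\<exists>f :: 'a \<Rightarrow> real. continuous_on UNIV f \<and> (\<forall>x. 0 \<le> f x \<and> f x \<le> 1) \<and> (\<forall>x\<in>K. f x = 1) \<and>
    compact (closure {x. f x \<noteq> 0}) \<and> closure {x. f x \<noteq> 0} \<subseteq> V"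
proof (cases "K = {}")
  case True
  then show ?thesis by (intro exI[of _ "\<lambda>x. 0"]) auto
next
  case ne: False
  have "\<forall>x\<in>K. \<exists>u v. open u \<and> compact v \<and> x \<in> u \<and> u \<subseteq> v \<and> v \<subseteq> V"
  proof
    fix x assume "x \<in> K"
    then have "x \<in> V" using V by blast
    then show "\<exists>u v. open u \<and> compact v \<and> x \<in> u \<and> u \<subseteq> v \<and> v \<subseteq> V"
      using lc V(1) unfolding locally_def subtopology_UNIV open_openin[symmetric] by blast
  qed
  from this[THEN bchoice] obtain u where
    "\<forall>x\<in>K. \<exists>v. open (u x) \<and> compact v \<and> x \<in> u x \<and> u x \<subseteq> v \<and> v \<subseteq> V" ..
  from this[THEN bchoice] obtain v where
    "\<forall>x\<in>K. open (u x) \<and> compact (v x) \<and> x \<in> u x \<and> u x \<subseteq> v x \<and> v x \<subseteq> V" ..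
  then have uv: "\<And>x. x \<in> K \<Longrightarrow> open (u x)" "\<And>x. x \<in> K \<Longrightarrow> compact (v x)"
    "\<And>x. x \<in> K \<Longrightarrow> x \<in> u x" "\<And>x. x \<in> K \<Longrightarrow> u x \<subseteq> v x" "\<And>x. x \<in> K \<Longrightarrow> v x \<subseteq> V"
    by simp_all
  obtain t where t: "t \<subseteq> K" "finite t" "K \<subseteq> (\<Union>x\<in>t. u x)"
    using compactE_image[OF K, of K u, OF uv(1)] uv(3) by blast
  define C where "C = (\<Union>x\<in>t. v x)"
  have "compact C" unfolding C_def using t(1) by (intro compact_UN t(2) uv(2)) blast
  moreover have "C \<subseteq> V" unfolding C_def using t(1) uv(5) by blast
  ultimately have C: "compact C" "C \<subseteq> V" .
  have "open (\<Union>x\<in>t. u x)" using t(1) by (intro open_UN ballI uv(1)) blast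
  then obtain e where e: "e > 0" "(\<Union>x\<in>K. ball x e) \<subseteq> (\<Union>x\<in>t. u x)"
    using compact_subset_open_imp_ball_epsilon_subset[OF K _ t(3)] by blast
  have "(\<Union>x\<in>t. u x) \<subseteq> C" unfolding C_def using t(1) by (intro UN_mono order_refl uv(4)) blast
  with e(2) have eC: "(\<Union>x\<in>K. ball x e) \<subseteq> C" by (rule order.trans)
  define f where "f x = max 0 (1 - infdist x K / e)" for x
  have cont: "continuous_on UNIV f" unfolding f_def
    by (intro continuous_intros) (use e in auto)
  have range: "\<forall>x. 0 \<le> f x \<and> f x \<le> 1"
    using e by (auto simp: f_def infdist_nonneg)
  have one: "\<forall>x\<in>K. f x = 1" by (simp add: f_def)
  have "{x. f x \<noteq> 0} \<subseteq> C"
  proof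
    fix x assume "x \<in> {x. f x \<noteq> 0}"
    then have fx: "f x \<noteq> 0" by simp
    have "infdist x K < e"
    proof (rule ccontr)
      assume "\<not> infdist x K < e"
      then have "1 \<le> infdist x K / e" using e(1) by (simp add: le_divide_eq)
      then show False using fx by (simp add: f_def)
    qed
    then obtain y where "y \<in> K" "dist x y < e"
      using ne by (auto simp: infdist_notempty cInf_less_iff)
    then have "x \<in> (\<Union>x\<in>K. ball x e)" by (auto simp: dist_commute)
    then show "x \<in> C" using eC by (rule rev_subsetD)
  qed
  then have sub: "closure {x. f x \<noteq> 0} \<subseteq> C" by (intro closure_minimal compact_imp_closed C)
  then have "compact (closure {x. f x \<noteq> 0})"
    using compact_Int_closed[OF C(1) closed_closure, of "{x. f x \<noteq> 0}"] by (simp add: Int_absorb1)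
  with cont range one order.trans[OF sub C(2)] show ?thesis by (intro exI[of _ f] conjI)
qed

lemma Cc_on_lincomb:
  assumes f: "f \<in> Cc_on U" and g: "g \<in> Cc_on U"
  shows "(\<lambda>x. a * f x + b * g x) \<in> Cc_on U"
proof -
  let ?C = "closure {x. f x \<noteq> 0} \<union> closure {x. g x \<noteq> 0}"
  have C: "compact ?C" "?C \<subseteq> U" using f g by (auto simp: Cc_on_def)
  have "{x. a * f x + b * g x \<noteq> 0} \<subseteq> {x. f x \<noteq> 0} \<union> {x. g x \<noteq> 0}" by auto
  from closure_mono[OF this] have sub: "closure {x. a * f x + b * g x \<noteq> 0} \<subseteq> ?C"
    by (simp only: closure_Un)
  then have "compact (closure {x. a * f x + b * g x \<noteq> 0})"
    using compact_Int_closed[OF C(1) closed_closure, of "{x. a * f x + b * g x \<noteq> 0}"]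
    by (simp add: Int_absorb1)
  moreover have "continuous_on UNIV (\<lambda>x. a * f x + b * g x)"
    using f g by (intro continuous_intros) (auto simp: Cc_on_def)
  ultimately show ?thesis using sub C(2) by (auto simp: Cc_on_def)
qed

locale radon_metric_space =
  fixes \<mu> :: "'a::metric_space measure" and \<epsilon> :: real
  assumes locally_compact: "locally compact (UNIV :: 'a set)"
    and radon: "radon_measure \<mu>"
    and eps: "\<epsilon> > 0"
begin

lemma sets_borel [measurable_cong]: "sets \<mu> = sets borel"
  using radon[unfolded radon_measure_def] by blast

lemma space_UNIV [simp]: "space \<mu> = UNIV"
  using sets_eq_imp_space_eq[OF sets_borel] by simp

lemma open_sets: "open U \<Longrightarrow> U \<in> sets \<mu>"
  by (simp add: sets_borel)

lemma compact_sets: "compact K \<Longrightarrow> K \<in> sets \<mu>"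
  by (simp add: sets_borel borel_compact)

lemma compact_finite: "compact K \<Longrightarrow> emeasure \<mu> K < \<infinity>"
  using radon[unfolded radon_measure_def] by blast

lemma continuous_measurable:
  "continuous_on UNIV f \<Longrightarrow> f \<in> borel_measurable \<mu>"
  unfolding measurable_cong_sets[OF sets_borel refl] by (rule borel_measurable_continuous_onI)

lemma bounded_support_l2:
  fixes f :: "'a \<Rightarrow> complex"
  assumes f: "f \<in> borel_measurable \<mu>" and K: "K \<in> sets \<mu>" "emeasure \<mu> K < \<infinity>" and C: "C \<ge> 0"
    and le: "\<And>x. cmod (f x) \<le> C * indicator K x"
  shows "f \<in> l2_space \<mu>" "l2_norm \<mu> f \<le> C * sqrt (measure \<mu> K)"
proof -
  have "cmod (f x) \<le> C * cmod (indicator K x)" for x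
    using le[of x] by (auto simp: indicator_def)
  from l2_norm_mono[OF f l2_indicator[OF K] this C]
  show "f \<in> l2_space \<mu>" "l2_norm \<mu> f \<le> C * sqrt (measure \<mu> K)"
    by (simp_all add: l2_norm_indicator[OF K(1)])
qed

lemma Cc_on_l2:
  assumes "f \<in> Cc_on U"
  shows "f \<in> l2_space \<mu>"
proof -
  define K where "K = closure {x. f x \<noteq> 0}"
  have K: "compact K" and f: "continuous_on UNIV f" using assms by (auto simp: Cc_on_def K_def)
  have "bounded (f ` K)"
    by (intro compact_imp_bounded compact_continuous_image continuous_on_subset[OF f] K) auto
  then obtain B where B: "B > 0" "\<And>x. x \<in> K \<Longrightarrow> cmod (f x) \<le> B"
    by (metis bounded_pos imageI)
  have "cmod (f x) \<le> B * indicator K x" for x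
  proof (cases "x \<in> K")
    case False
    then have "f x = 0" unfolding K_def using closure_subset[of "{x. f x \<noteq> 0}"] by blast
    then show ?thesis using False by simp
  qed (use B in simp)
  then show ?thesis
    by (rule bounded_support_l2(1)[OF continuous_measurable[OF f] compact_sets[OF K] compact_finite[OF K]
      less_imp_le[OF B(1)]])
qed

definition Cc_closure :: "'a set \<Rightarrow> ('a \<Rightarrow> complex) set" where
  "Cc_closure U = {f \<in> l2_space \<mu>. \<forall>\<delta>>0. \<exists>k\<in>Cc_on U. l2_norm \<mu> (\<lambda>x. f x - k x) < \<delta>}"

lemma Cc_closure_lincomb:
  assumes f: "f \<in> Cc_closure U" and g: "g \<in> Cc_closure U"
  shows "(\<lambda>x. a * f x + b * g x) \<in> Cc_closure U"
proof -
  have fl: "f \<in> l2_space \<mu>" and gl: "g \<in> l2_space \<mu>" using f g by (auto simp: Cc_closure_def)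
  have "\<exists>k\<in>Cc_on U. l2_norm \<mu> (\<lambda>x. (a * f x + b * g x) - k x) < \<delta>" if \<delta>: "\<delta> > 0" for \<delta>
  proof -
    define \<eta> where "\<eta> = \<delta> / (cmod a + cmod b + 1)"
    have pos: "cmod a + cmod b + 1 > 0" by (simp add: add_nonneg_pos)
    then have \<eta>: "\<eta> > 0" using \<delta> by (simp add: \<eta>_def)
    obtain k where k: "k \<in> Cc_on U" "l2_norm \<mu> (\<lambda>x. f x - k x) < \<eta>"
      using f \<eta> by (auto simp: Cc_closure_def)
    obtain l where l: "l \<in> Cc_on U" "l2_norm \<mu> (\<lambda>x. g x - l x) < \<eta>"
      using g \<eta> by (auto simp: Cc_closure_def)
    have kl: "(\<lambda>x. f x - k x) \<in> l2_space \<mu>" "(\<lambda>x. g x - l x) \<in> l2_space \<mu>"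
      using fl gl Cc_on_l2 k l by (auto intro: l2_diff)
    have "l2_norm \<mu> (\<lambda>x. (a * f x + b * g x) - (a * k x + b * l x))
        = l2_norm \<mu> (\<lambda>x. a * (f x - k x) + b * (g x - l x))"
      by (simp add: algebra_simps)
    also have "\<dots> \<le> l2_norm \<mu> (\<lambda>x. a * (f x - k x)) + l2_norm \<mu> (\<lambda>x. b * (g x - l x))"
      by (intro l2_norm_triangle l2_scale kl)
    also have "\<dots> \<le> cmod a * \<eta> + cmod b * \<eta>"
      unfolding l2_norm_scale using k(2) l(2) by (intro add_mono mult_left_mono) auto
    also have "\<dots> < (cmod a + cmod b + 1) * \<eta>" using \<eta> by (simp add: algebra_simps)
    also have "\<dots> = \<delta>" using pos by (simp add: \<eta>_def)
    finally show ?thesis using Cc_on_lincomb[OF k(1) l(1), of a b]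
      by (rule_tac bexI[of _ "\<lambda>x. a * k x + b * l x"])
  qed
  then show ?thesis using l2_lincomb[OF fl gl] by (simp add: Cc_closure_def)
qed

lemma Cc_closure_sum:
  assumes "finite I" "\<And>i. i \<in> I \<Longrightarrow> f i \<in> Cc_closure U"
  shows "(\<lambda>x. \<Sum>i\<in>I. c i * f i x) \<in> Cc_closure U"
  using assms
proof (induction I rule: finite_induct)
  case empty
  have "(\<lambda>x. 0) \<in> Cc_on U" by (simp add: Cc_on_def)
  then show ?case by (auto simp: Cc_closure_def l2_zero intro!: bexI[of _ "\<lambda>x. 0"])
next
  case (insert i I)
  then show ?case using Cc_closure_lincomb[of "f i" U "\<lambda>x. \<Sum>i\<in>I. c i * f i x" "c i" 1] by simp
qed

text \<open>
  By outer and then inner regularity \<open>A\<close> is squeezed, up to a set of small measure, between a compact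
  and an open set, and a cutoff function interpolates between these two.
\<close>

lemma indicator_Cc_closure:
  assumes U: "open U" and A: "A \<in> sets \<mu>" "A \<subseteq> U" and fin: "emeasure \<mu> A < \<infinity>"
  shows "(indicator A :: 'a \<Rightarrow> complex) \<in> Cc_closure U"
proof -
  have "\<exists>k\<in>Cc_on U. l2_norm \<mu> (\<lambda>x. indicator A x - k x) < \<delta>" if \<delta>: "\<delta> > 0" for \<delta>
  proof -
    define e where "e = \<delta>\<^sup>2 / 3"
    have e: "e > 0" using \<delta> by (simp add: e_def)
    have "emeasure \<mu> A = (INF W\<in>{W. open W \<and> A \<subseteq> W}. emeasure \<mu> W)"
      using radon[unfolded radon_measure_def] A(1) sets_borel by blast
    from INF_approx_ennreal[OF e this] fin
    have "\<exists>W\<in>{W. open W \<and> A \<subseteq> W}. emeasure \<mu> W < emeasure \<mu> A + ennreal e"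
      by (simp add: less_top)
    then obtain W where W: "open W" "A \<subseteq> W" "emeasure \<mu> W < emeasure \<mu> A + ennreal e" by blast
    define V where "V = W \<inter> U"
    have V: "open V" "A \<subseteq> V" "V \<subseteq> U" using W U A by (auto simp: V_def)
    have "emeasure \<mu> V \<le> emeasure \<mu> W"
      by (intro emeasure_mono) (auto simp: V_def open_sets W)
    then have VA: "emeasure \<mu> V < emeasure \<mu> A + ennreal e" using W(3) by (rule le_less_trans)
    also have "\<dots> < \<infinity>" using fin by simp
    finally have Vfin: "emeasure \<mu> V < \<infinity>" .
    have "emeasure \<mu> V = (SUP K\<in>{K. compact K \<and> K \<subseteq> V}. emeasure \<mu> K)"
      using radon[unfolded radon_measure_def] V(1) by blast
    moreover have "{K. compact K \<and> K \<subseteq> V} \<noteq> {}" using compact_empty by blast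
    moreover have "emeasure \<mu> V \<noteq> \<infinity>" using Vfin by simp
    ultimately have "\<exists>K\<in>{K. compact K \<and> K \<subseteq> V}. emeasure \<mu> V < emeasure \<mu> K + ennreal e"
      by (intro SUP_approx_ennreal[OF e])
    then obtain K where K: "compact K" "K \<subseteq> V" "emeasure \<mu> V < emeasure \<mu> K + ennreal e" by blast
    obtain f :: "'a \<Rightarrow> real" where f: "continuous_on UNIV f" "\<And>x. 0 \<le> f x \<and> f x \<le> 1"
      "\<And>x. x \<in> K \<Longrightarrow> f x = 1" "compact (closure {x. f x \<noteq> 0})" "closure {x. f x \<noteq> 0} \<subseteq> V"
      using compact_imp_Urysohn_cutoff[OF locally_compact K(1) V(1) K(2)] by blast
    define k where "k x = complex_of_real (f x)" for x
    have "continuous_on UNIV k" unfolding k_def using f(1) by (intro continuous_intros)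
    then have kC: "k \<in> Cc_on U" using f(4,5) V(3) by (auto simp: Cc_on_def k_def)
    have f0: "f x = 0" if "x \<notin> V" for x
      using that f(5) closure_subset[of "{x. f x \<noteq> 0}"] by blast
    define D where "D = (V - A) \<union> (V - K)"
    have sets: "V \<in> sets \<mu>" "K \<in> sets \<mu>" using V K by (auto intro: open_sets compact_sets)
    have D: "D \<in> sets \<mu>" unfolding D_def using sets A(1) by auto
    have Dfin: "emeasure \<mu> D < \<infinity>"
    proof (rule le_less_trans[OF _ Vfin])
      show "emeasure \<mu> D \<le> emeasure \<mu> V" by (rule emeasure_mono[OF _ sets(1)]) (auto simp: D_def)
    qed
    have fm: "V \<in> fmeasurable \<mu>" "A \<in> fmeasurable \<mu>" "K \<in> fmeasurable \<mu>"
      using Vfin fin compact_finite[OF K(1)] sets A(1) by (simp_all add: fmeasurableI)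
    have real: "measure \<mu> V < measure \<mu> B + e"
      if "B \<in> fmeasurable \<mu>" "emeasure \<mu> V < emeasure \<mu> B + ennreal e" for B
    proof -
      have "ennreal (measure \<mu> V) < ennreal (measure \<mu> B + e)"
        using that(2) e unfolding emeasure_eq_measure2[OF fm(1)] emeasure_eq_measure2[OF that(1)]
        by (simp only: ennreal_plus measure_nonneg less_imp_le)
      then show ?thesis by (simp only: ennreal_less_iff[OF measure_nonneg])
    qed
    note real[OF fm(2) VA] real[OF fm(3) K(3)]
    moreover have "measure \<mu> (V - A) = measure \<mu> V - measure \<mu> A" "measure \<mu> (V - K) = measure \<mu> V - measure \<mu> K"
      by (simp_all only: measurable_measure_Diff[OF fm(1) A(1) V(2)] measurable_measure_Diff[OF fm(1) sets(2) K(2)])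
    moreover have "measure \<mu> D \<le> measure \<mu> (V - A) + measure \<mu> (V - K)"
      unfolding D_def using sets A(1) by (intro measure_Un_le) auto
    ultimately have "measure \<mu> D < 2 * e" by linarith
    also have "\<dots> < \<delta>\<^sup>2" using e unfolding e_def by simp
    finally have "measure \<mu> D < \<delta>\<^sup>2" .
    then have "sqrt (measure \<mu> D) < \<delta>" using \<delta> by (intro real_less_lsqrt) auto
    moreover have "l2_norm \<mu> (\<lambda>x. indicator A x - k x) \<le> 1 * sqrt (measure \<mu> D)"
    proof (rule bounded_support_l2(2)[OF _ D Dfin])
      show "(\<lambda>x. indicator A x - k x) \<in> borel_measurable \<mu>"
        using A(1) l2_spaceD(1)[OF Cc_on_l2[OF kC]] by measurable
      fix x
      have "indicator A x - k x = complex_of_real (indicator A x - f x)"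
        by (simp add: k_def indicator_def)
      then have "cmod (indicator A x - k x) = \<bar>indicator A x - f x\<bar>"
        by (simp only: norm_of_real)
      also have "\<dots> \<le> 1 * indicator D x"
        using f(2)[of x] f(3)[of x] f0[of x] V(2) by (auto simp: indicator_def D_def)
      finally show "cmod (indicator A x - k x) \<le> 1 * indicator D x" .
    qed simp
    ultimately show ?thesis using kC by (intro bexI[of _ k]) auto
  qed
  then show ?thesis using l2_indicator[OF A(1) fin] by (simp add: Cc_closure_def)
qed

lemma Cc_closure_limit:
  assumes f: "f \<in> l2_space \<mu>"
    and "\<And>\<delta>. \<delta> > 0 \<Longrightarrow> \<exists>g\<in>Cc_closure U. l2_norm \<mu> (\<lambda>x. f x - g x) < \<delta>"
  shows "f \<in> Cc_closure U"
proof -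
  have "\<exists>k\<in>Cc_on U. l2_norm \<mu> (\<lambda>x. f x - k x) < \<delta>" if \<delta>: "\<delta> > 0" for \<delta>
  proof -
    have \<delta>2: "\<delta> / 2 > 0" using \<delta> by simp
    obtain g where g: "g \<in> Cc_closure U" "l2_norm \<mu> (\<lambda>x. f x - g x) < \<delta> / 2"
      using assms(2)[OF \<delta>2] by blast
    obtain k where k: "k \<in> Cc_on U" "l2_norm \<mu> (\<lambda>x. g x - k x) < \<delta> / 2"
      using g(1) \<delta>2 unfolding Cc_closure_def by blast
    have "g \<in> l2_space \<mu>" using g(1) by (simp add: Cc_closure_def)
    from l2_norm_triangle_via[OF f this Cc_on_l2[OF k(1)]]
    have "l2_norm \<mu> (\<lambda>x. f x - k x) < \<delta>" using g(2) k(2) by simp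
    then show ?thesis using k(1) by blast
  qed
  then show ?thesis using f by (simp add: Cc_closure_def)
qed

text \<open>
  A level set of a square-integrable simple function at a nonzero value has finite measure.
\<close>

lemma simple_Cc_closure:
  assumes U: "open U" and s: "simple_function \<mu> s" and sU: "s \<in> l2_on \<mu> U"
  shows "s \<in> Cc_closure U"
proof -
  define I where "I = range s - {0}"
  have I: "finite I" using s unfolding simple_function_def I_def by simp
  have s2: "s \<in> l2_space \<mu>" using sU by (rule l2_on_l2)
  have "indicator (s -` {y}) \<in> Cc_closure U" if y: "y \<in> I" for y
  proof (rule indicator_Cc_closure[OF U])
    show A: "s -` {y} \<in> sets \<mu>" using simple_functionD(2)[OF s, of "{y}"] by simp
    show "s -` {y} \<subseteq> U" using sU y by (auto simp: l2_on_def I_def)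
    have "y \<noteq> 0" using y by (simp add: I_def)
    have "(indicator (s -` {y}) :: 'a \<Rightarrow> complex) \<in> l2_space \<mu>"
    proof (rule l2_norm_mono(1)[OF _ s2, of _ "1 / cmod y"])
      show "indicator (s -` {y}) \<in> borel_measurable \<mu>" using A by simp
      show "cmod (indicator (s -` {y}) x) \<le> 1 / cmod y * cmod (s x)" for x
        using \<open>y \<noteq> 0\<close> by (auto simp: indicator_def)
    qed simp
    then have "integrable \<mu> (\<lambda>x. (cmod (indicator (s -` {y}) x))\<^sup>2)" by (rule l2_spaceD)
    moreover have "(\<lambda>x. (cmod (indicator (s -` {y}) x))\<^sup>2) = (indicator (s -` {y}) :: 'a \<Rightarrow> real)"
      by (auto simp: indicator_def)
    ultimately have "integrable \<mu> (indicator (s -` {y}) :: 'a \<Rightarrow> real)" by simp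
    then show "emeasure \<mu> (s -` {y}) < \<infinity>" using A by (simp add: integrable_indicator_iff)
  qed
  from Cc_closure_sum[OF I this] have "(\<lambda>x. \<Sum>y\<in>I. y * indicator (s -` {y}) x) \<in> Cc_closure U" .
  moreover have "(\<Sum>y\<in>I. y * indicator (s -` {y}) x) = s x" for x
  proof -
    have "(\<Sum>y\<in>I. y * indicator (s -` {y}) x) = (\<Sum>y\<in>I. if y = s x then y else 0)"
      by (rule sum.cong) (auto simp: indicator_def)
    also have "\<dots> = s x" using I by (auto simp: I_def)
    finally show ?thesis .
  qed
  ultimately show ?thesis by simp
qed

lemma Cc_dense_l2_on:
  assumes U: "open U" and f: "f \<in> l2_on \<mu> U" and \<delta>: "\<delta> > 0"
  shows "\<exists>k\<in>Cc_on U. l2_norm \<mu> (\<lambda>x. f x - k x) < \<delta>"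
proof -
  have f2: "f \<in> l2_space \<mu>" using f by (rule l2_on_l2)
  note [measurable] = l2_spaceD(1)[OF f2]
  obtain s where s: "\<And>i. simple_function \<mu> (s i)"
    and lim: "\<And>x. (\<lambda>i. s i x) \<longlonglongrightarrow> f x" and le: "\<And>i x. cmod (s i x) \<le> 2 * cmod (f x)"
  proof -
    obtain s where "(\<forall>i. simple_function \<mu> (s i)) \<and> (\<forall>x\<in>space \<mu>. (\<lambda>i. s i x) \<longlonglongrightarrow> f x) \<and>
        (\<forall>i. \<forall>x\<in>space \<mu>. dist (s i x) 0 \<le> 2 * dist (f x) 0)"
      using borel_measurable_implies_sequence_metric[OF l2_spaceD(1)[OF f2], of 0] ..
    then have "\<And>i. simple_function \<mu> (s i)" "\<And>x. (\<lambda>i. s i x) \<longlonglongrightarrow> f x"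
      "\<And>i x. cmod (s i x) \<le> 2 * cmod (f x)" by (simp_all add: dist_norm)
    then show thesis by (rule that)
  qed
  note [measurable] = borel_measurable_simple_function[OF s]
  have s2: "s i \<in> l2_space \<mu>" for i
    by (rule l2_norm_mono(1)[OF _ f2 le]) simp_all
  have "s i \<in> l2_on \<mu> U" for i
  proof -
    have "s i x = 0" if "x \<notin> U" for x
      using le[of i x] f that by (simp add: l2_on_def)
    then show ?thesis using s2 by (simp add: l2_on_def)
  qed
  note sC = simple_Cc_closure[OF U s this]
  have "(\<lambda>i. LINT x|\<mu>. (cmod (f x - s i x))\<^sup>2) \<longlonglongrightarrow> (LINT x|\<mu>. 0)"
  proof (rule integral_dominated_convergence)
    show "integrable \<mu> (\<lambda>x. 9 * (cmod (f x))\<^sup>2)" using l2_spaceD(2)[OF f2] by simp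
    show "AE x in \<mu>. (\<lambda>i. (cmod (f x - s i x))\<^sup>2) \<longlonglongrightarrow> 0"
    proof (rule AE_I2)
      fix x
      have "(\<lambda>i. (cmod (f x - s i x))\<^sup>2) \<longlonglongrightarrow> (cmod (f x - f x))\<^sup>2"
        by (intro tendsto_intros lim)
      then show "(\<lambda>i. (cmod (f x - s i x))\<^sup>2) \<longlonglongrightarrow> 0" by simp
    qed
    show "AE x in \<mu>. norm ((cmod (f x - s i x))\<^sup>2) \<le> 9 * (cmod (f x))\<^sup>2" for i
    proof (rule AE_I2)
      fix x
      have "cmod (f x - s i x) \<le> 3 * cmod (f x)"
        using norm_triangle_ineq4[of "f x" "s i x"] le[of i x] by linarith
      from power_mono[OF this norm_ge_zero, of 2]
      show "norm ((cmod (f x - s i x))\<^sup>2) \<le> 9 * (cmod (f x))\<^sup>2" by (simp add: power_mult_distrib)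
    qed
  qed simp_all
  then have "(\<lambda>i. (l2_norm \<mu> (\<lambda>x. f x - s i x))\<^sup>2) \<longlonglongrightarrow> 0" by (simp add: l2_norm_squared)
  from tendsto_real_sqrt[OF this] have conv: "(\<lambda>i. l2_norm \<mu> (\<lambda>x. f x - s i x)) \<longlonglongrightarrow> 0" by simp
  have "f \<in> Cc_closure U"
  proof (rule Cc_closure_limit[OF f2])
    fix e :: real assume "e > 0"
    from order_tendstoD(2)[OF conv this] obtain i where "l2_norm \<mu> (\<lambda>x. f x - s i x) < e"
      unfolding eventually_sequentially by blast
    then show "\<exists>g\<in>Cc_closure U. l2_norm \<mu> (\<lambda>x. f x - g x) < e" using sC by blast
  qed
  then show ?thesis using \<delta> by (simp add: Cc_closure_def)
qed

lemma open_ess_support_compl: "open (- ess_support \<mu> p)"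
  unfolding ess_support_def by auto

text \<open>
  Only compact subsets of the complement of the essential support are covered by finitely many
  open null sets. Hence \<open>p\<close> is orthogonal to all continuous functions with compact support there,
  and these are dense.
\<close>

lemma AE_zero_off_ess_support:
  assumes p: "p \<in> l2_space \<mu>"
  shows "AE x in \<mu>. x \<notin> ess_support \<mu> p \<longrightarrow> p x = 0"
proof -
  define W where "W = - ess_support \<mu> p"
  have W: "open W" unfolding W_def by (rule open_ess_support_compl)
  define f where "f x = indicator W x * p x" for x
  have fW: "f \<in> l2_on \<mu> W" unfolding f_def by (rule l2_on_cutoff[OF p open_sets[OF W] order_refl])
  then have f: "f \<in> l2_space \<mu>" by (rule l2_on_l2)
  have orth: "l2_inner \<mu> k f = 0" if k: "k \<in> Cc_on W" for k
  proof -
    define C where "C = closure {x. k x \<noteq> 0}"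
    have C: "compact C" "C \<subseteq> W" using k by (auto simp: Cc_on_def C_def)
    have "C \<subseteq> \<Union>{U. open U \<and> (AE x in \<mu>. x \<in> U \<longrightarrow> p x = 0)}"
      using C(2) unfolding W_def ess_support_def by simp
    then obtain t where t: "t \<subseteq> {U. open U \<and> (AE x in \<mu>. x \<in> U \<longrightarrow> p x = 0)}" "finite t" "C \<subseteq> \<Union>t"
      using compactE[OF C(1), of "{U. open U \<and> (AE x in \<mu>. x \<in> U \<longrightarrow> p x = 0)}"] by blast
    have "AE x in \<mu>. \<forall>U\<in>t. x \<in> U \<longrightarrow> p x = 0"
      using t(1,2) by (intro AE_finite_allI) auto
    then have "AE x in \<mu>. cnj (k x) * f x = 0"
    proof eventually_elim
      case (elim x)
      have "k x = 0 \<or> x \<in> C" unfolding C_def using closure_subset[of "{x. k x \<noteq> 0}"] by blast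
      then show ?case using elim t(3) by (auto simp: f_def)
    qed
    then have "(LINT x|\<mu>. cnj (k x) * f x) = (LINT x|\<mu>. 0)"
      using l2_inner_integrable[OF Cc_on_l2[OF k] f] by (intro integral_cong_AE) auto
    then show ?thesis by (simp add: l2_inner_def)
  qed
  have "(l2_norm \<mu> f)\<^sup>2 \<le> \<delta> * l2_norm \<mu> f" if \<delta>: "\<delta> > 0" for \<delta>
  proof -
    obtain k where k: "k \<in> Cc_on W" "l2_norm \<mu> (\<lambda>x. f x - k x) < \<delta>"
      using Cc_dense_l2_on[OF W fW \<delta>] by blast
    have kl: "k \<in> l2_space \<mu>" by (rule Cc_on_l2[OF k(1)])
    have "complex_of_real ((l2_norm \<mu> f)\<^sup>2) = l2_inner \<mu> (\<lambda>x. f x - k x) f"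
      using l2_inner_diff_left[OF f kl f] orth[OF k(1)] by (simp add: l2_inner_self)
    then have "(l2_norm \<mu> f)\<^sup>2 = cmod (l2_inner \<mu> (\<lambda>x. f x - k x) f)"
      by (metis norm_of_real abs_power2)
    also have "\<dots> \<le> l2_norm \<mu> (\<lambda>x. f x - k x) * l2_norm \<mu> f"
      by (rule l2_cauchy_schwarz[OF l2_diff[OF f kl] f])
    also have "\<dots> \<le> \<delta> * l2_norm \<mu> f" using k(2) by (intro mult_right_mono) auto
    finally show ?thesis .
  qed
  note small = this
  have "l2_norm \<mu> f = 0"
  proof (rule ccontr)
    assume "l2_norm \<mu> f \<noteq> 0"
    then have n: "l2_norm \<mu> f > 0" using l2_norm_nonneg[of \<mu> f] by linarith
    then have "(l2_norm \<mu> f)\<^sup>2 \<le> l2_norm \<mu> f / 2 * l2_norm \<mu> f" by (intro small) simp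
    then show False using n by (simp add: power2_eq_square)
  qed
  then have "AE x in \<mu>. f x = 0" using l2_norm_eq_0_AE[OF f] by simp
  then show ?thesis
    by eventually_elim (auto simp: f_def W_def)
qed

end

section \<open>Orthonormal families\<close>

definition l2_proj :: "'a measure \<Rightarrow> ('i \<Rightarrow> 'a \<Rightarrow> complex) \<Rightarrow> 'i set \<Rightarrow> 'a l2_op" where
  "l2_proj M e I = (\<lambda>h x. \<Sum>i\<in>I. rank1 M (e i) (e i) h x)"

lemma l2_proj_l2: "(\<And>i. i \<in> I \<Longrightarrow> e i \<in> l2_space M) \<Longrightarrow> l2_proj M e I h \<in> l2_space M"
  unfolding l2_proj_def by (intro l2_sum rank1_l2)

lemma l2_inner_proj:
  assumes "\<And>i. i \<in> I \<Longrightarrow> e i \<in> l2_space M" "k \<in> l2_space M"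
  shows "l2_inner M k (l2_proj M e I h) = (\<Sum>i\<in>I. l2_inner M k (e i) * l2_inner M (e i) h)"
proof -
  have "l2_inner M k (l2_proj M e I h) = (\<Sum>i\<in>I. l2_inner M k (rank1 M (e i) (e i) h))"
    unfolding l2_proj_def by (intro l2_inner_sum_right assms rank1_l2)
  then show ?thesis by (simp add: l2_inner_rank1)
qed

definition l2_orthonormal :: "'a measure \<Rightarrow> ('i \<Rightarrow> 'a \<Rightarrow> complex) \<Rightarrow> 'i set \<Rightarrow> bool" where
  "l2_orthonormal M e I \<longleftrightarrow> (\<forall>i\<in>I. e i \<in> l2_space M) \<and>
     (\<forall>i\<in>I. \<forall>j\<in>I. l2_inner M (e i) (e j) = (if i = j then 1 else 0))"

lemma normalised_disjoint_orthonormal: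
  assumes h: "\<And>i. i \<in> I \<Longrightarrow> h i \<in> l2_space M" "\<And>i. i \<in> I \<Longrightarrow> l2_norm M (h i) \<noteq> 0"
    and dis: "\<And>i j x. i \<in> I \<Longrightarrow> j \<in> I \<Longrightarrow> i \<noteq> j \<Longrightarrow> h i x = 0 \<or> h j x = 0"
  shows "l2_orthonormal M (\<lambda>i x. of_real (1 / l2_norm M (h i)) * h i x) I"
proof -
  have "l2_inner M (\<lambda>x. of_real (1 / l2_norm M (h i)) * h i x) (\<lambda>x. of_real (1 / l2_norm M (h j)) * h j x)
      = (if i = j then 1 else 0)" if ij: "i \<in> I" "j \<in> I" for i j
  proof (cases "i = j")
    case True
    then show ?thesis unfolding l2_inner_scale_left l2_inner_scale_right
      using h(2)[OF ij(1)] by (simp add: l2_inner_self power2_eq_square)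
  next
    case False
    have "(\<lambda>x. cnj (h i x) * h j x) = (\<lambda>x. 0)" using dis[OF ij False] by auto
    then have "l2_inner M (h i) (h j) = 0" by (simp add: l2_inner_def)
    then show ?thesis unfolding l2_inner_scale_left l2_inner_scale_right using False by simp
  qed
  then show ?thesis unfolding l2_orthonormal_def using l2_scale[OF h(1)] by blast
qed

lemma l2_proj_coefficient:
  assumes o: "l2_orthonormal M e I" and I: "finite I" and j: "j \<in> I"
  shows "l2_inner M (e j) (l2_proj M e I h) = l2_inner M (e j) h"
proof -
  have e: "e i \<in> l2_space M" if "i \<in> I" for i using o that by (simp add: l2_orthonormal_def)
  have "l2_inner M (e j) (l2_proj M e I h) = (\<Sum>i\<in>I. l2_inner M (e j) (e i) * l2_inner M (e i) h)"
    by (rule l2_inner_proj[OF e e[OF j]])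
  also have "\<dots> = (\<Sum>i\<in>I. if i = j then l2_inner M (e j) h else 0)"
    using o j by (intro sum.cong) (auto simp: l2_orthonormal_def)
  also have "\<dots> = l2_inner M (e j) h" using I j by simp
  finally show ?thesis .
qed

text \<open>
  The projection is selfadjoint and idempotent.
\<close>

lemma l2_inner_proj_self:
  assumes o: "l2_orthonormal M e I" and I: "finite I" and h: "h \<in> l2_space M"
  shows "l2_inner M h (l2_proj M e I h) = of_real ((l2_norm M (l2_proj M e I h))\<^sup>2)"
proof -
  have e: "e i \<in> l2_space M" if "i \<in> I" for i using o that by (simp add: l2_orthonormal_def)
  let ?p = "l2_proj M e I h"
  have p: "?p \<in> l2_space M" by (rule l2_proj_l2[OF e])
  have sum: "l2_inner M k ?p = (\<Sum>i\<in>I. l2_inner M k (e i) * l2_inner M (e i) h)"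
    if "k \<in> l2_space M" for k
    by (rule l2_inner_proj[OF e that])
  have "l2_inner M ?p (e i) = l2_inner M h (e i)" if "i \<in> I" for i
    using arg_cong[OF l2_proj_coefficient[OF o I that, of h], of cnj]
    by (simp only: l2_inner_commute[of M "l2_proj M e I h" "e i"] l2_inner_commute[of M h "e i"])
  then have "l2_inner M ?p ?p = l2_inner M h ?p" unfolding sum[OF p] sum[OF h] by simp
  then show ?thesis by (simp add: l2_inner_self)
qed

lemma l2_proj_pythagoras:
  assumes o: "l2_orthonormal M e I" and I: "finite I" and h: "h \<in> l2_space M"
  shows "(l2_norm M h)\<^sup>2 = (l2_norm M (l2_proj M e I h))\<^sup>2 + (l2_norm M (\<lambda>x. h x - l2_proj M e I h x))\<^sup>2"
proof -
  have p: "l2_proj M e I h \<in> l2_space M"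
    using o by (intro l2_proj_l2) (simp add: l2_orthonormal_def)
  show ?thesis
    using l2_norm_lincomb_squared[OF h p, of "-1"] unfolding l2_inner_proj_self[OF assms] by simp
qed

lemma l2_proj_norm_le:
  assumes "l2_orthonormal M e I" "finite I" "h \<in> l2_space M"
  shows "l2_norm M (l2_proj M e I h) \<le> l2_norm M h"
    and "l2_norm M (\<lambda>x. h x - l2_proj M e I h x) \<le> l2_norm M h"
proof -
  note * = l2_proj_pythagoras[OF assms]
  have "(l2_norm M (l2_proj M e I h))\<^sup>2 \<le> (l2_norm M h)\<^sup>2"
    "(l2_norm M (\<lambda>x. h x - l2_proj M e I h x))\<^sup>2 \<le> (l2_norm M h)\<^sup>2"
    unfolding * by simp_all
  then show "l2_norm M (l2_proj M e I h) \<le> l2_norm M h"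
    "l2_norm M (\<lambda>x. h x - l2_proj M e I h x) \<le> l2_norm M h"
    by (simp_all only: power2_le_imp_le[OF _ l2_norm_nonneg])
qed

section \<open>The operator space of a tolerance relation\<close>

definition small_open :: "real \<Rightarrow> 'a::metric_space set \<Rightarrow> bool" where
  "small_open \<epsilon> U \<longleftrightarrow> open U \<and> U \<times> U \<subseteq> tolerance \<epsilon>"

lemma small_open_balls:
  fixes a b :: "'a::metric_space"
  assumes "dist a b + 2 * r \<le> \<epsilon>"
  shows "small_open \<epsilon> (ball a r \<union> ball b r)"
proof -
  have one: "dist x y < \<epsilon>" if "dist c x < r" "dist d y < r" "dist c d \<le> dist a b" for c d x y
  proof -
    have "dist x y \<le> dist c x + dist c d + dist d y"
      using dist_triangle[of x y c] dist_triangle[of c y d] by (simp add: dist_commute)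
    then show ?thesis using that assms by linarith
  qed
  have "dist x y < \<epsilon>" if xy: "x \<in> ball a r \<union> ball b r" "y \<in> ball a r \<union> ball b r" for x y
  proof -
    obtain c where c: "dist c x < r" "c = a \<or> c = b" using xy(1) by auto
    obtain d where d: "dist d y < r" "d = a \<or> d = b" using xy(2) by auto
    have "dist c d \<le> dist a b" using c(2) d(2) dist_commute[of a b] by auto
    then show ?thesis by (rule one[OF c(1) d(1)])
  qed
  then have "(ball a r \<union> ball b r) \<times> (ball a r \<union> ball b r) \<subseteq> tolerance \<epsilon>"
    unfolding tolerance_def by blast
  then show ?thesis by (simp add: small_open_def open_Un)
qed

lemma Cc_tolerance_eq: "Cc_tolerance \<epsilon> = Cc_on (tolerance \<epsilon>)"
  by (simp add: Cc_tolerance_def Cc_on_def)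

text \<open>
  The balls of a finite cover are made disjoint by removing from each one what has been covered before.
\<close>

lemma small_borel_partition:
  fixes K :: "'a::metric_space set"
  assumes K: "compact K" and \<eta>: "\<eta> > 0"
  shows "\<exists>P. finite P \<and> disjoint P \<and> \<Union>P = K \<and> (\<forall>A\<in>P. A \<in> sets borel \<and> (\<exists>a. A \<subseteq> ball a \<eta>))"
proof -
  have "\<exists>P. finite P \<and> disjoint P \<and> \<Union>P = K \<inter> (\<Union>a\<in>t. ball a \<eta>) \<and>
      (\<forall>A\<in>P. A \<in> sets borel \<and> (\<exists>a. A \<subseteq> ball a \<eta>))" if "finite t" for t
    using that
  proof (induction t rule: finite_induct)
    case empty
    then show ?case by (intro exI[of _ "{}"]) auto
  next
    case (insert a t)
    from insert.IH obtain P where P': "finite P \<and> disjoint P \<and> \<Union>P = K \<inter> (\<Union>a\<in>t. ball a \<eta>) \<and>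
      (\<forall>A\<in>P. A \<in> sets borel \<and> (\<exists>a. A \<subseteq> ball a \<eta>))" ..
    then have P: "finite P" "disjoint P" "\<Union>P = K \<inter> (\<Union>a\<in>t. ball a \<eta>)"
      "\<And>A. A \<in> P \<Longrightarrow> A \<in> sets borel" by simp_all
    define A where "A = (K \<inter> ball a \<eta>) - \<Union>P"
    have "A \<in> sets borel"
      unfolding A_def using P(1,4)
      by (intro sets.Diff sets.Int sets.finite_Union borel_compact[OF K] borel_open[OF open_ball]) auto
    moreover have "\<exists>a. A \<subseteq> ball a \<eta>" unfolding A_def by blast
    moreover have "disjoint (insert A P)"
      using P(2) unfolding pairwise_insert disjnt_def A_def by blast
    moreover have "\<Union>(insert A P) = K \<inter> (\<Union>a\<in>insert a t. ball a \<eta>)"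
      using P(3) by (auto simp: A_def)
    ultimately show ?case using P' by (intro exI[of _ "insert A P"]) simp
  qed
  note partition = this
  have "K \<subseteq> (\<Union>a\<in>K. ball a \<eta>)" using \<eta> by auto
  then obtain t where t: "finite t" "K \<subseteq> (\<Union>a\<in>t. ball a \<eta>)"
    by (rule compactE_image[OF K open_ball])
  then have "K \<inter> (\<Union>a\<in>t. ball a \<eta>) = K" by blast
  with partition[OF t(1)] show ?thesis by simp
qed

definition block_kernel :: "'a set set \<Rightarrow> ('a set \<Rightarrow> 'a set \<Rightarrow> complex) \<Rightarrow> 'a \<Rightarrow> 'a \<Rightarrow> complex" where
  "block_kernel P c x y = (\<Sum>i\<in>P \<times> P. c (fst i) (snd i) * indicator (fst i) x * indicator (snd i) y)"

lemma block_kernel_eq: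
  assumes P: "finite P" "disjoint P" and A: "A \<in> P" "x \<in> A" and B: "B \<in> P" "y \<in> B"
  shows "block_kernel P c x y = c A B"
proof -
  have "c (fst i) (snd i) * indicator (fst i) x * indicator (snd i) y = (if i = (A, B) then c A B else 0)"
    if i: "i \<in> P \<times> P" for i
  proof (cases "i = (A, B)")
    case True
    then show ?thesis using A B by simp
  next
    case False
    then consider "fst i \<noteq> A" | "snd i \<noteq> B" by (metis prod.collapse)
    then show ?thesis
    proof cases
      case 1
      then have "x \<notin> fst i" using disjointD[OF P(2) _ A(1) 1] i A(2) by auto
      then show ?thesis using False by simp
    next
      case 2
      then have "y \<notin> snd i" using disjointD[OF P(2) _ B(1) 2] i B(2) by auto
      then show ?thesis using False by simp
    qed
  qed
  then have "block_kernel P c x y = (\<Sum>i\<in>P \<times> P. if i = (A, B) then c A B else 0)"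
    unfolding block_kernel_def by (rule sum.cong[OF refl])
  also have "\<dots> = c A B" using P(1) A B by simp
  finally show ?thesis .
qed

lemma block_kernel_zero:
  assumes "x \<notin> \<Union>P \<or> y \<notin> \<Union>P"
  shows "block_kernel P c x y = 0"
  unfolding block_kernel_def using assms by (intro sum.neutral) (auto simp: indicator_def)

context radon_metric_space
begin

definition local_pairs :: "(('a \<Rightarrow> complex) \<times> ('a \<Rightarrow> complex)) set" where
  "local_pairs = {(f, g). \<exists>U. small_open \<epsilon> U \<and> f \<in> l2_on \<mu> U \<and> g \<in> l2_on \<mu> U}"

lemma local_pairsI: "small_open \<epsilon> U \<Longrightarrow> f \<in> l2_on \<mu> U \<Longrightarrow> g \<in> l2_on \<mu> U \<Longrightarrow> (f, g) \<in> local_pairs"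
  unfolding local_pairs_def by blast

definition block_structure :: "'a set set \<Rightarrow> ('a set \<Rightarrow> 'a set \<Rightarrow> complex) \<Rightarrow> bool" where
  "block_structure P c \<longleftrightarrow> finite P \<and> disjoint P \<and>
     (\<forall>A\<in>P. A \<in> sets \<mu> \<and> emeasure \<mu> A < \<infinity> \<and> (\<exists>U. small_open \<epsilon> U \<and> A \<subseteq> U)) \<and>
     (\<forall>A\<in>P. \<forall>B\<in>P. c A B \<noteq> 0 \<longrightarrow> (\<exists>U. small_open \<epsilon> U \<and> A \<union> B \<subseteq> U))"

text \<open>
  The integral operator with kernel \<open>block_kernel P c\<close>, written as a sum of rank-one operators.
\<close>

definition block_op :: "'a set set \<Rightarrow> ('a set \<Rightarrow> 'a set \<Rightarrow> complex) \<Rightarrow> 'a l2_op" where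
  "block_op P c = (\<lambda>\<xi> x. \<Sum>i\<in>P \<times> P.
     rank1 \<mu> (\<lambda>x. c (fst i) (snd i) * indicator (fst i) x) (indicator (snd i)) \<xi> x)"

lemma block_structureD:
  assumes "block_structure P c"
  shows "finite P" "disjoint P"
    and "A \<in> P \<Longrightarrow> A \<in> sets \<mu>" "A \<in> P \<Longrightarrow> emeasure \<mu> A < \<infinity>"
    and "A \<in> P \<Longrightarrow> \<exists>U. small_open \<epsilon> U \<and> A \<subseteq> U"
    and "A \<in> P \<Longrightarrow> B \<in> P \<Longrightarrow> c A B \<noteq> 0 \<Longrightarrow> \<exists>U. small_open \<epsilon> U \<and> A \<union> B \<subseteq> U"
  using assms unfolding block_structure_def by blast+

lemma block_indicator_l2:
  "block_structure P c \<Longrightarrow> A \<in> P \<Longrightarrow> (indicator A :: 'a \<Rightarrow> complex) \<in> l2_space \<mu>"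
  by (intro l2_indicator block_structureD(3,4))

lemma indicator_l2_on:
  fixes A :: "'a set"
  shows "(indicator A :: 'a \<Rightarrow> complex) \<in> l2_space \<mu> \<Longrightarrow> A \<subseteq> U \<Longrightarrow> (\<lambda>x. a * indicator A x) \<in> l2_on \<mu> U"
  unfolding l2_on_def using l2_scale[of "indicator A" \<mu> a] by (auto simp: indicator_def)

lemma block_op_in_span:
  assumes b: "block_structure P c"
  shows "block_op P c \<in> rank_span \<mu> local_pairs"
  unfolding block_op_def
proof (rule rank_span_sum)
  show "finite (P \<times> P)" using block_structureD(1)[OF b] by simp
  fix i assume "i \<in> P \<times> P"
  then have i: "fst i \<in> P" "snd i \<in> P" by auto
  have "\<exists>U. small_open \<epsilon> U \<and> snd i \<subseteq> U \<and> (c (fst i) (snd i) \<noteq> 0 \<longrightarrow> fst i \<subseteq> U)"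
    using block_structureD(5)[OF b i(2)] block_structureD(6)[OF b i] by blast
  then obtain U where U: "small_open \<epsilon> U" "snd i \<subseteq> U" "c (fst i) (snd i) \<noteq> 0 \<Longrightarrow> fst i \<subseteq> U" by blast
  have "(\<lambda>x. c (fst i) (snd i) * indicator (fst i) x) \<in> l2_on \<mu> U"
    using indicator_l2_on[OF block_indicator_l2[OF b i(1)] U(3), of "c (fst i) (snd i)"]
    by (cases "c (fst i) (snd i) = 0") (simp_all add: l2_on_def l2_zero)
  moreover have "indicator (snd i) \<in> l2_on \<mu> U"
    using indicator_l2_on[OF block_indicator_l2[OF b i(2)] U(2), of 1] by simp
  ultimately show "((\<lambda>x. c (fst i) (snd i) * indicator (fst i) x), indicator (snd i)) \<in> local_pairs"
    by (rule local_pairsI[OF U(1)])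
qed

lemma kernel_op_eq_inner: "kernel_op \<mu> F \<xi> x = l2_inner \<mu> (\<lambda>y. cnj (F (x, y))) \<xi>"
  by (simp add: kernel_op_def l2_inner_def)

lemma block_kernel_slice:
  assumes b: "block_structure P c"
  shows "(\<lambda>y. cnj (block_kernel P c x y)) \<in> l2_space \<mu>"
    and "\<xi> \<in> l2_space \<mu> \<Longrightarrow> block_op P c \<xi> x = l2_inner \<mu> (\<lambda>y. cnj (block_kernel P c x y)) \<xi>"
proof -
  let ?a = "\<lambda>i. cnj (c (fst i) (snd i) * indicator (fst i) x)"
  have eq: "(\<lambda>y. cnj (block_kernel P c x y)) = (\<lambda>y. \<Sum>i\<in>P \<times> P. ?a i * indicator (snd i) y)"
    unfolding block_kernel_def cnj_sum by (auto intro!: sum.cong simp: indicator_def)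
  have l: "(\<lambda>y. ?a i * indicator (snd i) y) \<in> l2_space \<mu>" if "i \<in> P \<times> P" for i
    using that by (intro l2_scale block_indicator_l2[OF b]) auto
  show "(\<lambda>y. cnj (block_kernel P c x y)) \<in> l2_space \<mu>" unfolding eq by (rule l2_sum[OF l])
  assume \<xi>: "\<xi> \<in> l2_space \<mu>"
  have "l2_inner \<mu> \<xi> (\<lambda>y. cnj (block_kernel P c x y))
      = (\<Sum>i\<in>P \<times> P. l2_inner \<mu> \<xi> (\<lambda>y. ?a i * indicator (snd i) y))"
    unfolding eq by (rule l2_inner_sum_right[OF \<xi> l])
  also have "\<dots> = (\<Sum>i\<in>P \<times> P. ?a i * l2_inner \<mu> \<xi> (indicator (snd i)))"
    by (simp only: l2_inner_scale_right)
  finally have "l2_inner \<mu> \<xi> (\<lambda>y. cnj (block_kernel P c x y))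
      = (\<Sum>i\<in>P \<times> P. ?a i * l2_inner \<mu> \<xi> (indicator (snd i)))" .
  then have "cnj (l2_inner \<mu> \<xi> (\<lambda>y. cnj (block_kernel P c x y)))
      = (\<Sum>i\<in>P \<times> P. c (fst i) (snd i) * indicator (fst i) x * cnj (l2_inner \<mu> \<xi> (indicator (snd i))))"
    by simp
  moreover have "block_op P c \<xi> x
      = (\<Sum>i\<in>P \<times> P. c (fst i) (snd i) * indicator (fst i) x * cnj (l2_inner \<mu> \<xi> (indicator (snd i))))"
    unfolding block_op_def rank1_def
    by (rule sum.cong[OF refl]) (subst l2_inner_commute[of \<mu> _ \<xi>], rule refl)
  ultimately show "block_op P c \<xi> x = l2_inner \<mu> (\<lambda>y. cnj (block_kernel P c x y)) \<xi>"
    unfolding l2_inner_commute[of \<mu> "\<lambda>y. cnj (block_kernel P c x y)" \<xi>] by simp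
qed

text \<open>
  For fixed \<open>x\<close> the difference of the kernels is a square-integrable function of \<open>y\<close> of norm at most
  \<open>\<delta> \<mu>(K)\<^sup>1\<^sup>/\<^sup>2\<close>, and the Cauchy-Schwarz inequality in \<open>y\<close> gives the bound. Arguing pointwise in \<open>x\<close>
  avoids the product measure, which would require \<open>\<sigma>\<close>-finiteness.
\<close>

lemma kernel_block_difference:
  assumes F: "continuous_on UNIV F" and b: "block_structure P c"
    and K: "K \<in> sets \<mu>" "emeasure \<mu> K < \<infinity>" and \<delta>: "\<delta> \<ge> 0"
    and le: "\<And>x y. cmod (F (x, y) - block_kernel P c x y) \<le> \<delta> * indicator K x * indicator K y"
    and \<xi>: "\<xi> \<in> l2_space \<mu>"
  shows "cmod (kernel_op \<mu> F \<xi> x - block_op P c \<xi> x)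
    \<le> \<delta> * sqrt (measure \<mu> K) * l2_norm \<mu> \<xi> * cmod (indicator K x)"
proof -
  let ?g = "\<lambda>y. cnj (F (x, y)) - cnj (block_kernel P c x y)"
  note blk = block_kernel_slice(1)[OF b, of x]
  have "continuous_on UNIV (\<lambda>y. F (x, y))"
    by (rule continuous_on_compose2[OF F]) (auto intro!: continuous_intros)
  then have meas: "(\<lambda>y. cnj (F (x, y))) \<in> borel_measurable \<mu>"
    by (intro borel_measurable_cnj continuous_measurable)
  have m: "?g \<in> borel_measurable \<mu>" using meas l2_spaceD(1)[OF blk] by simp
  have le': "cmod (?g y) \<le> (\<delta> * indicator K x) * indicator K y" for y
    using le[of x y] by (simp flip: complex_cnj_diff)
  have nn: "0 \<le> \<delta> * indicator K x" using \<delta> by simp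
  have g: "?g \<in> l2_space \<mu>" "l2_norm \<mu> ?g \<le> \<delta> * indicator K x * sqrt (measure \<mu> K)"
    by (rule bounded_support_l2[OF m K nn le'])+
  have "(\<lambda>y. cnj (F (x, y))) \<in> l2_space \<mu>" using l2_add[OF g(1) blk] by simp
  from l2_inner_diff_left[OF this blk \<xi>]
  have "kernel_op \<mu> F \<xi> x - block_op P c \<xi> x = l2_inner \<mu> ?g \<xi>"
    unfolding kernel_op_eq_inner block_kernel_slice(2)[OF b \<xi>] by simp
  also have "cmod \<dots> \<le> l2_norm \<mu> ?g * l2_norm \<mu> \<xi>" by (rule l2_cauchy_schwarz[OF g(1) \<xi>])
  also have "\<dots> \<le> (\<delta> * indicator K x * sqrt (measure \<mu> K)) * l2_norm \<mu> \<xi>"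
    by (rule mult_right_mono[OF g(2)]) simp
  also have "\<dots> = \<delta> * sqrt (measure \<mu> K) * l2_norm \<mu> \<xi> * cmod (indicator K x)"
    by (auto simp: indicator_def)
  finally show ?thesis .
qed

text \<open>
  On a partition into sets of small diameter, \<open>c A B\<close> is the value of \<open>F\<close> at one of its nonzero
  points in \<open>A \<times> B\<close>, if there are any. Then \<open>c A B \<noteq> 0\<close> forces \<open>A\<close> and \<open>B\<close> to be close, since the
  distance is bounded away from \<open>\<epsilon>\<close> on the compact support of \<open>F\<close>.
\<close>

lemma kernel_block_approximation:
  assumes F: "F \<in> Cc_tolerance \<epsilon>"
  shows "\<exists>K. compact K \<and> (\<forall>\<delta>>0. \<exists>P c. block_structure P c \<and>
    (\<forall>x y. cmod (F (x, y) - block_kernel P c x y) \<le> \<delta> * indicator K x * indicator K y))"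
proof -
  define S where "S = closure {p. F p \<noteq> 0}"
  have cont: "continuous_on UNIV F" and S: "compact S" "S \<subseteq> tolerance \<epsilon>"
    using F by (auto simp: Cc_tolerance_def S_def)
  have FS: "p \<in> S" if "F p \<noteq> 0" for p
    unfolding S_def using that closure_subset[of "{p. F p \<noteq> 0}"] by blast
  define K where "K = fst ` S \<union> snd ` S"
  have K: "compact K" unfolding K_def
    by (intro compact_Un compact_continuous_image continuous_on_fst continuous_on_snd continuous_on_id S(1))
  have SK: "x \<in> K" "y \<in> K" if "(x, y) \<in> S" for x y
    unfolding K_def using that by force+
  have "\<exists>m. m < \<epsilon> \<and> (\<forall>(x, y)\<in>S. dist x y \<le> m)"
  proof (cases "S = {}")
    case True
    then show ?thesis using eps by (intro exI[of _ 0]) auto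
  next
    case False
    have "continuous_on S (\<lambda>p. dist (fst p) (snd p))" by (intro continuous_intros)
    from continuous_attains_sup[OF S(1) False this]
    obtain p where p: "p \<in> S" "\<forall>q\<in>S. dist (fst q) (snd q) \<le> dist (fst p) (snd p)" by blast
    have "dist (fst p) (snd p) < \<epsilon>" using p(1) S(2) by (auto simp: tolerance_def)
    then show ?thesis using p(2) by (intro exI[of _ "dist (fst p) (snd p)"]) auto
  qed
  then obtain m where m: "m < \<epsilon>" "\<And>x y. (x, y) \<in> S \<Longrightarrow> dist x y \<le> m" by blast
  have "uniformly_continuous_on (K \<times> K) F"
    by (intro compact_uniformly_continuous continuous_on_subset[OF cont] compact_Times K) simp
  note unif = this[unfolded uniformly_continuous_on_def, rule_format]
  have "\<exists>P c. block_structure P c \<and>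
    (\<forall>x y. cmod (F (x, y) - block_kernel P c x y) \<le> \<delta> * indicator K x * indicator K y)"
    if \<delta>: "\<delta> > 0" for \<delta>
  proof -
    obtain \<rho> where \<rho>: "\<rho> > 0" "\<And>p q. p \<in> K \<times> K \<Longrightarrow> q \<in> K \<times> K \<Longrightarrow> dist q p < \<rho> \<Longrightarrow> dist (F q) (F p) < \<delta>"
      using unif[OF \<delta>] by blast
    \<comment> \<open>The parts bound the oscillation of \<open>F\<close> on a block, the size of a piece and, through \<open>m + 4 \<eta> \<le> \<epsilon>\<close>, that of a block with \<open>c A B \<noteq> 0\<close>.\<close>
    define \<eta> where "\<eta> = min (\<rho> / 4) (min (\<epsilon> / 2) ((\<epsilon> - m) / 4))"
    have \<eta>: "\<eta> > 0" "4 * \<eta> \<le> \<rho>" "2 * \<eta> \<le> \<epsilon>" "m + 4 * \<eta> \<le> \<epsilon>"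
      using \<rho>(1) eps m(1) unfolding \<eta>_def min_def by (auto simp: field_simps)
    obtain P where P: "finite P" "disjoint P" "\<Union>P = K" "\<And>A. A \<in> P \<Longrightarrow> A \<in> sets borel"
      "\<And>A. A \<in> P \<Longrightarrow> \<exists>a. A \<subseteq> ball a \<eta>"
      using small_borel_partition[OF K \<eta>(1)] by blast
    define c where "c A B = (if \<exists>p\<in>A \<times> B. F p \<noteq> 0 then F (SOME p. p \<in> A \<times> B \<and> F p \<noteq> 0) else 0)" for A B
    have c: "\<exists>p\<in>A \<times> B. F p = c A B \<and> F p \<noteq> 0" if "\<exists>p\<in>A \<times> B. F p \<noteq> 0" for A B
    proof -
      have "\<exists>p. p \<in> A \<times> B \<and> F p \<noteq> 0" using that by blast
      note some = someI_ex[OF this]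
      have "c A B = F (SOME p. p \<in> A \<times> B \<and> F p \<noteq> 0)" unfolding c_def using that by (rule if_P)
      with some show ?thesis by (intro bexI[of _ "SOME p. p \<in> A \<times> B \<and> F p \<noteq> 0"]) simp_all
    qed
    have small: "dist x x' < 2 * \<eta>" if A: "A \<in> P" "x \<in> A" "x' \<in> A" for A x x'
    proof -
      obtain a where "A \<subseteq> ball a \<eta>" using P(5)[OF A(1)] by blast
      then have "dist a x < \<eta>" "dist a x' < \<eta>" using A(2,3) by auto
      then show ?thesis using dist_triangle[of x x' a] by (simp add: dist_commute)
    qed
    have "block_structure P c"
      unfolding block_structure_def
    proof (intro conjI ballI impI P)
      fix A assume A: "A \<in> P"
      then show "A \<in> sets \<mu>" using P(4) sets_borel by blast
      have "emeasure \<mu> A \<le> emeasure \<mu> K" using A P(3) by (intro emeasure_mono compact_sets K) auto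
      then show "emeasure \<mu> A < \<infinity>" using compact_finite[OF K] by (rule le_less_trans)
      obtain a where "A \<subseteq> ball a \<eta>" using P(5)[OF A] by blast
      then show "\<exists>U. small_open \<epsilon> U \<and> A \<subseteq> U"
        using small_open_balls[of a a \<eta> \<epsilon>] \<eta>(3) by (intro exI[of _ "ball a \<eta> \<union> ball a \<eta>"]) auto
    next
      fix A B assume AB: "A \<in> P" "B \<in> P" and nz: "c A B \<noteq> 0"
      obtain a where a: "A \<subseteq> ball a \<eta>" using P(5)[OF AB(1)] by blast
      obtain b where b: "B \<subseteq> ball b \<eta>" using P(5)[OF AB(2)] by blast
      have "\<exists>p\<in>A \<times> B. F p \<noteq> 0" using nz by (auto simp: c_def split: if_splits)
      then obtain x y where xy: "x \<in> A" "y \<in> B" "F (x, y) \<noteq> 0" by blast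
      then have "dist x y \<le> m" by (intro m(2) FS)
      moreover have "dist a x < \<eta>" "dist b y < \<eta>" using a b xy by auto
      moreover have "dist a b \<le> dist a x + dist x y + dist b y"
        using dist_triangle[of a b x] dist_triangle[of x b y] by (simp add: dist_commute)
      ultimately have "dist a b + 2 * \<eta> \<le> \<epsilon>" using \<eta>(4) by linarith
      from small_open_balls[OF this] show "\<exists>U. small_open \<epsilon> U \<and> A \<union> B \<subseteq> U"
        using a b by (intro exI[of _ "ball a \<eta> \<union> ball b \<eta>"]) auto
    qed
    moreover have "cmod (F (x, y) - block_kernel P c x y) \<le> \<delta> * indicator K x * indicator K y" for x y
    proof (cases "x \<in> K \<and> y \<in> K")
      case False
      then have "F (x, y) = 0" using FS SK by blast
      moreover have "block_kernel P c x y = 0"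
        by (rule block_kernel_zero) (use False P(3) in simp)
      ultimately show ?thesis using \<delta> by simp
    next
      case True
      then obtain A B where AB: "A \<in> P" "x \<in> A" "B \<in> P" "y \<in> B" using P(3) by blast
      have eq: "block_kernel P c x y = c A B" by (rule block_kernel_eq[OF P(1,2) AB])
      have "cmod (F (x, y) - c A B) \<le> \<delta>"
      proof (cases "\<exists>p\<in>A \<times> B. F p \<noteq> 0")
        case False
        then have "F (x, y) = 0" "c A B = 0" using AB by (auto simp: c_def)
        then show ?thesis using \<delta> by simp
      next
        case True
        from c[OF this] obtain x' y' where xy': "x' \<in> A" "y' \<in> B" "F (x', y') = c A B" by auto
        have "dist (x, y) (x', y') \<le> dist x x' + dist y y'"
          unfolding dist_Pair_Pair by (rule sqrt_sum_squares_le_sum) simp_all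
        also have "\<dots> < \<rho>" using small[OF AB(1,2) xy'(1)] small[OF AB(3,4) xy'(2)] \<eta>(2) by linarith
        finally have "dist (F (x, y)) (F (x', y')) < \<delta>"
          using AB xy' P(3) by (intro \<rho>(2)) auto
        then show ?thesis by (simp add: xy'(3) dist_norm)
      qed
      then show ?thesis using True by (simp add: eq)
    qed
    ultimately show ?thesis by blast
  qed
  then show ?thesis using K by blast
qed

lemma block_op_bounded:
  assumes b: "block_structure P c"
  shows "block_op P c \<in> bounded_ops \<mu>"
proof (rule rank_span_subset[OF _ _ block_op_in_span[OF b]])
  show "op_space \<mu> (bounded_ops \<mu>)"
    unfolding op_space_def using bounded_ops_lincomb rank1_bounded[OF l2_zero l2_zero] by blast
  fix f g assume "(f, g) \<in> local_pairs"
  then show "rank1 \<mu> f g \<in> bounded_ops \<mu>"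
    unfolding local_pairs_def by (auto intro: rank1_bounded l2_on_l2)
qed

lemma kernel_op_slice_l2:
  assumes F: "F \<in> Cc_tolerance \<epsilon>"
  shows "(\<lambda>y. cnj (F (x, y))) \<in> l2_space \<mu>"
proof -
  have cont: "continuous_on UNIV F" using F by (simp add: Cc_tolerance_def)
  obtain K P c where K: "compact K" and b: "block_structure P c"
    and le: "\<forall>x y. cmod (F (x, y) - block_kernel P c x y) \<le> 1 * indicator K x * indicator K y"
    using kernel_block_approximation[OF F] zero_less_one by blast
  have "continuous_on UNIV (\<lambda>y. F (x, y))"
    by (rule continuous_on_compose2[OF cont]) (auto intro!: continuous_intros)
  then have "(\<lambda>y. cnj (F (x, y))) \<in> borel_measurable \<mu>"
    by (intro borel_measurable_cnj continuous_measurable)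
  then have m: "(\<lambda>y. cnj (F (x, y)) - cnj (block_kernel P c x y)) \<in> borel_measurable \<mu>"
    using l2_spaceD(1)[OF block_kernel_slice(1)[OF b, of x]] by simp
  have le': "cmod (cnj (F (x, y)) - cnj (block_kernel P c x y)) \<le> indicator K x * indicator K y" for y
    using le[rule_format, of x y] by (simp flip: complex_cnj_diff)
  have "0 \<le> (indicator K x :: real)" by simp
  from l2_add[OF bounded_support_l2(1)[OF m compact_sets[OF K] compact_finite[OF K] this le']
      block_kernel_slice(1)[OF b, of x]]
  show ?thesis by simp
qed

text \<open>
  The pointwise estimate shows in passing that \<open>kernel_op \<mu> F \<xi>\<close> is a pointwise limit of measurable
  functions. It is supported in \<open>K\<close>, so a uniform bound is also a bound for the norm.
\<close>

lemma kernel_op_approximation: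
  assumes F: "F \<in> Cc_tolerance \<epsilon>"
  shows "kernel_op \<mu> F \<in> bounded_ops \<mu>"
    and "\<delta> > 0 \<Longrightarrow> \<exists>P c. block_structure P c \<and> op_norm \<mu> (\<lambda>\<xi> x. kernel_op \<mu> F \<xi> x - block_op P c \<xi> x) < \<delta>"
proof -
  have cont: "continuous_on UNIV F" using F by (simp add: Cc_tolerance_def)
  obtain K where K: "compact K" and approx: "\<And>\<delta>. \<delta> > 0 \<Longrightarrow> \<exists>P c. block_structure P c \<and>
    (\<forall>x y. cmod (F (x, y) - block_kernel P c x y) \<le> \<delta> * indicator K x * indicator K y)"
    using kernel_block_approximation[OF F] by blast
  note Km = compact_sets[OF K] compact_finite[OF K]
  define s where "s = sqrt (measure \<mu> K)"
  have s: "s \<ge> 0" by (simp add: s_def)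
  have diff: "cmod (kernel_op \<mu> F \<xi> x - block_op P c \<xi> x) \<le> (\<delta> * s * l2_norm \<mu> \<xi>) * cmod (indicator K x)"
    if "block_structure P c" "\<delta> > 0" "\<xi> \<in> l2_space \<mu>"
      "\<forall>x y. cmod (F (x, y) - block_kernel P c x y) \<le> \<delta> * indicator K x * indicator K y"
    for P c \<delta> \<xi> x
    unfolding s_def by (rule kernel_block_difference[OF cont that(1) Km _ _ that(3)]) (use that in auto)
  have meas: "kernel_op \<mu> F \<xi> \<in> borel_measurable \<mu>" if \<xi>: "\<xi> \<in> l2_space \<mu>" for \<xi>
  proof -
    have "\<forall>n. \<exists>T. T \<in> bounded_ops \<mu> \<and> (\<forall>x. cmod (kernel_op \<mu> F \<xi> x - T \<xi> x)
        \<le> 1 / real (Suc n) * (s * l2_norm \<mu> \<xi> * cmod (indicator K x)))"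
    proof
      fix n
      have n: "1 / real (Suc n) > 0" by simp
      obtain P c where Pc: "block_structure P c" "\<forall>x y. cmod (F (x, y) - block_kernel P c x y)
          \<le> 1 / real (Suc n) * indicator K x * indicator K y"
        using approx[OF n] by blast
      show "\<exists>T. T \<in> bounded_ops \<mu> \<and> (\<forall>x. cmod (kernel_op \<mu> F \<xi> x - T \<xi> x)
        \<le> 1 / real (Suc n) * (s * l2_norm \<mu> \<xi> * cmod (indicator K x)))"
        using block_op_bounded[OF Pc(1)] diff[OF Pc(1) n \<xi> Pc(2)]
        by (intro exI[of _ "block_op P c"]) (simp add: mult.assoc)
    qed
    from choice[OF this] obtain T where T: "\<And>n. T n \<in> bounded_ops \<mu>"
      and le: "\<And>n x. cmod (kernel_op \<mu> F \<xi> x - T n \<xi> x)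
        \<le> 1 / real (Suc n) * (s * l2_norm \<mu> \<xi> * cmod (indicator K x))" by blast
    show ?thesis
    proof (rule borel_measurable_LIMSEQ_metric)
      show "T n \<xi> \<in> borel_measurable \<mu>" for n by (rule l2_spaceD(1)[OF bounded_opsD(1)[OF T \<xi>]])
      fix x
      have "(\<lambda>n. T n \<xi> x - kernel_op \<mu> F \<xi> x) \<longlonglongrightarrow> 0"
      proof (rule Lim_null_comparison)
        show "\<forall>\<^sub>F n in sequentially. norm (T n \<xi> x - kernel_op \<mu> F \<xi> x)
            \<le> 1 / real (Suc n) * (s * l2_norm \<mu> \<xi> * cmod (indicator K x))"
          by (subst norm_minus_commute) (intro always_eventually allI le)
        have "(\<lambda>n. 1 / real (Suc n)) \<longlonglongrightarrow> 0"
          using LIMSEQ_inverse_real_of_nat by (simp add: inverse_eq_divide)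
        from tendsto_mult_right[OF this]
        show "(\<lambda>n. 1 / real (Suc n) * (s * l2_norm \<mu> \<xi> * cmod (indicator K x))) \<longlonglongrightarrow> 0" by simp
      qed
      then show "(\<lambda>n. T n \<xi> x) \<longlonglongrightarrow> kernel_op \<mu> F \<xi> x" by (simp add: LIM_zero_iff)
    qed
  qed
  have norm: "(\<lambda>x. kernel_op \<mu> F \<xi> x - block_op P c \<xi> x) \<in> l2_space \<mu> \<and>
      l2_norm \<mu> (\<lambda>x. kernel_op \<mu> F \<xi> x - block_op P c \<xi> x) \<le> (\<delta> * s * s) * l2_norm \<mu> \<xi>"
    if Pc: "block_structure P c" "\<delta> > 0"
      "\<forall>x y. cmod (F (x, y) - block_kernel P c x y) \<le> \<delta> * indicator K x * indicator K y"
      and \<xi>: "\<xi> \<in> l2_space \<mu>"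
    for P c \<delta> \<xi>
  proof -
    have m: "(\<lambda>x. kernel_op \<mu> F \<xi> x - block_op P c \<xi> x) \<in> borel_measurable \<mu>"
      using meas[OF \<xi>] l2_spaceD(1)[OF bounded_opsD(1)[OF block_op_bounded[OF Pc(1)] \<xi>]] by simp
    have "0 \<le> \<delta> * s * l2_norm \<mu> \<xi>" using Pc(2) s by simp
    from l2_norm_mono[OF m l2_indicator[OF Km] diff[OF Pc(1,2) \<xi> Pc(3)] this]
    show ?thesis by (simp add: l2_norm_indicator[OF Km(1)] s_def mult_ac)
  qed
  obtain P c where Pc: "block_structure P c"
    "\<forall>x y. cmod (F (x, y) - block_kernel P c x y) \<le> 1 * indicator K x * indicator K y"
    using approx[OF zero_less_one] by blast
  note R = block_op_bounded[OF Pc(1)]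
  note n1 = norm[OF Pc(1) zero_less_one Pc(2)]
  have k2: "kernel_op \<mu> F \<xi> \<in> l2_space \<mu>" if "\<xi> \<in> l2_space \<mu>" for \<xi>
    using l2_add[OF conjunct1[OF n1[OF that]] bounded_opsD(1)[OF R that]] by simp
  show bounded: "kernel_op \<mu> F \<in> bounded_ops \<mu>"
  proof (rule bounded_opsI[OF k2])
    fix \<xi> assume \<xi>: "\<xi> \<in> l2_space \<mu>"
    have "l2_norm \<mu> (kernel_op \<mu> F \<xi>) \<le> l2_norm \<mu> (block_op P c \<xi>)
        + l2_norm \<mu> (\<lambda>x. kernel_op \<mu> F \<xi> x - block_op P c \<xi> x)"
      by (rule l2_norm_triangle_reverse[OF k2[OF \<xi>] bounded_opsD(1)[OF R \<xi>]])
    also have "\<dots> \<le> op_norm \<mu> (block_op P c) * l2_norm \<mu> \<xi> + (1 * s * s) * l2_norm \<mu> \<xi>"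
      by (intro add_mono op_norm_bound[OF R \<xi>] conjunct2[OF n1[OF \<xi>]])
    finally show "l2_norm \<mu> (kernel_op \<mu> F \<xi>) \<le> (op_norm \<mu> (block_op P c) + 1 * s * s) * l2_norm \<mu> \<xi>"
      by (simp only: distrib_right)
  next
    fix f g a b assume f: "f \<in> l2_space \<mu>" and g: "g \<in> l2_space \<mu>"
    show "AE x in \<mu>. kernel_op \<mu> F (\<lambda>y. a * f y + b * g y) x
        = a * kernel_op \<mu> F f x + b * kernel_op \<mu> F g x"
      unfolding kernel_op_eq_inner l2_inner_lincomb_right[OF f g kernel_op_slice_l2[OF F]] by simp
  qed
  show "\<exists>P c. block_structure P c \<and> op_norm \<mu> (\<lambda>\<xi> x. kernel_op \<mu> F \<xi> x - block_op P c \<xi> x) < \<delta>"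
    if \<delta>: "\<delta> > 0"
  proof -
    define \<eta> where "\<eta> = \<delta> / (2 * (s * s + 1))"
    have pos: "s * s + 1 > 0" using s by (intro add_nonneg_pos) auto
    then have \<eta>: "\<eta> > 0" using \<delta> by (simp add: \<eta>_def)
    obtain P c where Pc: "block_structure P c"
      "\<forall>x y. cmod (F (x, y) - block_kernel P c x y) \<le> \<eta> * indicator K x * indicator K y"
      using approx[OF \<eta>] by blast
    have "op_norm \<mu> (\<lambda>\<xi> x. kernel_op \<mu> F \<xi> x - block_op P c \<xi> x) \<le> \<eta> * s * s"
      using s \<eta> norm[OF Pc(1) \<eta> Pc(2)] by (intro op_norm_le) auto
    also have "\<dots> \<le> \<eta> * (s * s + 1)" using \<eta> by (simp add: algebra_simps)
    also have "\<dots> = \<delta> / 2" using pos by (simp add: \<eta>_def field_simps)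
    finally show ?thesis using Pc(1) \<delta> by (intro exI[of _ P] exI[of _ c]) simp
  qed
qed

lemma E_op_compact: "T \<in> E_op \<mu> \<epsilon> \<Longrightarrow> T \<in> compact_ops \<mu>"
  by (simp add: E_op_def)

lemma E_op_bounded: "T \<in> E_op \<mu> \<epsilon> \<Longrightarrow> T \<in> bounded_ops \<mu>"
  by (intro compact_ops_bounded E_op_compact)

lemma E_op_kernel:
  assumes "T \<in> E_op \<mu> \<epsilon>" "\<delta> > 0"
  shows "\<exists>F\<in>Cc_tolerance \<epsilon>. op_norm \<mu> (\<lambda>\<xi> x. T \<xi> x - kernel_op \<mu> F \<xi> x) < \<delta>"
  using assms unfolding E_op_def mem_Collect_eq by blast

lemma E_opI:
  assumes "T \<in> compact_ops \<mu>"
    and "\<And>\<delta>. \<delta> > 0 \<Longrightarrow> \<exists>F\<in>Cc_tolerance \<epsilon>. op_norm \<mu> (\<lambda>\<xi> x. T \<xi> x - kernel_op \<mu> F \<xi> x) < \<delta>"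
  shows "T \<in> E_op \<mu> \<epsilon>"
  using assms unfolding E_op_def mem_Collect_eq by blast

lemma E_op_lincomb:
  assumes T: "T \<in> E_op \<mu> \<epsilon>" and U: "U \<in> E_op \<mu> \<epsilon>"
  shows "(\<lambda>\<xi> x. a * T \<xi> x + b * U \<xi> x) \<in> E_op \<mu> \<epsilon>"
proof (rule E_opI)
  show "(\<lambda>\<xi> x. a * T \<xi> x + b * U \<xi> x) \<in> compact_ops \<mu>"
    by (intro compact_ops_lincomb E_op_compact T U)
  fix \<delta> :: real assume \<delta>: "\<delta> > 0"
  define \<eta> where "\<eta> = \<delta> / (cmod a + cmod b + 1)"
  have pos: "cmod a + cmod b + 1 > 0" by (simp add: add_nonneg_pos)
  then have \<eta>: "\<eta> > 0" using \<delta> by (simp add: \<eta>_def)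
  obtain F where F: "F \<in> Cc_tolerance \<epsilon>" "op_norm \<mu> (\<lambda>\<xi> x. T \<xi> x - kernel_op \<mu> F \<xi> x) < \<eta>"
    using E_op_kernel[OF T \<eta>] by blast
  obtain G where G: "G \<in> Cc_tolerance \<epsilon>" "op_norm \<mu> (\<lambda>\<xi> x. U \<xi> x - kernel_op \<mu> G \<xi> x) < \<eta>"
    using E_op_kernel[OF U \<eta>] by blast
  have FG: "(\<lambda>p. a * F p + b * G p) \<in> Cc_tolerance \<epsilon>"
    using Cc_on_lincomb[OF F(1)[unfolded Cc_tolerance_eq] G(1)[unfolded Cc_tolerance_eq], of a b]
    by (simp only: Cc_tolerance_eq)
  define D1 where "D1 = (\<lambda>\<xi> x. T \<xi> x - kernel_op \<mu> F \<xi> x)"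
  define D2 where "D2 = (\<lambda>\<xi> x. U \<xi> x - kernel_op \<mu> G \<xi> x)"
  have D: "D1 \<in> bounded_ops \<mu>" "D2 \<in> bounded_ops \<mu>"
    unfolding D1_def D2_def
    by (intro bounded_ops_diff E_op_bounded T U kernel_op_approximation(1) F(1) G(1))+
  have eq: "kernel_op \<mu> (\<lambda>p. a * F p + b * G p) \<xi> x = a * kernel_op \<mu> F \<xi> x + b * kernel_op \<mu> G \<xi> x"
    if "\<xi> \<in> l2_space \<mu>" for \<xi> x
    using l2_inner_lincomb_left[OF kernel_op_slice_l2[OF F(1), of x] kernel_op_slice_l2[OF G(1), of x] that,
        of "cnj a" "cnj b"]
    by (simp add: kernel_op_eq_inner)
  have "op_norm \<mu> (\<lambda>\<xi> x. (a * T \<xi> x + b * U \<xi> x) - kernel_op \<mu> (\<lambda>p. a * F p + b * G p) \<xi> x)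
      \<le> cmod a * op_norm \<mu> D1 + cmod b * op_norm \<mu> D2"
  proof (rule op_norm_le)
    show "0 \<le> cmod a * op_norm \<mu> D1 + cmod b * op_norm \<mu> D2"
      using op_norm_nonneg[OF D(1)] op_norm_nonneg[OF D(2)] by simp
    fix \<xi> assume \<xi>: "\<xi> \<in> l2_space \<mu>"
    have "(\<lambda>x. (a * T \<xi> x + b * U \<xi> x) - kernel_op \<mu> (\<lambda>p. a * F p + b * G p) \<xi> x)
        = (\<lambda>x. a * D1 \<xi> x + b * D2 \<xi> x)"
      by (rule ext) (simp add: eq[OF \<xi>] D1_def D2_def algebra_simps)
    then show "l2_norm \<mu> (\<lambda>x. (a * T \<xi> x + b * U \<xi> x) - kernel_op \<mu> (\<lambda>p. a * F p + b * G p) \<xi> x)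
        \<le> (cmod a * op_norm \<mu> D1 + cmod b * op_norm \<mu> D2) * l2_norm \<mu> \<xi>"
      using op_lincomb_bound[OF D \<xi>] by simp
  qed
  also have "\<dots> \<le> cmod a * \<eta> + cmod b * \<eta>"
    using F(2) G(2) by (intro add_mono mult_left_mono) (auto simp: D1_def D2_def)
  also have "\<dots> < (cmod a + cmod b + 1) * \<eta>" using \<eta> by (simp add: algebra_simps)
  also have "\<dots> = \<delta>" using pos by (simp add: \<eta>_def)
  finally show "\<exists>F\<in>Cc_tolerance \<epsilon>. op_norm \<mu> (\<lambda>\<xi> x. (a * T \<xi> x + b * U \<xi> x) - kernel_op \<mu> F \<xi> x) < \<delta>"
    by (rule bexI[OF _ FG])
qed

lemma Cc_tensor:
  assumes U: "small_open \<epsilon> U" and k: "k \<in> Cc_on U" and l: "l \<in> Cc_on U"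
  shows "(\<lambda>p. k (fst p) * cnj (l (snd p))) \<in> Cc_tolerance \<epsilon>"
proof -
  let ?C = "closure {x. k x \<noteq> 0} \<times> closure {x. l x \<noteq> 0}"
  let ?S = "{p. k (fst p) * cnj (l (snd p)) \<noteq> 0}"
  have C: "compact ?C" using k l by (intro compact_Times) (auto simp: Cc_on_def)
  have "?C \<subseteq> U \<times> U" using k l by (auto simp: Cc_on_def)
  then have Ct: "?C \<subseteq> tolerance \<epsilon>" using U by (auto simp: small_open_def)
  have "?S \<subseteq> ?C"
    using closure_subset[of "{x. k x \<noteq> 0}"] closure_subset[of "{x. l x \<noteq> 0}"] by auto
  then have sub: "closure ?S \<subseteq> ?C" by (intro closure_minimal compact_imp_closed C)
  then have "compact (closure ?S)"
    using compact_Int_closed[OF C closed_closure, of ?S] by (simp add: Int_absorb1)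
  moreover have "continuous_on UNIV (\<lambda>p. k (fst p) * cnj (l (snd p)))"
  proof (intro continuous_on_mult continuous_on_cnj)
    show "continuous_on UNIV (\<lambda>p. k (fst p))"
      using k by (intro continuous_on_compose2[of UNIV k UNIV fst] continuous_on_fst continuous_on_id)
        (auto simp: Cc_on_def)
    show "continuous_on UNIV (\<lambda>p. l (snd p))"
      using l by (intro continuous_on_compose2[of UNIV l UNIV snd] continuous_on_snd continuous_on_id)
        (auto simp: Cc_on_def)
  qed
  ultimately show ?thesis
    unfolding Cc_tolerance_def mem_Collect_eq using order.trans[OF sub Ct] by (intro conjI)
qed

text \<open>
  If \<open>k\<close> and \<open>l\<close> are continuous with compact support in a small open set, then \<open>rank1 \<mu> k l\<close> is the
  integral operator with kernel \<open>k(x) cnj (l(y))\<close>, and such functions are dense in \<open>L\<^sup>2\<close> of that set.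
\<close>

lemma rank1_in_E_op:
  assumes "(f, g) \<in> local_pairs"
  shows "rank1 \<mu> f g \<in> E_op \<mu> \<epsilon>"
proof -
  obtain U where U: "small_open \<epsilon> U" and fU: "f \<in> l2_on \<mu> U" and gU: "g \<in> l2_on \<mu> U"
    using assms unfolding local_pairs_def by blast
  have oU: "open U" using U by (simp add: small_open_def)
  have f: "f \<in> l2_space \<mu>" and g: "g \<in> l2_space \<mu>" using fU gU by (auto intro: l2_on_l2)
  show ?thesis
  proof (rule E_opI[OF rank1_compact[OF f g]])
    fix \<delta> :: real assume \<delta>: "\<delta> > 0"
    define \<eta> where "\<eta> = \<delta> / (2 * (l2_norm \<mu> g + 1))"
    have gp: "l2_norm \<mu> g + 1 > 0" by (simp add: add_nonneg_pos)
    then have \<eta>: "\<eta> > 0" using \<delta> by (simp add: \<eta>_def)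
    obtain k where k: "k \<in> Cc_on U" "l2_norm \<mu> (\<lambda>x. f x - k x) < \<eta>"
      using Cc_dense_l2_on[OF oU fU \<eta>] by blast
    define \<zeta> where "\<zeta> = \<delta> / (2 * (l2_norm \<mu> k + 1))"
    have kp: "l2_norm \<mu> k + 1 > 0" by (simp add: add_nonneg_pos)
    then have \<zeta>: "\<zeta> > 0" using \<delta> by (simp add: \<zeta>_def)
    obtain l where l: "l \<in> Cc_on U" "l2_norm \<mu> (\<lambda>x. g x - l x) < \<zeta>"
      using Cc_dense_l2_on[OF oU gU \<zeta>] by blast
    have k2: "k \<in> l2_space \<mu>" and l2: "l \<in> l2_space \<mu>" using Cc_on_l2 k(1) l(1) by blast+
    let ?F = "\<lambda>p. k (fst p) * cnj (l (snd p))"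
    have "kernel_op \<mu> ?F = rank1 \<mu> k l"
      by (intro ext) (simp add: kernel_op_def rank1_def l2_inner_def mult.assoc)
    then have "op_norm \<mu> (\<lambda>\<xi> x. rank1 \<mu> f g \<xi> x - kernel_op \<mu> ?F \<xi> x)
        = op_norm \<mu> (\<lambda>\<xi> x. rank1 \<mu> f g \<xi> x - rank1 \<mu> k l \<xi> x)" by simp
    also have "\<dots> \<le> l2_norm \<mu> (\<lambda>x. f x - k x) * l2_norm \<mu> g + l2_norm \<mu> k * l2_norm \<mu> (\<lambda>x. g x - l x)"
    proof (rule op_norm_le)
      fix \<xi> assume \<xi>: "\<xi> \<in> l2_space \<mu>"
      have "(\<lambda>x. rank1 \<mu> f g \<xi> x - rank1 \<mu> k l \<xi> x)
          = (\<lambda>x. rank1 \<mu> (\<lambda>x. f x - k x) g \<xi> x + rank1 \<mu> k (\<lambda>x. g x - l x) \<xi> x)"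
        by (rule ext) (simp add: rank1_def l2_inner_diff_left[OF g l2 \<xi>] algebra_simps)
      then have "l2_norm \<mu> (\<lambda>x. rank1 \<mu> f g \<xi> x - rank1 \<mu> k l \<xi> x)
          \<le> l2_norm \<mu> (rank1 \<mu> (\<lambda>x. f x - k x) g \<xi>) + l2_norm \<mu> (rank1 \<mu> k (\<lambda>x. g x - l x) \<xi>)"
        using l2_norm_triangle[OF rank1_l2[OF l2_diff[OF f k2]] rank1_l2[OF k2]] by simp
      also have "\<dots> \<le> (l2_norm \<mu> (\<lambda>x. f x - k x) * l2_norm \<mu> g) * l2_norm \<mu> \<xi>
          + (l2_norm \<mu> k * l2_norm \<mu> (\<lambda>x. g x - l x)) * l2_norm \<mu> \<xi>"
        by (intro add_mono l2_norm_rank1_le g \<xi> l2_diff[OF g l2])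
      finally show "l2_norm \<mu> (\<lambda>x. rank1 \<mu> f g \<xi> x - rank1 \<mu> k l \<xi> x)
          \<le> (l2_norm \<mu> (\<lambda>x. f x - k x) * l2_norm \<mu> g + l2_norm \<mu> k * l2_norm \<mu> (\<lambda>x. g x - l x)) * l2_norm \<mu> \<xi>"
        by (simp add: distrib_right)
    qed simp
    also have "\<dots> \<le> \<eta> * l2_norm \<mu> g + l2_norm \<mu> k * \<zeta>"
      using k(2) l(2) by (intro add_mono mult_mono) (auto simp: less_imp_le \<eta>)
    also have "\<dots> < \<eta> * (l2_norm \<mu> g + 1) + (l2_norm \<mu> k + 1) * \<zeta>"
      using \<eta> \<zeta> by (simp add: algebra_simps)
    also have "\<dots> = \<delta>"
    proof -
      have half: "d / (2 * t) * t = d / 2" if "t > 0" for d t :: real using that by simp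
      show ?thesis
        using half[OF gp, of \<delta>] half[OF kp, of \<delta>]
        unfolding \<eta>_def \<zeta>_def by (simp only: mult.commute[of "l2_norm \<mu> k + 1"])
    qed
    finally show "\<exists>F\<in>Cc_tolerance \<epsilon>. op_norm \<mu> (\<lambda>\<xi> x. rank1 \<mu> f g \<xi> x - kernel_op \<mu> F \<xi> x) < \<delta>"
      by (rule bexI[OF _ Cc_tensor[OF U k(1) l(1)]])
  qed
qed

lemma op_space_E: "op_space \<mu> (E_op \<mu> \<epsilon>)"
proof -
  have "small_open \<epsilon> {}" by (simp add: small_open_def)
  then have "((\<lambda>x. 0), (\<lambda>x. 0)) \<in> local_pairs" by (rule local_pairsI) (simp_all add: l2_on_def l2_zero)
  from rank1_in_E_op[OF this] have "E_op \<mu> \<epsilon> \<noteq> {}" by blast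
  moreover have "E_op \<mu> \<epsilon> \<subseteq> bounded_ops \<mu>" using E_op_bounded by blast
  ultimately show ?thesis unfolding op_space_def using E_op_lincomb by (intro conjI ballI allI)
qed

lemma block_op_in_E: "block_structure P c \<Longrightarrow> block_op P c \<in> E_op \<mu> \<epsilon>"
  by (rule rank_span_subset[OF op_space_E rank1_in_E_op block_op_in_span])

lemma E_op_block_approximation:
  assumes T: "T \<in> E_op \<mu> \<epsilon>" and \<delta>: "\<delta> > 0"
  shows "\<exists>P c. block_structure P c \<and> op_norm \<mu> (\<lambda>\<xi> x. T \<xi> x - block_op P c \<xi> x) < \<delta>"
proof -
  have \<delta>2: "\<delta> / 2 > 0" using \<delta> by simp
  obtain F where F: "F \<in> Cc_tolerance \<epsilon>" "op_norm \<mu> (\<lambda>\<xi> x. T \<xi> x - kernel_op \<mu> F \<xi> x) < \<delta> / 2"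
    using E_op_kernel[OF T \<delta>2] by blast
  obtain P c where Pc: "block_structure P c"
    "op_norm \<mu> (\<lambda>\<xi> x. kernel_op \<mu> F \<xi> x - block_op P c \<xi> x) < \<delta> / 2"
    using kernel_op_approximation(2)[OF F(1) \<delta>2] by blast
  have "op_norm \<mu> (\<lambda>\<xi> x. T \<xi> x - block_op P c \<xi> x) < \<delta>"
    using op_norm_triangle_via[OF E_op_bounded[OF T] kernel_op_approximation(1)[OF F(1)]
        block_op_bounded[OF Pc(1)]] F(2) Pc(2) by simp
  then show ?thesis using Pc(1) by blast
qed

lemma E_op_generated: "rank1_generated \<mu> (E_op \<mu> \<epsilon>) local_pairs"
  unfolding rank1_generated_def
proof (intro conjI ballI allI impI op_space_E)
  fix p assume "p \<in> local_pairs"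
  then show "case p of (f, g) \<Rightarrow> rank1 \<mu> f g \<in> E_op \<mu> \<epsilon>"
    by (cases p) (simp add: rank1_in_E_op)
next
  fix T \<delta> assume "T \<in> E_op \<mu> \<epsilon>" "\<delta> > (0::real)"
  from E_op_block_approximation[OF this]
  show "\<exists>R\<in>rank_span \<mu> local_pairs. op_norm \<mu> (\<lambda>\<xi> x. T \<xi> x - R \<xi> x) < \<delta>"
    using block_op_in_span by blast
qed

text \<open>
  Vector functionals keep their norm under restriction to the operator space: cutting \<open>p\<close> into
  finitely many pieces of small support loses little, and the projection onto the span of the
  pieces is a sum of rank-one operators of small support.
\<close>

lemma vector_functional_norming:
  assumes p: "p \<in> l2_space \<mu>" "l2_norm \<mu> p = 1" and e: "e < 1"
  shows "\<exists>T\<in>E_op \<mu> \<epsilon>. op_norm \<mu> T \<le> 1 \<and> e < cmod (l2_inner \<mu> p (T p))"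
proof -
  \<comment> \<open>Removing a part of norm \<open>\<delta>\<close> from a unit vector leaves a squared norm of at least \<open>1 - 2 \<delta> > e\<close>.\<close>
  define \<delta> where "\<delta> = (1 - e) / 4"
  have \<delta>: "\<delta> > 0" using e by (simp add: \<delta>_def)
  have "p \<in> l2_on \<mu> UNIV" using p by (simp add: l2_on_def)
  from Cc_dense_l2_on[OF open_UNIV this \<delta>]
  obtain k where k: "k \<in> Cc_on UNIV" "l2_norm \<mu> (\<lambda>x. p x - k x) < \<delta>" by blast
  define K where "K = closure {x. k x \<noteq> 0}"
  have K: "compact K" using k(1) by (simp add: Cc_on_def K_def)
  have k0: "k x = 0" if "x \<notin> K" for x
    using that closure_subset[of "{x. k x \<noteq> 0}"] unfolding K_def by blast
  define pA where "pA A x = indicator A x * p x" for A x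
  have pA: "pA A \<in> l2_space \<mu>" if "A \<in> sets \<mu>" for A
    unfolding pA_def by (rule l2_cutoff[OF p(1) that])
  have inner_pA: "l2_inner \<mu> p (pA A) = of_real ((l2_norm \<mu> (pA A))\<^sup>2)" for A
    unfolding l2_inner_self[symmetric] l2_inner_def pA_def
    by (rule Bochner_Integration.integral_cong) (auto simp: indicator_def)
  have "l2_norm \<mu> (\<lambda>x. p x - pA K x) \<le> 1 * l2_norm \<mu> (\<lambda>x. p x - k x)"
  proof (rule l2_norm_mono(2))
    show "(\<lambda>x. p x - pA K x) \<in> borel_measurable \<mu>"
      by (rule l2_spaceD(1)[OF l2_diff[OF p(1) pA[OF compact_sets[OF K]]]])
    show "(\<lambda>x. p x - k x) \<in> l2_space \<mu>" by (rule l2_diff[OF p(1) Cc_on_l2[OF k(1)]])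
    show "cmod (p x - pA K x) \<le> 1 * cmod (p x - k x)" for x
      using k0[of x] by (cases "x \<in> K") (simp_all add: pA_def)
  qed simp
  then have "l2_norm \<mu> (pA K) \<ge> 1 - \<delta>"
    using k(2) l2_norm_triangle_reverse[OF p(1) pA[OF compact_sets[OF K]]] p(2) by linarith
  moreover have "2 * l2_norm \<mu> (pA K) \<le> (l2_norm \<mu> (pA K))\<^sup>2 + 1"
    using sum_squares_bound[of "l2_norm \<mu> (pA K)" 1] by simp
  ultimately have "1 - 2 * \<delta> \<le> (l2_norm \<mu> (pA K))\<^sup>2" by linarith
  moreover have "e < 1 - 2 * \<delta>" using e by (simp add: \<delta>_def field_simps)
  ultimately have big: "e < (l2_norm \<mu> (pA K))\<^sup>2" by (rule less_le_trans[rotated])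
  obtain P where P: "finite P" "disjoint P" "\<Union>P = K" "\<And>A. A \<in> P \<Longrightarrow> A \<in> sets borel"
    "\<And>A. A \<in> P \<Longrightarrow> \<exists>a. A \<subseteq> ball a (\<epsilon> / 2)"
    using small_borel_partition[OF K, of "\<epsilon> / 2"] eps by auto
  have Ps: "A \<in> sets \<mu>" if "A \<in> P" for A using P(4)[OF that] sets_borel by blast
  define P' where "P' = {A \<in> P. l2_norm \<mu> (pA A) \<noteq> 0}"
  have P': "finite P'" "P' \<subseteq> P" using P(1) by (auto simp: P'_def)
  define u where "u A = (\<lambda>x. of_real (1 / l2_norm \<mu> (pA A)) * pA A x)" for A
  have u: "u A \<in> l2_space \<mu>" if "A \<in> P'" for A
    unfolding u_def using that P'(2) by (intro l2_scale pA Ps) blast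
  have on: "l2_orthonormal \<mu> u P'"
    unfolding u_def
  proof (rule normalised_disjoint_orthonormal)
    show "pA A \<in> l2_space \<mu>" if "A \<in> P'" for A using that P'(2) by (intro pA Ps) blast
    show "l2_norm \<mu> (pA A) \<noteq> 0" if "A \<in> P'" for A using that by (simp add: P'_def)
    fix A B x assume AB: "A \<in> P'" "B \<in> P'" "A \<noteq> B"
    then have "A \<inter> B = {}" using disjointD[OF P(2) _ _ AB(3)] P'(2) by blast
    then show "pA A x = 0 \<or> pA B x = 0" by (auto simp: pA_def indicator_def)
  qed
  have "(u A, u A) \<in> local_pairs" if A: "A \<in> P'" for A
  proof -
    obtain a where "A \<subseteq> ball a (\<epsilon> / 2)" using P(5) A P'(2) by blast
    then have "A \<subseteq> ball a (\<epsilon> / 2) \<union> ball a (\<epsilon> / 2)" by simp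
    then have "pA A x = 0" if "x \<notin> ball a (\<epsilon> / 2) \<union> ball a (\<epsilon> / 2)" for x
      unfolding pA_def using that by (auto simp: indicator_def)
    then have uA: "u A \<in> l2_on \<mu> (ball a (\<epsilon> / 2) \<union> ball a (\<epsilon> / 2))"
      using u[OF A] by (auto simp: l2_on_def u_def)
    have "small_open \<epsilon> (ball a (\<epsilon> / 2) \<union> ball a (\<epsilon> / 2))" by (rule small_open_balls) simp
    from local_pairsI[OF this uA uA] show ?thesis .
  qed
  then have "(\<lambda>\<xi> x. \<Sum>A\<in>P'. rank1 \<mu> (u A) (u A) \<xi> x) \<in> rank_span \<mu> local_pairs"
    by (rule rank_span_sum[OF P'(1)])
  from rank_span_subset[OF op_space_E rank1_in_E_op this]
  have T: "l2_proj \<mu> u P' \<in> E_op \<mu> \<epsilon>" unfolding l2_proj_def .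
  have "op_norm \<mu> (l2_proj \<mu> u P') \<le> 1"
    using l2_proj_norm_le(1)[OF on P'(1)] by (intro op_norm_le) auto
  moreover have "l2_inner \<mu> p (l2_proj \<mu> u P' p) = of_real ((l2_norm \<mu> (pA K))\<^sup>2)"
  proof -
    have "l2_inner \<mu> p (l2_proj \<mu> u P' p) = (\<Sum>A\<in>P'. l2_inner \<mu> p (u A) * l2_inner \<mu> (u A) p)"
      by (rule l2_inner_proj[OF u p(1)])
    also have "\<dots> = (\<Sum>A\<in>P'. of_real ((l2_norm \<mu> (pA A))\<^sup>2))"
    proof (rule sum.cong[OF refl])
      fix A assume "A \<in> P'"
      then have n: "l2_norm \<mu> (pA A) \<noteq> 0" by (simp add: P'_def)
      have "l2_inner \<mu> p (u A) = of_real (l2_norm \<mu> (pA A))"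
        unfolding u_def l2_inner_scale_right inner_pA using n by (simp add: power2_eq_square)
      then show "l2_inner \<mu> p (u A) * l2_inner \<mu> (u A) p = of_real ((l2_norm \<mu> (pA A))\<^sup>2)"
        by (subst l2_inner_commute[of \<mu> "u A" p]) (simp add: power2_eq_square)
    qed
    also have "\<dots> = (\<Sum>A\<in>P. of_real ((l2_norm \<mu> (pA A))\<^sup>2))"
      using P(1) by (intro sum.mono_neutral_left) (auto simp: P'_def)
    also have "\<dots> = (\<Sum>A\<in>P. l2_inner \<mu> p (pA A))" by (simp only: inner_pA)
    also have "\<dots> = l2_inner \<mu> p (\<lambda>x. \<Sum>A\<in>P. pA A x)"
      by (rule l2_inner_sum_right[symmetric, OF p(1) pA[OF Ps]])
    also have "(\<lambda>x. \<Sum>A\<in>P. pA A x) = pA K"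
    proof
      fix x
      have "disjoint_family_on (\<lambda>A. A) P"
        unfolding disjoint_family_on_def using disjointD[OF P(2)] by blast
      then have "(indicator (\<Union>A\<in>P. A) x :: complex) = (\<Sum>A\<in>P. indicator A x)"
        by (rule indicator_UN_disjoint[OF P(1)])
      then have "(\<Sum>A\<in>P. indicator A x) = (indicator K x :: complex)" by (simp add: P(3))
      then show "(\<Sum>A\<in>P. pA A x) = pA K x" by (simp add: pA_def sum_distrib_right[symmetric])
    qed
    finally show ?thesis by (simp only: inner_pA)
  qed
  then have "e < cmod (l2_inner \<mu> p (l2_proj \<mu> u P' p))" using big by (simp only: norm_of_real abs_power2)
  ultimately show ?thesis using T by blast
qed

lemma vector_functional_state:
  assumes S: "op_space \<mu> S" "E_op \<mu> \<epsilon> \<subseteq> S" and p: "p \<in> l2_space \<mu>" "l2_norm \<mu> p = 1"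
  shows "(\<lambda>T\<in>S. l2_inner \<mu> p (T p)) \<in> states \<mu> S"
proof (rule statesI[OF S(1)])
  show "quasi_state \<mu> S (\<lambda>T\<in>S. l2_inner \<mu> p (T p))"
    by (rule quasi_state_restrict[OF S(1) vector_functional_quasi_state[OF S(1) p(1)]]) (simp add: p(2))
  fix e :: real assume "e < 1"
  from vector_functional_norming[OF p this] obtain T where
    T: "T \<in> E_op \<mu> \<epsilon>" "op_norm \<mu> T \<le> 1" "e < cmod (l2_inner \<mu> p (T p))" by blast
  then have "T \<in> S" using S(2) by blast
  then show "\<exists>T\<in>S. op_norm \<mu> T \<le> 1 \<and> e < cmod ((\<lambda>T\<in>S. l2_inner \<mu> p (T p)) T)"
    using T(2,3) by (intro bexI[of _ T]) simp_all
qed simp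

end

section \<open>Extending a state to a mean on the unit ball\<close>

lemma Re_of_real_mult: "Re (of_real r * z) = r * Re z"
  by simp

lemma numerical_bound_scale:
  assumes T: "T \<in> bounded_ops M" and h: "h \<in> l2_space M"
    and r: "\<And>k. k \<in> l2_space M \<Longrightarrow> l2_norm M k \<le> 1 \<Longrightarrow> Re (l2_inner M k (T k)) \<le> r"
  shows "Re (l2_inner M h (T h)) \<le> r * (l2_norm M h)\<^sup>2"
proof (cases "l2_norm M h = 0")
  case True
  then have "cmod (l2_inner M h (T h)) \<le> 0" using l2_inner_op_bound[OF T h h] by simp
  then show ?thesis using True by simp
next
  case False
  define s where "s = l2_norm M h"
  have s: "s > 0" using False l2_norm_nonneg[of M h] unfolding s_def by linarith
  define k where "k = (\<lambda>x. of_real (1/s) * h x + 0 * h x)"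
  have k: "k \<in> l2_space M" unfolding k_def by (rule l2_lincomb[OF h h])
  have "l2_norm M k = cmod (of_real (1/s)) * l2_norm M h"
    unfolding k_def l2_norm_scale[symmetric] by simp
  also have "\<dots> = 1" using s unfolding norm_of_real by (simp add: s_def)
  finally have "Re (l2_inner M k (T k)) \<le> r" using r[OF k] by simp
  moreover have "l2_inner M k (T k) = of_real (1/s) * l2_inner M k (T h)"
    using l2_inner_op_lincomb[OF T h h k, of "of_real (1/s)" 0] unfolding k_def by simp
  moreover have "l2_inner M k (T h) = of_real (1/s) * l2_inner M h (T h)"
    using l2_inner_scale_left[of M "of_real (1/s)" h "T h"] unfolding k_def by simp
  ultimately have "Re (of_real (1/s) * (of_real (1/s) * l2_inner M h (T h))) \<le> r" by simp
  then have "Re (of_real (1/s * (1/s)) * l2_inner M h (T h)) \<le> r" by (simp only: of_real_mult mult.assoc)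
  then have "1/s * (1/s) * Re (l2_inner M h (T h)) \<le> r" by (simp only: Re_of_real_mult)
  then show ?thesis using s by (simp add: s_def[symmetric] power2_eq_square field_simps)
qed

context radon_metric_space
begin

lemma l2_inner_block_op:
  assumes b: "block_structure P c" and h: "h \<in> l2_space \<mu>"
  shows "l2_inner \<mu> h (block_op P c k)
    = (\<Sum>i\<in>P \<times> P. c (fst i) (snd i) * l2_inner \<mu> h (indicator (fst i)) * l2_inner \<mu> (indicator (snd i)) k)"
proof -
  have "l2_inner \<mu> h (block_op P c k) = (\<Sum>i\<in>P \<times> P. l2_inner \<mu> h
      (rank1 \<mu> (\<lambda>x. c (fst i) (snd i) * indicator (fst i) x) (indicator (snd i)) k))"
    unfolding block_op_def
    by (intro l2_inner_sum_right[OF h] rank1_l2 l2_scale block_indicator_l2[OF b]) auto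
  then show ?thesis by (simp only: l2_inner_rank1 l2_inner_scale_right)
qed

definition block_adjoint :: "('a set \<Rightarrow> 'a set \<Rightarrow> complex) \<Rightarrow> 'a set \<Rightarrow> 'a set \<Rightarrow> complex" where
  "block_adjoint c A B = cnj (c B A)"

lemma block_structure_adjoint:
  assumes b: "block_structure P c"
  shows "block_structure P (block_adjoint c)"
  unfolding block_structure_def
proof (intro conjI ballI impI)
  show "finite P" "disjoint P" by (rule block_structureD[OF b])+
next
  fix A assume A: "A \<in> P"
  show "A \<in> sets \<mu>" by (rule block_structureD(3)[OF b A])
  show "emeasure \<mu> A < \<infinity>" by (rule block_structureD(4)[OF b A])
  show "\<exists>U. small_open \<epsilon> U \<and> A \<subseteq> U" by (rule block_structureD(5)[OF b A])
next
  fix A B assume A: "A \<in> P" and B: "B \<in> P" and "block_adjoint c A B \<noteq> 0"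
  then have "c B A \<noteq> 0" by (simp add: block_adjoint_def)
  from block_structureD(6)[OF b B A this] show "\<exists>U. small_open \<epsilon> U \<and> A \<union> B \<subseteq> U"
    by (simp only: Un_commute)
qed

lemma block_structure_scale: "block_structure P c \<Longrightarrow> block_structure P (\<lambda>A B. a * c A B)"
  unfolding block_structure_def by auto

lemma l2_inner_block_adjoint:
  assumes b: "block_structure P c" and h: "h \<in> l2_space \<mu>"
  shows "l2_inner \<mu> h (block_op P (block_adjoint c) h) = cnj (l2_inner \<mu> h (block_op P c h))"
proof -
  have "cnj (l2_inner \<mu> h (block_op P c h)) = (\<Sum>i\<in>P \<times> P. cnj (c (fst i) (snd i))
      * l2_inner \<mu> (indicator (fst i)) h * l2_inner \<mu> h (indicator (snd i)))"
    unfolding l2_inner_block_op[OF b h] cnj_sum complex_cnj_mult l2_inner_commute[symmetric] ..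
  also have "\<dots> = (\<Sum>i\<in>P \<times> P. cnj (c (snd i) (fst i))
      * l2_inner \<mu> (indicator (snd i)) h * l2_inner \<mu> h (indicator (fst i)))"
    by (rule sum.reindex_bij_witness[of _ prod.swap prod.swap]) auto
  also have "\<dots> = l2_inner \<mu> h (block_op P (block_adjoint c) h)"
    unfolding l2_inner_block_op[OF block_structure_adjoint[OF b] h] block_adjoint_def
    by (simp only: mult_ac)
  finally show ?thesis by simp
qed

text \<open>
  The projection \<open>Q\<close> onto the functions constant on each piece of \<open>P\<close> belongs to the operator space.
  A block operator over \<open>P\<close> only sees \<open>Q h\<close>, so that its numerical range is bounded by \<open>r\<close> in the
  stronger sense that its real part is at most \<open>r Q\<close>, and \<open>\<phi> Q \<le> 1\<close>.
\<close>

lemma block_quasi_state_bound_aux: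
  assumes q: "quasi_state \<mu> (E_op \<mu> \<epsilon>) \<phi>" and b: "block_structure P c" and r0: "r \<ge> 0"
    and r: "\<And>k. k \<in> l2_space \<mu> \<Longrightarrow> l2_norm \<mu> k \<le> 1 \<Longrightarrow> Re (l2_inner \<mu> k (block_op P c k)) \<le> r"
  shows "Im (\<phi> (block_op P c) + \<phi> (block_op P (block_adjoint c))) = 0"
    and "Re (\<phi> (block_op P c) + \<phi> (block_op P (block_adjoint c))) \<le> 2 * r"
proof -
  define X where "X = block_op P c"
  define Y where "Y = block_op P (block_adjoint c)"
  have XE: "X \<in> E_op \<mu> \<epsilon>" and YE: "Y \<in> E_op \<mu> \<epsilon>"
    unfolding X_def Y_def by (intro block_op_in_E b block_structure_adjoint)+
  \<comment> \<open>Pieces of measure zero cannot be normalised; \<open>X\<close> does not see them.\<close>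
  define P' where "P' = {A \<in> P. l2_norm \<mu> (indicator A) \<noteq> 0}"
  have P': "finite P'" "P' \<subseteq> P" using block_structureD(1)[OF b] by (auto simp: P'_def)
  define e :: "'a set \<Rightarrow> 'a \<Rightarrow> complex"
    where "e A = (\<lambda>x. of_real (1 / l2_norm \<mu> (indicator A)) * indicator A x)" for A
  have ind: "(indicator A :: 'a \<Rightarrow> complex) \<in> l2_space \<mu>" if "A \<in> P" for A
    by (rule block_indicator_l2[OF b that])
  have e: "e A \<in> l2_space \<mu>" if "A \<in> P'" for A
    unfolding e_def using that P'(2) by (intro l2_scale ind) blast
  have on: "l2_orthonormal \<mu> e P'"
    unfolding e_def
  proof (rule normalised_disjoint_orthonormal)
    show "(indicator A :: 'a \<Rightarrow> complex) \<in> l2_space \<mu>" if "A \<in> P'" for A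
      using that P'(2) by (intro ind) blast
    show "l2_norm \<mu> (indicator A) \<noteq> 0" if "A \<in> P'" for A using that by (simp add: P'_def)
    fix A B x assume AB: "A \<in> P'" "B \<in> P'" "A \<noteq> B"
    then have "A \<inter> B = {}" using disjointD[OF block_structureD(2)[OF b] _ _ AB(3)] P'(2) by blast
    then show "indicator A x = (0 :: complex) \<or> indicator B x = (0 :: complex)" by (auto simp: indicator_def)
  qed
  define Q where "Q = l2_proj \<mu> e P'"
  have "(e A, e A) \<in> local_pairs" if A: "A \<in> P'" for A
  proof -
    have AP: "A \<in> P" using A P'(2) by blast
    obtain U where U: "small_open \<epsilon> U" "A \<subseteq> U" using block_structureD(5)[OF b AP] by blast
    have "e A \<in> l2_on \<mu> U" unfolding e_def by (rule indicator_l2_on[OF ind[OF AP] U(2)])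
    then show ?thesis by (intro local_pairsI[OF U(1)])
  qed
  then have "(\<lambda>\<xi> x. \<Sum>A\<in>P'. rank1 \<mu> (e A) (e A) \<xi> x) \<in> rank_span \<mu> local_pairs"
    by (rule rank_span_sum[OF P'(1)])
  from rank_span_subset[OF op_space_E rank1_in_E_op this]
  have QE: "Q \<in> E_op \<mu> \<epsilon>" unfolding Q_def l2_proj_def .
  have Qn: "op_norm \<mu> Q \<le> 1"
    unfolding Q_def using l2_proj_norm_le(1)[OF on P'(1)] by (intro op_norm_le) auto
  have Q2: "Q h \<in> l2_space \<mu>" for h unfolding Q_def by (rule l2_proj_l2[OF e])
  have Qh: "l2_inner \<mu> h (Q h) = of_real ((l2_norm \<mu> (Q h))\<^sup>2)" if "h \<in> l2_space \<mu>" for h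
    unfolding Q_def by (rule l2_inner_proj_self[OF on P'(1) that])
  have coeff: "l2_inner \<mu> (indicator A) (Q h) = l2_inner \<mu> (indicator A) h"
    if A: "A \<in> P" and h: "h \<in> l2_space \<mu>" for A h
  proof (cases "l2_norm \<mu> (indicator A) = 0")
    case True
    then have "cmod (l2_inner \<mu> (indicator A) (Q h)) \<le> 0" "cmod (l2_inner \<mu> (indicator A) h) \<le> 0"
      using l2_cauchy_schwarz[OF ind[OF A] Q2[of h]] l2_cauchy_schwarz[OF ind[OF A] h] by simp_all
    then show ?thesis by simp
  next
    case False
    then have "A \<in> P'" using A by (simp add: P'_def)
    from l2_proj_coefficient[OF on P'(1) this, of h]
    show ?thesis using False unfolding e_def l2_inner_scale_left Q_def by simp
  qed
  have coeff': "l2_inner \<mu> (Q h) (indicator A) = l2_inner \<mu> h (indicator A)"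
    if "A \<in> P" "h \<in> l2_space \<mu>" for A h
    using coeff[OF that] by (metis l2_inner_commute)
  have le: "Re (l2_inner \<mu> h (X h)) \<le> r * (l2_norm \<mu> (Q h))\<^sup>2" if h: "h \<in> l2_space \<mu>" for h
  proof -
    have "l2_inner \<mu> h (X h) = l2_inner \<mu> (Q h) (X (Q h))"
      unfolding X_def l2_inner_block_op[OF b h] l2_inner_block_op[OF b Q2]
      by (rule sum.cong[OF refl]) (auto simp: coeff[OF _ h] coeff'[OF _ h])
    then show ?thesis
      using numerical_bound_scale[OF E_op_bounded[OF XE] Q2[of h]] r unfolding X_def by simp
  qed
  \<comment> \<open>Positive, because \<open>2 Re <h, X h> \<le> 2 r \<parallel>Q h\<parallel>\<^sup>2 = 2 r <h, Q h>\<close>.\<close>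
  define D where "D = (\<lambda>\<xi> x. of_real (2 * r) * Q \<xi> x + (-1) * (X \<xi> x + Y \<xi> x))"
  have XY: "(\<lambda>\<xi> x. X \<xi> x + Y \<xi> x) \<in> E_op \<mu> \<epsilon>" by (rule op_space_add[OF op_space_E XE YE])
  have DE: "D \<in> E_op \<mu> \<epsilon>" unfolding D_def by (rule op_space_lincomb[OF op_space_E QE XY])
  have "positive_op \<mu> D"
    unfolding positive_op_def
  proof
    fix h assume h: "h \<in> l2_space \<mu>"
    have X2: "X h \<in> l2_space \<mu>" and Y2: "Y h \<in> l2_space \<mu>"
      using bounded_opsD(1)[OF E_op_bounded[OF XE] h] bounded_opsD(1)[OF E_op_bounded[OF YE] h] by auto
    have "l2_inner \<mu> h (D h) = of_real (2 * r) * l2_inner \<mu> h (Q h)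
        + (-1) * (l2_inner \<mu> h (X h) + l2_inner \<mu> h (Y h))"
      unfolding D_def l2_inner_lincomb_right[OF Q2 l2_add[OF X2 Y2] h] l2_inner_add_right[OF X2 Y2 h] ..
    also have "l2_inner \<mu> h (X h) + l2_inner \<mu> h (Y h) = of_real (2 * Re (l2_inner \<mu> h (X h)))"
      unfolding X_def Y_def l2_inner_block_adjoint[OF b h] by (rule complex_add_cnj)
    finally have "l2_inner \<mu> h (D h)
        = of_real (2 * (r * (l2_norm \<mu> (Q h))\<^sup>2 - Re (l2_inner \<mu> h (X h))))"
      unfolding Qh[OF h] by (simp add: algebra_simps)
    then show "l2_inner \<mu> h (D h) \<in> \<real>\<^sub>\<ge>\<^sub>0" using le[OF h] by (simp only: nonneg_Reals_of_real_iff) simp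
  qed
  then have \<phi>D: "\<phi> D \<in> \<real>\<^sub>\<ge>\<^sub>0" by (rule quasi_stateD(2)[OF q DE])
  have "positive_op \<mu> Q" unfolding positive_op_def using Qh by simp
  then have \<phi>Q: "\<phi> Q \<in> \<real>\<^sub>\<ge>\<^sub>0" by (rule quasi_stateD(2)[OF q QE])
  have "Re (\<phi> Q) \<le> 1"
    using complex_Re_le_cmod[of "\<phi> Q"] quasi_state_le_1[OF q QE Qn] by linarith
  then have "2 * r * Re (\<phi> Q) \<le> 2 * r" using mult_left_mono[of "Re (\<phi> Q)" 1 "2 * r"] r0 by simp
  moreover have "\<phi> D = of_real (2 * r) * \<phi> Q + (-1) * (\<phi> X + \<phi> Y)"
    unfolding D_def functional_lincomb[OF quasi_stateD(1)[OF q] QE XY] functional_add[OF quasi_stateD(1)[OF q] XE YE] ..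
  ultimately show "Im (\<phi> (block_op P c) + \<phi> (block_op P (block_adjoint c))) = 0"
    "Re (\<phi> (block_op P c) + \<phi> (block_op P (block_adjoint c))) \<le> 2 * r"
    using \<phi>D \<phi>Q unfolding X_def Y_def complex_nonneg_Reals_iff by simp_all
qed

text \<open>
  The preceding estimate concerns \<open>\<phi> X + \<phi> X\<^sup>*\<close>. Its statement about imaginary parts, applied to
  \<open>\<i> X\<close> instead of \<open>X\<close>, shows that \<open>\<phi> X\<close> and \<open>\<phi> X\<^sup>*\<close> have the same real part.
\<close>

lemma block_quasi_state_bound:
  assumes q: "quasi_state \<mu> (E_op \<mu> \<epsilon>) \<phi>" and b: "block_structure P c" and r0: "r \<ge> 0"
    and r: "\<And>k. k \<in> l2_space \<mu> \<Longrightarrow> l2_norm \<mu> k \<le> 1 \<Longrightarrow> Re (l2_inner \<mu> k (block_op P c k)) \<le> r"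
  shows "Re (\<phi> (block_op P c)) \<le> r"
proof -
  let ?ic = "\<lambda>A B. \<i> * c A B"
  note b' = block_structure_scale[OF b, of \<i>]
  note lin = quasi_stateD(1)[OF q]
  have ieq: "block_op P ?ic = (\<lambda>\<xi> x. \<i> * block_op P c \<xi> x)"
    unfolding block_op_def rank1_def sum_distrib_left by (simp only: mult.assoc)
  have aeq: "block_op P (block_adjoint ?ic) = (\<lambda>\<xi> x. (- \<i>) * block_op P (block_adjoint c) \<xi> x)"
    unfolding block_op_def rank1_def sum_distrib_left block_adjoint_def complex_cnj_mult complex_cnj_i
    by (simp only: mult.assoc)
  have "Im (\<phi> (block_op P ?ic) + \<phi> (block_op P (block_adjoint ?ic))) = 0"
  proof (rule block_quasi_state_bound_aux(1)[OF q b' op_norm_nonneg[OF block_op_bounded[OF b']]])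
    fix k assume k: "k \<in> l2_space \<mu>" "l2_norm \<mu> k \<le> 1"
    have "op_norm \<mu> (block_op P ?ic) * (l2_norm \<mu> k * l2_norm \<mu> k) \<le> op_norm \<mu> (block_op P ?ic) * (1 * 1)"
      using k(2) by (intro mult_left_mono mult_mono op_norm_nonneg[OF block_op_bounded[OF b']]) auto
    then show "Re (l2_inner \<mu> k (block_op P ?ic k)) \<le> op_norm \<mu> (block_op P ?ic)"
      using l2_inner_op_bound[OF block_op_bounded[OF b'] k(1) k(1)]
        complex_Re_le_cmod[of "l2_inner \<mu> k (block_op P ?ic k)"] by linarith
  qed
  then have "Im (\<i> * \<phi> (block_op P c) + (- \<i>) * \<phi> (block_op P (block_adjoint c))) = 0"
    unfolding ieq aeq functional_scale[OF lin block_op_in_E[OF b]]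
      functional_scale[OF lin block_op_in_E[OF block_structure_adjoint[OF b]]] .
  then have "Re (\<phi> (block_op P c)) = Re (\<phi> (block_op P (block_adjoint c)))" by simp
  then show ?thesis using block_quasi_state_bound_aux(2)[OF q b r0 r] by simp
qed

lemma quasi_state_le_numerical_range:
  assumes q: "quasi_state \<mu> (E_op \<mu> \<epsilon>) \<phi>" and T: "T \<in> E_op \<mu> \<epsilon>"
    and r: "\<And>k. k \<in> l2_space \<mu> \<Longrightarrow> l2_norm \<mu> k \<le> 1 \<Longrightarrow> Re (l2_inner \<mu> k (T k)) \<le> r"
  shows "Re (\<phi> T) \<le> r"
proof (rule field_le_epsilon)
  fix e :: real assume "e > 0"
  then have e2: "e / 2 > 0" by simp
  have r0: "r \<ge> 0" using r[OF l2_zero] by simp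
  obtain P c where b: "block_structure P c"
    and small: "op_norm \<mu> (\<lambda>\<xi> x. T \<xi> x - block_op P c \<xi> x) < e / 2"
    using E_op_block_approximation[OF T e2] by blast
  define D where "D = (\<lambda>\<xi> x. T \<xi> x - block_op P c \<xi> x)"
  note BE = block_op_in_E[OF b]
  have DE: "D \<in> E_op \<mu> \<epsilon>" unfolding D_def by (rule op_space_diff[OF op_space_E T BE])
  have Dn: "op_norm \<mu> D < e / 2" using small by (simp add: D_def)
  have "Re (l2_inner \<mu> k (block_op P c k)) \<le> r + e / 2" if k: "k \<in> l2_space \<mu>" "l2_norm \<mu> k \<le> 1" for k
  proof -
    have "op_norm \<mu> D * (l2_norm \<mu> k * l2_norm \<mu> k) \<le> op_norm \<mu> D * (1 * 1)"
      using k(2) by (intro mult_left_mono mult_mono op_norm_nonneg[OF E_op_bounded[OF DE]]) auto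
    then have "- (e / 2) \<le> Re (l2_inner \<mu> k (D k))"
      using l2_inner_op_bound[OF E_op_bounded[OF DE] k(1) k(1)]
        abs_Re_le_cmod[of "l2_inner \<mu> k (D k)"] Dn by linarith
    moreover have "l2_inner \<mu> k (D k) = l2_inner \<mu> k (T k) - l2_inner \<mu> k (block_op P c k)"
      unfolding D_def
      by (rule l2_inner_diff_right[OF bounded_opsD(1)[OF E_op_bounded[OF T] k(1)]
        bounded_opsD(1)[OF E_op_bounded[OF BE] k(1)] k(1)])
    ultimately show ?thesis using r[OF k] by simp
  qed
  then have "Re (\<phi> (block_op P c)) \<le> r + e / 2"
    using r0 e2 by (intro block_quasi_state_bound[OF q b]) auto
  moreover have "Re (\<phi> D) \<le> e / 2"
    using complex_Re_le_cmod[of "\<phi> D"] quasi_stateD(3)[OF q DE] Dn by linarith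
  moreover have "\<phi> D = \<phi> T - \<phi> (block_op P c)"
    unfolding D_def by (rule functional_diff[OF quasi_stateD(1)[OF q] T BE])
  ultimately show "Re (\<phi> T) \<le> r + e" by simp
qed

definition unit_ball :: "('a \<Rightarrow> complex) set" where
  "unit_ball = {h \<in> l2_space \<mu>. l2_norm \<mu> h \<le> 1}"

lemma unit_ballD: "h \<in> unit_ball \<Longrightarrow> h \<in> l2_space \<mu>" "h \<in> unit_ball \<Longrightarrow> l2_norm \<mu> h \<le> 1"
  by (simp_all add: unit_ball_def)

lemma unit_ball_inner_le:
  assumes h: "h \<in> unit_ball" and f: "f \<in> l2_space \<mu>"
  shows "cmod (l2_inner \<mu> h f) \<le> l2_norm \<mu> f" "cmod (l2_inner \<mu> f h) \<le> l2_norm \<mu> f"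
proof -
  have "l2_norm \<mu> h * l2_norm \<mu> f \<le> 1 * l2_norm \<mu> f"
    using unit_ballD(2)[OF h] by (intro mult_right_mono) auto
  then show "cmod (l2_inner \<mu> h f) \<le> l2_norm \<mu> f" "cmod (l2_inner \<mu> f h) \<le> l2_norm \<mu> f"
    using l2_cauchy_schwarz[OF unit_ballD(1)[OF h] f] l2_cauchy_schwarz[OF f unit_ballD(1)[OF h]]
    by (simp_all add: mult.commute)
qed

lemma unit_ball_quadratic_le:
  assumes h: "h \<in> unit_ball" and T: "T \<in> bounded_ops \<mu>"
  shows "cmod (l2_inner \<mu> h (T h)) \<le> op_norm \<mu> T"
proof -
  have "op_norm \<mu> T * (l2_norm \<mu> h * l2_norm \<mu> h) \<le> op_norm \<mu> T * (1 * 1)"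
    using unit_ballD(2)[OF h] by (intro mult_left_mono mult_mono op_norm_nonneg[OF T]) auto
  then show ?thesis using l2_inner_op_bound[OF T unit_ballD(1)[OF h] unit_ballD(1)[OF h]] by simp
qed

text \<open>
  By the bound just proved, \<open>Re (\<phi> T)\<close> is a linear function of the numerical function
  \<open>h \<mapsto> Re <h, T h>\<close> on the unit ball that is dominated by its supremum. So the Hahn-Banach theorem
  applies and presents \<open>\<phi>\<close> as an average of the functionals \<open>T \<mapsto> <h, T h>\<close>.
\<close>

lemma quasi_state_as_mean:
  assumes q: "quasi_state \<mu> (E_op \<mu> \<epsilon>) \<phi>"
  shows "\<exists>m. mean_on unit_ball m \<and>
    (\<forall>T\<in>E_op \<mu> \<epsilon>. \<phi> T = complex_mean m (\<lambda>h. l2_inner \<mu> h (T h)))"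
proof -
  note lin = quasi_stateD(1)[OF q]
  \<comment> \<open>Outside the unit ball the values are set to \<open>0\<close>, for \<open>l2_inner\<close> is linear on \<open>l2_space\<close> only.\<close>
  define Q where "Q T = (\<lambda>h. if h \<in> unit_ball then Re (l2_inner \<mu> h (T h)) else 0)" for T
  define L where "L = {(Q T, Re (\<phi> T)) |T. T \<in> E_op \<mu> \<epsilon>}"
  have inL: "(Q T, Re (\<phi> T)) \<in> L" if "T \<in> E_op \<mu> \<epsilon>" for T unfolding L_def using that by blast
  have bdd: "bounded_fun_on unit_ball (Q T)" if T: "T \<in> E_op \<mu> \<epsilon>" for T
    unfolding bounded_fun_on_def
  proof (intro exI ballI)
    fix h assume h: "h \<in> unit_ball"
    show "\<bar>Q T h\<bar> \<le> op_norm \<mu> T"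
      using abs_Re_le_cmod[of "l2_inner \<mu> h (T h)"] unit_ball_quadratic_le[OF h E_op_bounded[OF T]] h
      by (simp add: Q_def)
  qed
  have "\<exists>m. mean_on unit_ball m \<and> (\<forall>(v, r)\<in>L. m v = r)"
  proof (rule extend_to_mean)
    show "L \<noteq> {}" using inL[OF op_space_zero[OF op_space_E]] by blast
  next
    fix v r w s and a b :: real assume "(v, r) \<in> L" "(w, s) \<in> L"
    then obtain T U where T: "T \<in> E_op \<mu> \<epsilon>" "v = Q T" "r = Re (\<phi> T)"
      and U: "U \<in> E_op \<mu> \<epsilon>" "w = Q U" "s = Re (\<phi> U)" unfolding L_def by blast
    define W where "W = (\<lambda>\<xi> x. of_real a * T \<xi> x + of_real b * U \<xi> x)"
    have WE: "W \<in> E_op \<mu> \<epsilon>" unfolding W_def by (rule op_space_lincomb[OF op_space_E T(1) U(1)])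
    have "Q W = (\<lambda>x. a * v x + b * w x)"
    proof
      fix h
      show "Q W h = a * v h + b * w h"
      proof (cases "h \<in> unit_ball")
        case True
        note h = unit_ballD(1)[OF True]
        have "l2_inner \<mu> h (W h) = of_real a * l2_inner \<mu> h (T h) + of_real b * l2_inner \<mu> h (U h)"
          unfolding W_def
          by (rule l2_inner_lincomb_right[OF bounded_opsD(1)[OF E_op_bounded[OF T(1)] h]
            bounded_opsD(1)[OF E_op_bounded[OF U(1)] h] h])
        then show ?thesis using True by (simp add: Q_def T(2) U(2))
      qed (simp add: Q_def T(2) U(2))
    qed
    moreover have "\<phi> W = of_real a * \<phi> T + of_real b * \<phi> U"
      unfolding W_def by (rule functional_lincomb[OF lin T(1) U(1)])
    then have "Re (\<phi> W) = a * r + b * s" by (simp add: T(3) U(3))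
    ultimately show "(\<lambda>x. a * v x + b * w x, a * r + b * s) \<in> L" using inL[OF WE] by simp
  next
    fix v r assume "(v, r) \<in> L"
    then obtain T where T: "T \<in> E_op \<mu> \<epsilon>" "v = Q T" "r = Re (\<phi> T)" unfolding L_def by blast
    show "bounded_fun_on unit_ball v" unfolding T(2) by (rule bdd[OF T(1)])
  next
    fix v r c assume "(v, r) \<in> L" and le: "\<forall>x\<in>unit_ball. v x \<le> c"
    then obtain T where T: "T \<in> E_op \<mu> \<epsilon>" "v = Q T" "r = Re (\<phi> T)" unfolding L_def by blast
    show "r \<le> c" unfolding T(3)
    proof (rule quasi_state_le_numerical_range[OF q T(1)])
      fix k assume "k \<in> l2_space \<mu>" "l2_norm \<mu> k \<le> 1"
      then have k: "k \<in> unit_ball" by (simp add: unit_ball_def)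
      show "Re (l2_inner \<mu> k (T k)) \<le> c" using bspec[OF le k] k by (simp add: T(2) Q_def)
    qed
  qed
  then obtain m where m: "mean_on unit_ball m" and ext: "\<forall>(v, r)\<in>L. m v = r" by blast
  have mQ: "m (Q T) = Re (\<phi> T)" if "T \<in> E_op \<mu> \<epsilon>" for T
    using bspec[OF ext inL[OF that]] by simp
  have "\<phi> T = complex_mean m (\<lambda>h. l2_inner \<mu> h (T h))" if T: "T \<in> E_op \<mu> \<epsilon>" for T
  proof -
    define u where "u = (\<lambda>h. if h \<in> unit_ball then l2_inner \<mu> h (T h) else 0)"
    define iT where "iT = (\<lambda>\<xi> x. (- \<i>) * T \<xi> x)"
    have iTE: "iT \<in> E_op \<mu> \<epsilon>" unfolding iT_def by (rule op_space_scale[OF op_space_E T])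
    have "\<phi> iT = (- \<i>) * \<phi> T" unfolding iT_def by (rule functional_scale[OF lin T])
    then have Im: "Im (\<phi> T) = Re (\<phi> iT)" by simp
    have "(\<lambda>h. Re (u h)) = Q T" by (auto simp: u_def Q_def)
    moreover have "(\<lambda>h. Im (u h)) = Q iT"
      unfolding u_def Q_def iT_def l2_inner_scale_right by auto
    ultimately have "complex_mean m u = \<phi> T"
      unfolding complex_mean_def by (simp only: mQ[OF T] mQ[OF iTE] Im[symmetric] complex.collapse)
    moreover have "complex_mean m u = complex_mean m (\<lambda>h. l2_inner \<mu> h (T h))"
    proof (rule complex_mean_cong[OF m])
      show "bounded_fun_on unit_ball (\<lambda>x. cmod (u x))"
        unfolding bounded_fun_on_def u_def using unit_ball_quadratic_le[OF _ E_op_bounded[OF T]]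
        by (intro exI[of _ "op_norm \<mu> T"] ballI) simp
    qed (simp add: u_def)
    ultimately show ?thesis by simp
  qed
  then show ?thesis using m by blast
qed

end

section \<open>Pure states are vector states\<close>

lemma bounded_fun_onI: "(\<And>x. x \<in> B \<Longrightarrow> \<bar>v x\<bar> \<le> K) \<Longrightarrow> bounded_fun_on B v"
  unfolding bounded_fun_on_def by blast

context radon_metric_space
begin

lemma unit_ball_coefficient_bounds:
  assumes g: "g \<in> l2_space \<mu>" and f: "f \<in> l2_space \<mu>"
  shows "bounded_fun_on unit_ball (\<lambda>h. cmod (l2_inner \<mu> h f * l2_inner \<mu> g h))"
    and "bounded_fun_on unit_ball (\<lambda>h. (cmod (l2_inner \<mu> g h))\<^sup>2)"
proof -
  show "bounded_fun_on unit_ball (\<lambda>h. cmod (l2_inner \<mu> h f * l2_inner \<mu> g h))"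
  proof (rule bounded_fun_onI)
    fix h assume h: "h \<in> unit_ball"
    show "\<bar>cmod (l2_inner \<mu> h f * l2_inner \<mu> g h)\<bar> \<le> l2_norm \<mu> f * l2_norm \<mu> g"
      using mult_mono[OF unit_ball_inner_le(1)[OF h f] unit_ball_inner_le(2)[OF h g]]
      by (simp add: norm_mult)
  qed
  show "bounded_fun_on unit_ball (\<lambda>h. (cmod (l2_inner \<mu> g h))\<^sup>2)"
  proof (rule bounded_fun_onI)
    fix h assume h: "h \<in> unit_ball"
    show "\<bar>(cmod (l2_inner \<mu> g h))\<^sup>2\<bar> \<le> (l2_norm \<mu> g)\<^sup>2"
      using power_mono[OF unit_ball_inner_le(2)[OF h g] norm_ge_zero, of 2] by simp
  qed
qed

lemma mean_nonneg:
  assumes "mean_on unit_ball m" "bounded_fun_on unit_ball v" "\<And>h. h \<in> unit_ball \<Longrightarrow> 0 \<le> v h"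
  shows "0 \<le> m v"
proof -
  have b0: "bounded_fun_on unit_ball (\<lambda>h. 0)" by (rule bounded_fun_onI[of _ _ 0]) simp
  have "m (\<lambda>h. 0) = 0" using mean_on_lincomb[OF assms(1) b0 b0, of 0 0] by simp
  then show ?thesis using mean_on_mono[OF assms(1) b0 assms(2,3)] by simp
qed

text \<open>
  The weights \<open>|<g, h>|\<^sup>2\<close> cannot average to zero for every \<open>g\<close>, for otherwise the state vanishes
  on all rank-one operators of the operator space.
\<close>

lemma exists_charged_vector:
  assumes \<phi>: "\<phi> \<in> states \<mu> (E_op \<mu> \<epsilon>)" and m: "mean_on unit_ball m"
    and rep: "\<And>T. T \<in> E_op \<mu> \<epsilon> \<Longrightarrow> \<phi> T = complex_mean m (\<lambda>h. l2_inner \<mu> h (T h))"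
  shows "\<exists>g\<in>l2_space \<mu>. m (\<lambda>h. (cmod (l2_inner \<mu> g h))\<^sup>2) > 0"
proof (rule ccontr)
  assume neg: "\<not> (\<exists>g\<in>l2_space \<mu>. m (\<lambda>h. (cmod (l2_inner \<mu> g h))\<^sup>2) > 0)"
  have q: "quasi_state \<mu> (E_op \<mu> \<epsilon>) \<phi>" by (rule states_imp_quasi_state[OF op_space_E \<phi>])
  have zero: "\<phi> (rank1 \<mu> f g) = 0 * \<phi> (rank1 \<mu> f g)" if fg: "(f, g) \<in> local_pairs" for f g
  proof -
    have f: "f \<in> l2_space \<mu>" and g: "g \<in> l2_space \<mu>"
      using fg unfolding local_pairs_def by (auto intro: l2_on_l2)
    note bf = unit_ball_coefficient_bounds(2)[OF f f]
    note bg = unit_ball_coefficient_bounds(2)[OF g g]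
    have "\<phi> (rank1 \<mu> f g) = complex_mean m (\<lambda>h. l2_inner \<mu> h f * l2_inner \<mu> g h)"
      unfolding rep[OF rank1_in_E_op[OF fg]] l2_inner_rank1 ..
    also have "cmod \<dots> \<le> m (\<lambda>h. 1/2 * (cmod (l2_inner \<mu> f h))\<^sup>2 + 1/2 * (cmod (l2_inner \<mu> g h))\<^sup>2)"
    proof (rule cmod_complex_mean_le[OF m unit_ball_coefficient_bounds(1)[OF g f] bounded_fun_on_lincomb[OF bf bg]])
      fix h
      have "cmod (l2_inner \<mu> h f) = cmod (l2_inner \<mu> f h)"
        by (subst l2_inner_commute) simp
      then show "cmod (l2_inner \<mu> h f * l2_inner \<mu> g h)
          \<le> 1/2 * (cmod (l2_inner \<mu> f h))\<^sup>2 + 1/2 * (cmod (l2_inner \<mu> g h))\<^sup>2"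
        using sum_squares_bound[of "cmod (l2_inner \<mu> f h)" "cmod (l2_inner \<mu> g h)"]
        by (simp add: norm_mult)
    qed
    also have "\<dots> = 1/2 * m (\<lambda>h. (cmod (l2_inner \<mu> f h))\<^sup>2) + 1/2 * m (\<lambda>h. (cmod (l2_inner \<mu> g h))\<^sup>2)"
      by (rule mean_on_lincomb[OF m bf bg])
    also have "\<dots> \<le> 0"
      using neg f g by (intro add_nonpos_nonpos mult_nonneg_nonpos) (auto simp: not_less)
    finally show ?thesis by simp
  qed
  obtain T where T: "T \<in> E_op \<mu> \<epsilon>" "0 < cmod (\<phi> T)"
    using states_norm_attained[OF op_space_E \<phi>, of 0] by auto
  have "\<phi> T = 0 * \<phi> T"
    by (rule functionals_proportional_if_on_generators[OF E_op_generated q q zero T(1)])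
  then show False using T(2) by simp
qed

text \<open>
  Let the mean \<open>m\<close> represent the state, let \<open>c = m |<g, h>|\<^sup>2 > 0\<close>, and let \<open>p\<close> be the weak average of
  \<open><h, g> h\<close>. Expanding \<open>m <k, T k>\<close> for \<open>k = h - <g, h> p / c\<close> gives
  \<open>\<phi> T - <p, T p> / c\<close>, a positive functional of norm at most \<open>m \<parallel>k\<parallel>\<^sup>2 \<le> 1 - \<parallel>p\<parallel>\<^sup>2 / c\<close>. So \<open>p\<close>
  contributes the weight \<open>\<parallel>p\<parallel>\<^sup>2 / c\<close> to \<open>\<phi>\<close>, and purity leaves no room for the remainder.
\<close>

lemma pure_state_is_vector_state:
  assumes pure: "\<phi> \<in> pure_states \<mu> (E_op \<mu> \<epsilon>)"
  shows "\<exists>p\<in>l2_space \<mu>. l2_norm \<mu> p = 1 \<and> (\<forall>T\<in>E_op \<mu> \<epsilon>. \<phi> T = l2_inner \<mu> p (T p))"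
proof -
  have \<phi>: "\<phi> \<in> states \<mu> (E_op \<mu> \<epsilon>)" using pure by (simp add: pure_states_def)
  have q: "quasi_state \<mu> (E_op \<mu> \<epsilon>) \<phi>" by (rule states_imp_quasi_state[OF op_space_E \<phi>])
  note lin = quasi_stateD(1)[OF q]
  obtain m where m: "mean_on unit_ball m"
    and rep: "\<And>T. T \<in> E_op \<mu> \<epsilon> \<Longrightarrow> \<phi> T = complex_mean m (\<lambda>h. l2_inner \<mu> h (T h))"
    using quasi_state_as_mean[OF q] by blast
  obtain g where g: "g \<in> l2_space \<mu>" and c0: "m (\<lambda>h. (cmod (l2_inner \<mu> g h))\<^sup>2) > 0"
    using exists_charged_vector[OF \<phi> m rep] by blast
  define z where "z h = l2_inner \<mu> g h" for h
  define c where "c = m (\<lambda>h. (cmod (z h))\<^sup>2)"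
  have c: "c > 0" using c0 by (simp add: c_def z_def)
  define l where "l f = complex_mean m (\<lambda>h. l2_inner \<mu> h f * z h)" for f
  have bd: "bounded_fun_on unit_ball (\<lambda>h. cmod (l2_inner \<mu> h f * z h))" if "f \<in> l2_space \<mu>" for f
    unfolding z_def by (rule unit_ball_coefficient_bounds(1)[OF g that])
  have bz: "bounded_fun_on unit_ball (\<lambda>h. (cmod (z h))\<^sup>2)"
    unfolding z_def by (rule unit_ball_coefficient_bounds(2)[OF g g])
  have "\<exists>p\<in>l2_space \<mu>. \<forall>f\<in>l2_space \<mu>. l f = l2_inner \<mu> p f"
  proof (rule l2_riesz_representation)
    fix f f' a b assume f: "f \<in> l2_space \<mu>" and f': "f' \<in> l2_space \<mu>"
    have "l (\<lambda>x. a * f x + b * f' x)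
        = complex_mean m (\<lambda>h. a * (l2_inner \<mu> h f * z h) + b * (l2_inner \<mu> h f' * z h))"
      unfolding l_def
    proof (rule complex_mean_cong[OF m bd[OF l2_lincomb[OF f f']]])
      fix h assume "h \<in> unit_ball"
      then show "l2_inner \<mu> h (\<lambda>x. a * f x + b * f' x) * z h
          = a * (l2_inner \<mu> h f * z h) + b * (l2_inner \<mu> h f' * z h)"
        unfolding l2_inner_lincomb_right[OF f f' unit_ballD(1)[OF \<open>h \<in> unit_ball\<close>]]
        by (simp add: algebra_simps)
    qed
    also have "\<dots> = a * l f + b * l f'" unfolding l_def by (rule complex_mean_lincomb[OF m bd[OF f] bd[OF f']])
    finally show "l (\<lambda>x. a * f x + b * f' x) = a * l f + b * l f'" .
  next
    fix f assume f: "f \<in> l2_space \<mu>"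
    have bc: "bounded_fun_on unit_ball (\<lambda>h. l2_norm \<mu> g * l2_norm \<mu> f)"
      by (rule bounded_fun_onI[of _ _ "l2_norm \<mu> g * l2_norm \<mu> f"]) simp
    have "cmod (l f) \<le> m (\<lambda>h. l2_norm \<mu> g * l2_norm \<mu> f)"
      unfolding l_def
    proof (rule cmod_complex_mean_le[OF m bd[OF f] bc])
      fix h assume h: "h \<in> unit_ball"
      show "cmod (l2_inner \<mu> h f * z h) \<le> l2_norm \<mu> g * l2_norm \<mu> f"
        using mult_mono[OF unit_ball_inner_le(1)[OF h f] unit_ball_inner_le(2)[OF h g]]
        by (simp add: norm_mult z_def mult.commute)
    qed
    also have "\<dots> \<le> l2_norm \<mu> g * l2_norm \<mu> f" by (rule mean_on_le[OF m bc]) simp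
    finally show "cmod (l f) \<le> l2_norm \<mu> g * l2_norm \<mu> f" .
  qed
  then obtain p where p: "p \<in> l2_space \<mu>" and lp: "\<And>f. f \<in> l2_space \<mu> \<Longrightarrow> l f = l2_inner \<mu> p f"
    by blast
  have "l g = complex_mean m (\<lambda>h. of_real ((cmod (z h))\<^sup>2))"
    unfolding l_def
  proof (rule complex_mean_cong[OF m bd[OF g]])
    fix h
    show "l2_inner \<mu> h g * z h = of_real ((cmod (z h))\<^sup>2)"
      unfolding z_def complex_norm_square by (subst l2_inner_commute) (simp add: mult.commute)
  qed
  then have lg: "l2_inner \<mu> p g = of_real c"
    using lp[OF g] complex_mean_of_real[OF m bz] by (simp add: c_def)
  define n where "n = l2_norm \<mu> p"
  have "n \<noteq> 0"
  proof
    assume "n = 0"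
    then have "cmod (l2_inner \<mu> p g) \<le> 0" using l2_cauchy_schwarz[OF p g] by (simp add: n_def)
    then show False using lg c by simp
  qed
  then have n: "n > 0" using l2_norm_nonneg[of \<mu> p] unfolding n_def by linarith
  define t where "t = n\<^sup>2 / c"
  have t0: "t > 0" using n c by (simp add: t_def)
  define k where "k h = (\<lambda>x. h x + (- z h / of_real c) * p x)" for h
  have k2: "k h \<in> l2_space \<mu>" if "h \<in> unit_ball" for h
    unfolding k_def using l2_lincomb[OF unit_ballD(1)[OF that] p, of 1 "- z h / of_real c"]
    by (simp only: mult_1)
  define \<theta> where "\<theta> T = \<phi> T - l2_inner \<mu> p (T p) / of_real c" for T
  have kn: "(l2_norm \<mu> (k h))\<^sup>2 = (l2_norm \<mu> h)\<^sup>2 - 2 / c * Re (l2_inner \<mu> h p * z h) + n\<^sup>2 / c\<^sup>2 * (cmod (z h))\<^sup>2"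
    if "h \<in> unit_ball" for h
  proof -
    have re: "Re (- z h / of_real c * l2_inner \<mu> h p) = - (1 / c) * Re (l2_inner \<mu> h p * z h)"
    proof -
      have "- z h / of_real c * l2_inner \<mu> h p = of_real (- (1 / c)) * (l2_inner \<mu> h p * z h)" by simp
      then show ?thesis by (simp only: Re_of_real_mult)
    qed
    have ab: "(cmod (- z h / of_real c))\<^sup>2 = (cmod (z h))\<^sup>2 / c\<^sup>2"
      using c by (simp add: norm_divide power_divide)
    have alg: "N + 2 * (- (1 / c) * X) + Z / c\<^sup>2 * Y = N - 2 / c * X + Y / c\<^sup>2 * Z" for N X Y Z :: real
      by simp
    show ?thesis
      unfolding k_def l2_norm_lincomb_squared[OF unit_ballD(1)[OF that] p] re ab n_def by (rule alg)
  qed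
  have bh: "bounded_fun_on unit_ball (\<lambda>h. (l2_norm \<mu> h)\<^sup>2)"
  proof (rule bounded_fun_onI)
    fix h assume "h \<in> unit_ball"
    then show "\<bar>(l2_norm \<mu> h)\<^sup>2\<bar> \<le> 1" using unit_ballD(2) by (simp add: power_le_one)
  qed
  have bRe: "bounded_fun_on unit_ball (\<lambda>h. Re (l2_inner \<mu> h p * z h))"
    by (rule bounded_fun_on_Re_Im(1)[OF bd[OF p]])
  \<comment> \<open>The expansion of \<open>\<parallel>k h\<parallel>\<^sup>2\<close>, arranged as nested linear combinations to which \<open>mean_on_lincomb\<close> applies.\<close>
  define v where "v h = 1 * (l2_norm \<mu> h)\<^sup>2
    + 1 * ((- 2 / c) * Re (l2_inner \<mu> h p * z h) + (n\<^sup>2 / c\<^sup>2) * (cmod (z h))\<^sup>2)" for h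
  have bv: "bounded_fun_on unit_ball v"
    unfolding v_def by (intro bounded_fun_on_lincomb bh bRe bz)
  have kv: "(l2_norm \<mu> (k h))\<^sup>2 = v h" if "h \<in> unit_ball" for h
    unfolding kn[OF that] v_def by simp
  have mv: "m v \<le> 1 - t"
  proof -
    have "m v = 1 * m (\<lambda>h. (l2_norm \<mu> h)\<^sup>2)
        + 1 * ((- 2 / c) * m (\<lambda>h. Re (l2_inner \<mu> h p * z h)) + (n\<^sup>2 / c\<^sup>2) * c)"
      unfolding v_def c_def
      by (simp only: mean_on_lincomb[OF m bh bounded_fun_on_lincomb[OF bRe bz]] mean_on_lincomb[OF m bRe bz])
    moreover have "m (\<lambda>h. Re (l2_inner \<mu> h p * z h)) = n\<^sup>2"
    proof -
      have "Re (l p) = n\<^sup>2" unfolding lp[OF p] l2_inner_self n_def by simp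
      then show ?thesis unfolding l_def complex_mean_def by simp
    qed
    moreover have "m (\<lambda>h. (l2_norm \<mu> h)\<^sup>2) \<le> 1"
      by (rule mean_on_le[OF m bh]) (use unit_ballD(2) in \<open>simp add: power_le_one\<close>)
    moreover have "(n\<^sup>2 / c\<^sup>2) * c = t" "(- 2 / c) * n\<^sup>2 = - 2 * t"
      using c by (simp_all add: t_def power2_eq_square)
    ultimately show ?thesis by simp
  qed
  have v_nonneg: "0 \<le> m v"
    by (rule mean_nonneg[OF m bv]) (simp add: kv[symmetric])
  have bk: "bounded_fun_on unit_ball (\<lambda>h. cmod (l2_inner \<mu> (k h) (T (k h))))"
    and \<theta>_mean: "\<theta> T = complex_mean m (\<lambda>h. l2_inner \<mu> (k h) (T (k h)))" if T: "T \<in> E_op \<mu> \<epsilon>" for T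
  proof -
    note Tb = E_op_bounded[OF T]
    have T2: "T f \<in> l2_space \<mu>" if "f \<in> l2_space \<mu>" for f by (rule bounded_opsD(1)[OF Tb that])
    obtain \<zeta> where \<zeta>: "\<zeta> \<in> l2_space \<mu>" "\<And>f. f \<in> l2_space \<mu> \<Longrightarrow> l2_inner \<mu> p (T f) = l2_inner \<mu> \<zeta> f"
      using bounded_op_adjoint[OF Tb p] by blast
    define w where "w = l2_inner \<mu> p (T p)"
    define u1 where "u1 h = l2_inner \<mu> h (T h)" for h
    define u2 where "u2 h = l2_inner \<mu> h (T p) * z h" for h
    define u3 where "u3 h = cnj (l2_inner \<mu> h \<zeta> * z h)" for h
    define u4 where "u4 h = complex_of_real ((cmod (z h))\<^sup>2)" for h
    define u where "u h = 1 * (1 * u1 h + (- 1 / of_real c) * u2 h)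
      + 1 * ((- 1 / of_real c) * u3 h + (w / (of_real c)\<^sup>2) * u4 h)" for h
    have b1: "bounded_fun_on unit_ball (\<lambda>h. cmod (u1 h))"
      unfolding u1_def by (rule bounded_fun_onI[of _ _ "op_norm \<mu> T"]) (simp add: unit_ball_quadratic_le[OF _ Tb])
    have b2: "bounded_fun_on unit_ball (\<lambda>h. cmod (u2 h))" unfolding u2_def by (rule bd[OF T2[OF p]])
    have b3: "bounded_fun_on unit_ball (\<lambda>h. cmod (u3 h))"
      unfolding u3_def complex_mod_cnj by (rule bd[OF \<zeta>(1)])
    have b4: "bounded_fun_on unit_ball (\<lambda>h. cmod (u4 h))"
      unfolding u4_def norm_of_real abs_power2 by (rule bz)
    have bu: "bounded_fun_on unit_ball (\<lambda>h. cmod (u h))"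
      unfolding u_def by (rule bounded_fun_on_cmod_lincomb[OF
        bounded_fun_on_cmod_lincomb[OF b1 b2] bounded_fun_on_cmod_lincomb[OF b3 b4]])
    have eq: "u h = l2_inner \<mu> (k h) (T (k h))" if h: "h \<in> unit_ball" for h
    proof -
      note h2 = unit_ballD(1)[OF h]
      let ?a = "- z h / of_real c"
      have kh: "k h = (\<lambda>x. 1 * h x + ?a * p x)" by (simp add: k_def)
      have "l2_inner \<mu> (k h) (T (k h)) = 1 * l2_inner \<mu> (k h) (T h) + ?a * l2_inner \<mu> (k h) (T p)"
        using l2_inner_op_lincomb[OF Tb h2 p k2[OF h], of 1 ?a] unfolding kh .
      also have "l2_inner \<mu> (k h) (T h) = cnj 1 * l2_inner \<mu> h (T h) + cnj ?a * l2_inner \<mu> p (T h)"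
        unfolding kh by (rule l2_inner_lincomb_left[OF h2 p T2[OF h2]])
      also have "l2_inner \<mu> (k h) (T p) = cnj 1 * l2_inner \<mu> h (T p) + cnj ?a * l2_inner \<mu> p (T p)"
        unfolding kh by (rule l2_inner_lincomb_left[OF h2 p T2[OF p]])
      also have "l2_inner \<mu> p (T h) = cnj (l2_inner \<mu> h \<zeta>)"
        unfolding \<zeta>(2)[OF h2] by (rule l2_inner_commute)
      finally have lhs: "l2_inner \<mu> (k h) (T (k h))
          = 1 * (cnj 1 * l2_inner \<mu> h (T h) + cnj ?a * cnj (l2_inner \<mu> h \<zeta>))
          + ?a * (cnj 1 * l2_inner \<mu> h (T p) + cnj ?a * l2_inner \<mu> p (T p))" .
      have ca: "cnj ?a = - cnj (z h) / of_real c" by simp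
      have alg: "1 * (1 * A + (- y' / d) * B) + (- y / d) * (1 * D + (- y' / d) * W)
          = 1 * (1 * A + (- 1 / d) * (D * y)) + 1 * ((- 1 / d) * (B * y') + (W / d\<^sup>2) * (y * y'))"
        for A B D W y y' d :: complex
        by (simp add: power2_eq_square divide_inverse algebra_simps)
      show ?thesis
        unfolding lhs ca u_def u1_def u2_def u3_def u4_def w_def complex_norm_square
          complex_cnj_mult complex_cnj_one
        by (rule alg[symmetric])
    qed
    have "cmod (u h) = cmod (l2_inner \<mu> (k h) (T (k h)))" if "h \<in> unit_ball" for h
      using eq[OF that] by simp
    then show "bounded_fun_on unit_ball (\<lambda>h. cmod (l2_inner \<mu> (k h) (T (k h))))"
      using bu unfolding bounded_fun_on_def by simp
    have M2: "complex_mean m u2 = w" unfolding u2_def w_def using lp[OF T2[OF p]] by (simp add: l_def)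
    have "complex_mean m u3 = cnj (l \<zeta>)" unfolding u3_def l_def by (rule complex_mean_cnj[OF m bd[OF \<zeta>(1)]])
    also have "\<dots> = l2_inner \<mu> \<zeta> p" unfolding lp[OF \<zeta>(1)] by (rule l2_inner_commute[symmetric])
    also have "\<dots> = w" unfolding w_def \<zeta>(2)[OF p] ..
    finally have M3: "complex_mean m u3 = w" .
    have M4: "complex_mean m u4 = of_real c"
      unfolding u4_def c_def by (rule complex_mean_of_real[OF m bz])
    have M1: "complex_mean m u1 = \<phi> T" unfolding u1_def by (rule rep[OF T, symmetric])
    have "complex_mean m u = 1 * (1 * complex_mean m u1 + (- 1 / of_real c) * complex_mean m u2)
      + 1 * ((- 1 / of_real c) * complex_mean m u3 + (w / (of_real c)\<^sup>2) * complex_mean m u4)"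
      unfolding u_def
      by (simp only: complex_mean_lincomb[OF m bounded_fun_on_cmod_lincomb[OF b1 b2] bounded_fun_on_cmod_lincomb[OF b3 b4]]
          complex_mean_lincomb[OF m b1 b2] complex_mean_lincomb[OF m b3 b4])
    also have "\<dots> = \<theta> T"
      unfolding M1 M2 M3 M4 \<theta>_def w_def using c by (simp add: power2_eq_square)
    finally show "\<theta> T = complex_mean m (\<lambda>h. l2_inner \<mu> (k h) (T (k h)))"
      using complex_mean_cong[OF m bu eq] by simp
  qed
  have \<theta>_bound: "cmod (\<theta> T) \<le> op_norm \<mu> T * (1 - t)" if T: "T \<in> E_op \<mu> \<epsilon>" for T
  proof -
    note Tb = E_op_bounded[OF T]
    have "cmod (\<theta> T) \<le> m (\<lambda>h. op_norm \<mu> T * v h + 0 * v h)"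
      unfolding \<theta>_mean[OF T]
    proof (rule cmod_complex_mean_le[OF m bk[OF T] bounded_fun_on_lincomb[OF bv bv]])
      fix h assume h: "h \<in> unit_ball"
      show "cmod (l2_inner \<mu> (k h) (T (k h))) \<le> op_norm \<mu> T * v h + 0 * v h"
        using l2_inner_op_bound[OF Tb k2[OF h] k2[OF h]] by (simp add: kv[OF h, symmetric] power2_eq_square)
    qed
    also have "\<dots> = op_norm \<mu> T * m v" using mean_on_lincomb[OF m bv bv, of "op_norm \<mu> T" 0] by simp
    also have "\<dots> \<le> op_norm \<mu> T * (1 - t)" by (rule mult_left_mono[OF mv op_norm_nonneg[OF Tb]])
    finally show ?thesis .
  qed
  have \<theta>_pos: "\<theta> T \<in> \<real>\<^sub>\<ge>\<^sub>0" if T: "T \<in> E_op \<mu> \<epsilon>" and pos: "positive_op \<mu> T" for T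
  proof -
    define r where "r h = Re (l2_inner \<mu> (k h) (T (k h)))" for h
    have kr: "l2_inner \<mu> (k h) (T (k h)) = of_real (r h)" "0 \<le> r h" if "h \<in> unit_ball" for h
      using pos k2[OF that] unfolding positive_op_def r_def
      by (auto simp: complex_nonneg_Reals_iff complex_eq_iff)
    have br: "bounded_fun_on unit_ball r"
      unfolding r_def by (rule bounded_fun_on_Re_Im(1)[OF bk[OF T]])
    have "\<theta> T = complex_mean m (\<lambda>h. of_real (r h))"
      unfolding \<theta>_mean[OF T] by (rule complex_mean_cong[OF m bk[OF T] kr(1)])
    also have "\<dots> = of_real (m r)" by (rule complex_mean_of_real[OF m br])
    finally show ?thesis using mean_nonneg[OF m br kr(2)] by simp
  qed
  define P where "P = (\<lambda>x. of_real (1 / n) * p x)"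
  have P2: "P \<in> l2_space \<mu>" unfolding P_def by (rule l2_scale[OF p])
  have Pn: "l2_norm \<mu> P = 1"
    unfolding P_def l2_norm_scale norm_of_real using n by (simp add: n_def)
  have PT: "l2_inner \<mu> p (T p) = of_real (n\<^sup>2) * l2_inner \<mu> P (T P)" if T: "T \<in> E_op \<mu> \<epsilon>" for T
  proof -
    have "l2_inner \<mu> P (T P) = of_real (1 / n) * l2_inner \<mu> P (T p)"
      using l2_inner_op_lincomb[OF E_op_bounded[OF T] p p P2, of "of_real (1 / n)" 0] unfolding P_def by simp
    also have "l2_inner \<mu> P (T p) = of_real (1 / n) * l2_inner \<mu> p (T p)"
      unfolding P_def l2_inner_scale_left by simp
    finally show ?thesis using n by (simp add: power2_eq_square)
  qed
  have split: "\<phi> T = of_real t * l2_inner \<mu> P (T P) + \<theta> T" if T: "T \<in> E_op \<mu> \<epsilon>" for T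
    unfolding \<theta>_def PT[OF T] t_def by simp
  have "\<phi> T = l2_inner \<mu> P (T P)" if T: "T \<in> E_op \<mu> \<epsilon>" for T
  proof (cases "t < 1")
    case False
    then have "t = 1" using mv v_nonneg by linarith
    then have "\<theta> T = 0" using \<theta>_bound[OF T] by simp
    then show ?thesis using split[OF T] \<open>t = 1\<close> by simp
  next
    case True
    have qP: "quasi_state \<mu> (E_op \<mu> \<epsilon>) (\<lambda>T. l2_inner \<mu> P (T P))"
      by (rule vector_functional_quasi_state[OF op_space_E P2]) (simp add: Pn)
    have q\<theta>: "quasi_state \<mu> (E_op \<mu> \<epsilon>) (\<lambda>T. of_real (1 / (1 - t)) * \<theta> T)"
      unfolding quasi_state_def linear_functional_on_def
    proof (intro conjI ballI allI impI)
      fix T U a b assume T: "T \<in> E_op \<mu> \<epsilon>" and U: "U \<in> E_op \<mu> \<epsilon>"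
      have "l2_inner \<mu> p (\<lambda>x. a * T p x + b * U p x) = a * l2_inner \<mu> p (T p) + b * l2_inner \<mu> p (U p)"
        by (intro l2_inner_lincomb_right bounded_opsD(1)[OF E_op_bounded[OF T] p]
            bounded_opsD(1)[OF E_op_bounded[OF U] p] p)
      then have "\<theta> (\<lambda>\<xi> x. a * T \<xi> x + b * U \<xi> x) = a * \<theta> T + b * \<theta> U"
        unfolding \<theta>_def functional_lincomb[OF lin T U] by (simp add: algebra_simps add_divide_distrib)
      then show "of_real (1 / (1 - t)) * \<theta> (\<lambda>\<xi> x. a * T \<xi> x + b * U \<xi> x)
          = a * (of_real (1 / (1 - t)) * \<theta> T) + b * (of_real (1 / (1 - t)) * \<theta> U)"
        by (simp only: distrib_left mult.left_commute)
    next
      fix T assume "T \<in> E_op \<mu> \<epsilon>" "positive_op \<mu> T"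
      then have "\<theta> T \<in> \<real>\<^sub>\<ge>\<^sub>0" by (rule \<theta>_pos)
      moreover have "complex_of_real (1 / (1 - t)) \<in> \<real>\<^sub>\<ge>\<^sub>0"
        using True by (simp only: nonneg_Reals_of_real_iff) simp
      ultimately show "of_real (1 / (1 - t)) * \<theta> T \<in> \<real>\<^sub>\<ge>\<^sub>0"
        by (intro nonneg_Reals_mult_I)
    next
      fix T assume T: "T \<in> E_op \<mu> \<epsilon>"
      have "cmod (of_real (1 / (1 - t)) * \<theta> T) = cmod (\<theta> T) / (1 - t)"
        unfolding norm_mult norm_of_real using True by simp
      also have "\<dots> \<le> op_norm \<mu> T" using \<theta>_bound[OF T] True by (simp add: divide_le_eq)
      finally show "cmod (of_real (1 / (1 - t)) * \<theta> T) \<le> op_norm \<mu> T" .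
    qed
    have comb: "\<phi> T = of_real t * l2_inner \<mu> P (T P) + of_real (1 - t) * (of_real (1 / (1 - t)) * \<theta> T)"
      if "T \<in> E_op \<mu> \<epsilon>" for T
    proof -
      have "complex_of_real (1 - t) * of_real (1 / (1 - t)) = 1"
        unfolding of_real_mult[symmetric] using True by simp
      then show ?thesis unfolding split[OF that] mult.assoc[symmetric] by simp
    qed
    show ?thesis
      by (rule pure_state_convex_component(1)[OF op_space_E pure qP q\<theta> t0 True comb T, symmetric])
  qed
  then show ?thesis using P2 Pn by blast
qed

end

section \<open>Compact operators are limits of finite-rank operators\<close>

definition all_pairs :: "'a measure \<Rightarrow> (('a \<Rightarrow> complex) \<times> ('a \<Rightarrow> complex)) set" where
  "all_pairs M = l2_space M \<times> l2_space M"

text \<open>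
  The residual of \<open>f\<close> is the residual of \<open>f - g\<close>, for that of \<open>g\<close> is null; and taking residuals is
  contractive.
\<close>

lemma l2_proj_of_member:
  assumes o: "l2_orthonormal M e I" and I: "finite I" and f: "f \<in> l2_space M"
    and g: "g \<in> l2_space M" and j: "l2_norm M (\<lambda>x. g x - l2_proj M e I g x) = 0"
  shows "l2_norm M (\<lambda>x. f x - l2_proj M e I f x) \<le> l2_norm M (\<lambda>x. f x - g x)"
proof -
  have e: "e i \<in> l2_space M" if "i \<in> I" for i using o that by (simp add: l2_orthonormal_def)
  have p: "l2_proj M e I h \<in> l2_space M" for h by (rule l2_proj_l2[OF e])
  have lin: "l2_proj M e I (\<lambda>x. f x - g x) x = l2_proj M e I f x - l2_proj M e I g x" for x
    unfolding l2_proj_def rank1_def sum_subtractf[symmetric]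
    by (rule sum.cong[OF refl]) (simp add: l2_inner_diff_right[OF f g e] algebra_simps)
  have "l2_norm M (\<lambda>x. f x - l2_proj M e I f x)
      = l2_norm M (\<lambda>x. ((f x - g x) - l2_proj M e I (\<lambda>x. f x - g x) x) + (g x - l2_proj M e I g x))"
    unfolding lin by simp
  also have "\<dots> \<le> l2_norm M (\<lambda>x. (f x - g x) - l2_proj M e I (\<lambda>x. f x - g x) x)
      + l2_norm M (\<lambda>x. g x - l2_proj M e I g x)"
    by (intro l2_norm_triangle l2_diff f g p)
  also have "\<dots> \<le> l2_norm M (\<lambda>x. f x - g x) + 0"
    by (intro add_mono l2_proj_norm_le(2)[OF o I] l2_diff f g) (simp add: j)
  finally show ?thesis by simp
qed

text \<open>
  Otherwise one can select recursively vectors \<open>f\<^sub>n\<close> of the unit ball such that \<open>T f\<^sub>n\<close> has distance more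
  than \<open>\<delta>\<close> from the span of the earlier \<open>T f\<^sub>m\<close>, extending at the same time an orthonormal basis of these
  spans. Then no subsequence of \<open>T f\<^sub>n\<close> is Cauchy.
\<close>

lemma compact_op_near_finite_projection:
  assumes T: "T \<in> compact_ops M" and \<delta>: "\<delta> > 0"
  shows "\<exists>(I :: nat set) e. finite I \<and> l2_orthonormal M e I \<and>
    (\<forall>f\<in>l2_space M. l2_norm M f \<le> 1 \<longrightarrow> l2_norm M (\<lambda>x. T f x - l2_proj M e I (T f) x) \<le> \<delta>)"
proof (rule ccontr)
  assume neg: "\<not> ?thesis"
  note Tb = compact_ops_bounded[OF T]
  define R where "R e n f = (\<lambda>x. T f x - l2_proj M e {..<n} (T f) x)" for e :: "nat \<Rightarrow> 'a \<Rightarrow> complex" and n :: nat and f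
  have step: "\<exists>f u. f \<in> l2_space M \<and> l2_norm M f \<le> 1 \<and> \<delta> < l2_norm M (R e n f) \<and>
      l2_orthonormal M (e(n := u)) {..<Suc n} \<and> l2_norm M (R (e(n := u)) (Suc n) f) = 0"
    if o: "l2_orthonormal M e {..<n}" for e n
  proof -
    obtain f where f: "f \<in> l2_space M" "l2_norm M f \<le> 1" "\<delta> < l2_norm M (R e n f)"
    proof -
      have "\<not> (\<forall>f\<in>l2_space M. l2_norm M f \<le> 1 \<longrightarrow> l2_norm M (R e n f) \<le> \<delta>)"
        using neg o finite_lessThan[of n] unfolding R_def by blast
      then show thesis using that by (auto simp: not_le)
    qed
    have e: "e i \<in> l2_space M" if "i < n" for i using o that by (simp add: l2_orthonormal_def)
    have Tf: "T f \<in> l2_space M" by (rule bounded_opsD(1)[OF Tb f(1)])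
    have pr: "l2_proj M e {..<n} (T f) \<in> l2_space M" by (rule l2_proj_l2) (simp add: e)
    define w where "w = R e n f"
    define s where "s = l2_norm M w"
    have s: "s > 0" using f(3) \<delta> by (simp add: s_def w_def)
    have w: "w \<in> l2_space M" unfolding w_def R_def by (rule l2_diff[OF Tf pr])
    define u where "u = (\<lambda>x. of_real (1 / s) * w x)"
    have u: "u \<in> l2_space M" unfolding u_def by (rule l2_scale[OF w])
    have ew: "l2_inner M (e i) w = 0" if "i < n" for i
    proof -
      have "l2_inner M (e i) w = l2_inner M (e i) (T f) - l2_inner M (e i) (l2_proj M e {..<n} (T f))"
        unfolding w_def R_def by (rule l2_inner_diff_right[OF Tf pr e[OF that]])
      then show ?thesis using l2_proj_coefficient[OF o _, of i "T f"] that by simp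
    qed
    have eu: "l2_inner M (e i) u = 0" "l2_inner M u (e i) = 0" if "i < n" for i
    proof -
      show "l2_inner M (e i) u = 0" unfolding u_def l2_inner_scale_right using ew[OF that] by simp
      then show "l2_inner M u (e i) = 0" by (subst l2_inner_commute) simp
    qed
    have "l2_norm M u = 1" unfolding u_def l2_norm_scale norm_of_real using s by (simp add: s_def)
    then have uu: "l2_inner M u u = 1" by (simp add: l2_inner_self)
    have o': "l2_orthonormal M (e(n := u)) {..<Suc n}"
      using o eu uu u unfolding l2_orthonormal_def by (auto simp: less_Suc_eq)
    have uw: "l2_inner M u (T f) = of_real s"
    proof -
      have "l2_inner M u (l2_proj M e {..<n} (T f))
          = (\<Sum>i<n. l2_inner M u (e i) * l2_inner M (e i) (T f))"
        by (rule l2_inner_proj[OF _ u]) (simp add: e)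
      then have "l2_inner M u (l2_proj M e {..<n} (T f)) = 0" using eu(2) by simp
      then have "l2_inner M u (T f) = l2_inner M u w"
        unfolding w_def R_def l2_inner_diff_right[OF Tf pr u] by simp
      also have "\<dots> = of_real s"
        unfolding u_def l2_inner_scale_left l2_inner_self s_def[symmetric] using s by (simp add: power2_eq_square)
      finally show ?thesis .
    qed
    have "R (e(n := u)) (Suc n) f = (\<lambda>x. 0)"
    proof
      fix x
      have "l2_proj M (e(n := u)) {..<Suc n} (T f) x = rank1 M u u (T f) x + l2_proj M e {..<n} (T f) x"
        unfolding l2_proj_def by (simp add: add.commute)
      also have "rank1 M u u (T f) x = w x" unfolding rank1_def uw using s by (simp add: u_def)
      also have "w x + l2_proj M e {..<n} (T f) x = T f x" by (simp add: w_def R_def)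
      finally show "R (e(n := u)) (Suc n) f x = 0" by (simp only: R_def right_minus_eq)
    qed
    then have "l2_norm M (R (e(n := u)) (Suc n) f) = 0" by simp
    then show ?thesis using f o' by blast
  qed
  define Z where "Z n s s' \<longleftrightarrow> fst s' \<in> l2_space M \<and> l2_norm M (fst s') \<le> 1 \<and>
      \<delta> < l2_norm M (R (snd s) n (fst s')) \<and> (\<forall>i<n. snd s' i = snd s i) \<and>
      l2_norm M (R (snd s') (Suc n) (fst s')) = 0" for n and s s' :: "('a \<Rightarrow> complex) \<times> (nat \<Rightarrow> 'a \<Rightarrow> complex)"
  \<comment> \<open>\<open>S n\<close> holds the vector chosen last and the orthonormal family reached so far.\<close>
  have "\<exists>S. \<forall>n. l2_orthonormal M (snd (S n)) {..<n} \<and> Z n (S n) (S (Suc n))"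
  proof (rule dependent_nat_choice)
    show "\<exists>s :: ('a \<Rightarrow> complex) \<times> (nat \<Rightarrow> 'a \<Rightarrow> complex). l2_orthonormal M (snd s) {..<0}"
      by (simp add: l2_orthonormal_def)
    fix s :: "('a \<Rightarrow> complex) \<times> (nat \<Rightarrow> 'a \<Rightarrow> complex)" and n
    assume "l2_orthonormal M (snd s) {..<n}"
    from step[OF this] obtain f u where "f \<in> l2_space M" "l2_norm M f \<le> 1" "\<delta> < l2_norm M (R (snd s) n f)"
      "l2_orthonormal M ((snd s)(n := u)) {..<Suc n}" "l2_norm M (R ((snd s)(n := u)) (Suc n) f) = 0" by blast
    then show "\<exists>s'. l2_orthonormal M (snd s') {..<Suc n} \<and> Z n s s'"
      by (intro exI[of _ "(f, (snd s)(n := u))"]) (simp add: Z_def)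
  qed
  then obtain S where o: "\<And>n. l2_orthonormal M (snd (S n)) {..<n}" and Z: "\<And>n. Z n (S n) (S (Suc n))"
    by blast
  define f where "f n = fst (S (Suc n))" for n
  have f: "f n \<in> l2_space M" "l2_norm M (f n) \<le> 1" for n
    using Z[of n] by (simp_all add: Z_def f_def)
  have Tf: "T (f n) \<in> l2_space M" for n by (rule bounded_opsD(1)[OF Tb f(1)])
  have agree: "snd (S (n + k)) i = snd (S n) i" if "i < n" for i n k
  proof (induction k)
    case (Suc k)
    have "snd (S (Suc (n + k))) i = snd (S (n + k)) i" using Z[of "n + k"] that by (simp add: Z_def)
    then show ?case using Suc by simp
  qed simp
  have far: "\<delta> < l2_norm M (\<lambda>x. T (f n) x - T (f m) x)" if "m < n" for m n
  proof -
    have "\<delta> < l2_norm M (R (snd (S n)) n (f n))" using Z[of n] by (simp add: Z_def f_def)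
    also have "\<dots> \<le> l2_norm M (\<lambda>x. T (f n) x - T (f m) x)"
      unfolding R_def
    proof (rule l2_proj_of_member[OF o finite_lessThan Tf Tf])
      have on: "l2_orthonormal M (snd (S n)) {..<n}" by (rule o)
      have Sm: "snd (S n) i = snd (S (Suc m)) i" if "i < Suc m" for i
        using agree[OF that, of "n - Suc m"] \<open>m < n\<close> by simp
      have z0: "l2_norm M (R (snd (S (Suc m))) (Suc m) (f m)) = 0"
        using Z[of m] by (simp add: Z_def f_def)
      have e: "snd (S n) i \<in> l2_space M" if "i < n" for i using on that by (simp add: l2_orthonormal_def)
      have psub: "l2_proj M (snd (S (Suc m))) {..<Suc m} (T (f m)) = l2_proj M (snd (S n)) {..<Suc m} (T (f m))"
        unfolding l2_proj_def by (intro ext sum.cong[OF refl]) (simp add: Sm)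
      let ?e = "snd (S n)" and ?g = "T (f m)"
      let ?p = "l2_proj M ?e {..<Suc m} ?g"
      have p2: "?p \<in> l2_space M" using \<open>m < n\<close> by (intro l2_proj_l2 e) simp
      have q2: "l2_proj M ?e {..<n} ?g \<in> l2_space M" by (intro l2_proj_l2 e) simp
      have gp: "l2_norm M (\<lambda>x. ?g x - ?p x) = 0" using z0 unfolding R_def psub .
      have same: "l2_inner M (?e i) ?g = l2_inner M (?e i) ?p" if "i < n" for i
      proof -
        have "cmod (l2_inner M (?e i) (\<lambda>x. ?g x - ?p x)) \<le> 0"
          using l2_cauchy_schwarz[OF e[OF that] l2_diff[OF Tf[of m] p2]] gp by simp
        then show ?thesis unfolding l2_inner_diff_right[OF Tf p2 e[OF that]] by simp
      qed
      have "l2_inner M (?e i) ?p = 0" if "Suc m \<le> i" "i < n" for i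
      proof -
        have "l2_inner M (?e i) ?p = (\<Sum>j\<in>{..<Suc m}. l2_inner M (?e i) (?e j) * l2_inner M (?e j) ?g)"
          by (rule l2_inner_proj) (use e that in auto)
        also have "\<dots> = 0"
          by (rule sum.neutral) (use on that in \<open>auto simp: l2_orthonormal_def\<close>)
        finally show ?thesis .
      qed
      then have zero: "l2_inner M (?e i) ?g = 0" if "i \<in> {..<n} - {..<Suc m}" for i
        using same[of i] that by simp
      have "l2_proj M ?e {..<n} ?g = ?p"
        unfolding l2_proj_def
        by (intro ext sum.mono_neutral_right) (use \<open>m < n\<close> zero in \<open>auto simp: rank1_def\<close>)
      then show "l2_norm M (\<lambda>x. ?g x - l2_proj M ?e {..<n} ?g x) = 0" using gp by simp
    qed
    finally show ?thesis .
  qed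
  obtain g r where g: "g \<in> l2_space M" and r: "strict_mono r"
    and lim: "(\<lambda>n. l2_norm M (\<lambda>x. T (f (r n)) x - g x)) \<longlonglongrightarrow> 0"
    by (rule compact_opsD[OF T f])
  have "\<delta> / 2 > 0" using \<delta> by simp
  from order_tendstoD(2)[OF lim this] obtain N where N: "\<And>n. n \<ge> N \<Longrightarrow> l2_norm M (\<lambda>x. T (f (r n)) x - g x) < \<delta> / 2"
    unfolding eventually_sequentially by blast
  have "l2_norm M (\<lambda>x. T (f (r (Suc N))) x - T (f (r N)) x)
      \<le> l2_norm M (\<lambda>x. T (f (r (Suc N))) x - g x) + l2_norm M (\<lambda>x. g x - T (f (r N)) x)"
    by (rule l2_norm_triangle_via[OF Tf g Tf])
  also have "\<dots> < \<delta>" using N[of "Suc N"] N[of N] l2_norm_minus_commute[of M g "T (f (r N))"] by simp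
  finally show False using far[of "r N" "r (Suc N)"] r by (simp add: strict_mono_def)
qed

text \<open>
  If the projection onto the span of an orthonormal family \<open>e\<close> nearly fixes the image of the unit ball,
  then its composition with \<open>T\<close>, which is \<open>\<Sum>i. |e\<^sub>i><T\<^sup>* e\<^sub>i|\<close>, is close to \<open>T\<close>.
\<close>

lemma compact_ops_generated:
  shows "rank1_generated M (compact_ops M) (all_pairs M)"
  unfolding rank1_generated_def
proof (intro conjI ballI allI impI)
  have "rank1 M (\<lambda>x. 0) (\<lambda>x. 0) \<in> compact_ops M" by (rule rank1_compact[OF l2_zero l2_zero])
  then have "compact_ops M \<noteq> {}" by blast
  moreover have "compact_ops M \<subseteq> bounded_ops M" using compact_ops_bounded by blast
  ultimately show S: "op_space M (compact_ops M)"
    unfolding op_space_def using compact_ops_lincomb by (intro conjI ballI allI)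
  fix p assume "p \<in> all_pairs M"
  then show "case p of (f, g) \<Rightarrow> rank1 M f g \<in> compact_ops M"
    by (cases p) (simp add: all_pairs_def rank1_compact)
next
  fix T and \<delta> :: real assume T: "T \<in> compact_ops M" and \<delta>: "\<delta> > 0"
  note Tb = compact_ops_bounded[OF T]
  have "\<delta> / 2 > 0" using \<delta> by simp
  from compact_op_near_finite_projection[OF T this] obtain I :: "nat set" and e where
    I: "finite I" and o: "l2_orthonormal M e I" and
    near: "\<And>f. f \<in> l2_space M \<Longrightarrow> l2_norm M f \<le> 1 \<Longrightarrow>
      l2_norm M (\<lambda>x. T f x - l2_proj M e I (T f) x) \<le> \<delta> / 2"
    by blast
  have e: "e i \<in> l2_space M" if "i \<in> I" for i using o that by (simp add: l2_orthonormal_def)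
  have "\<forall>i\<in>I. \<exists>q. q \<in> l2_space M \<and> (\<forall>f\<in>l2_space M. l2_inner M (e i) (T f) = l2_inner M q f)"
    using bounded_op_adjoint[OF Tb e] by blast
  from bchoice[OF this] obtain q where q: "\<And>i. i \<in> I \<Longrightarrow> q i \<in> l2_space M"
    and eT: "\<And>i f. i \<in> I \<Longrightarrow> f \<in> l2_space M \<Longrightarrow> l2_inner M (e i) (T f) = l2_inner M (q i) f" by blast
  define R where "R = (\<lambda>\<xi> x. \<Sum>i\<in>I. rank1 M (e i) (q i) \<xi> x)"
  have "R \<in> rank_span M (all_pairs M)"
    unfolding R_def by (rule rank_span_sum[OF I]) (simp add: all_pairs_def e q)
  moreover have "op_norm M (\<lambda>\<xi> x. T \<xi> x - R \<xi> x) \<le> \<delta> / 2"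
    unfolding op_norm_def
  proof (rule cSUP_least)
    show "{f \<in> l2_space M. l2_norm M f \<le> 1} \<noteq> {}" using l2_zero[of M] by force
    fix f assume "f \<in> {f \<in> l2_space M. l2_norm M f \<le> 1}"
    then have f: "f \<in> l2_space M" "l2_norm M f \<le> 1" by auto
    have "R f = l2_proj M e I (T f)"
      unfolding R_def l2_proj_def rank1_def by (intro ext sum.cong[OF refl]) (simp only: eT[OF _ f(1)])
    then show "l2_norm M (\<lambda>x. T f x - R f x) \<le> \<delta> / 2" using near[OF f] by simp
  qed
  ultimately show "\<exists>R\<in>rank_span M (all_pairs M). op_norm M (\<lambda>\<xi> x. T \<xi> x - R \<xi> x) < \<delta>"
    using \<delta> by (intro bexI[of _ R]) linarith
qed

section \<open>Functionals dominated by a vector functional\<close>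

text \<open>
  By the Cauchy-Schwarz inequality for \<open>s\<close>, a vector with \<open>s f f = 0\<close> is in the kernel of the form. So
  \<open>s\<close> factors through \<open>V\<close> modulo the kernel of \<open>l\<close>, which has dimension at most one.
\<close>

lemma form_dominated_by_rank_one:
  fixes s :: "('a \<Rightarrow> complex) \<Rightarrow> ('a \<Rightarrow> complex) \<Rightarrow> complex" and l :: "('a \<Rightarrow> complex) \<Rightarrow> complex"
  assumes V: "\<And>f g a b. f \<in> V \<Longrightarrow> g \<in> V \<Longrightarrow> (\<lambda>x. a * f x + b * g x) \<in> V"
    and s1: "\<And>f g h a b. f \<in> V \<Longrightarrow> g \<in> V \<Longrightarrow> h \<in> V \<Longrightarrow>
      s (\<lambda>x. a * f x + b * g x) h = a * s f h + b * s g h"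
    and s2: "\<And>f g h a b. f \<in> V \<Longrightarrow> g \<in> V \<Longrightarrow> h \<in> V \<Longrightarrow>
      s h (\<lambda>x. a * f x + b * g x) = cnj a * s h f + cnj b * s h g"
    and l: "\<And>f g a b. f \<in> V \<Longrightarrow> g \<in> V \<Longrightarrow> l (\<lambda>x. a * f x + b * g x) = a * l f + b * l g"
    and pos: "\<And>f. f \<in> V \<Longrightarrow> s f f \<in> \<real>\<^sub>\<ge>\<^sub>0"
    and dom: "\<And>f. f \<in> V \<Longrightarrow> l f = 0 \<Longrightarrow> s f f = 0"
  shows "\<exists>c. \<forall>f\<in>V. \<forall>g\<in>V. s f g = c * (l f * cnj (l g))"
proof -
  have quad: "s (\<lambda>x. 1 * f x + t * g x) (\<lambda>x. 1 * f x + t * g x)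
      = s f f + cnj t * s f g + t * s g f + t * cnj t * s g g" if f: "f \<in> V" and g: "g \<in> V" for f g t
    unfolding s1[OF f g V[OF f g]] s2[OF f g f] s2[OF f g g] by (simp add: algebra_simps)
  have null: "s f g = 0" "s g f = 0" if f: "f \<in> V" and g: "g \<in> V" and ff: "s f f = 0" for f g
  proof -
    have ge: "s f f + cnj t * s f g + t * s g f + t * cnj t * s g g \<in> \<real>\<^sub>\<ge>\<^sub>0" for t
      using pos[OF V[OF f g, of 1 t]] unfolding quad[OF f g] .
    have gg: "Im (s g g) = 0" "Re (s g g) \<ge> 0" using pos[OF g] by (simp_all add: complex_nonneg_Reals_iff)
    have "Im (s f g + s g f) = 0" using ge[of 1] gg ff by (simp add: complex_nonneg_Reals_iff)
    moreover have "Im (- \<i> * s f g + \<i> * s g f) = 0"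
      using ge[of \<i>] gg ff by (simp add: complex_nonneg_Reals_iff)
    ultimately have fg: "s f g = cnj (s g f)" by (simp add: complex_eq_iff)
    have "0 \<le> 2 * Re (t * s g f) + (cmod t)\<^sup>2 * Re (s g g)" for t
    proof -
      have "0 \<le> Re (s f f + cnj t * s f g + t * s g f + t * cnj t * s g g)"
        using ge[of t] by (simp add: complex_nonneg_Reals_iff)
      also have "cnj t * s f g + t * s g f = of_real (2 * Re (t * s g f))"
        unfolding fg complex_cnj_mult[symmetric] by (subst add.commute) (rule complex_add_cnj)
      then have "s f f + cnj t * s f g + t * s g f + t * cnj t * s g g
          = of_real (2 * Re (t * s g f)) + of_real ((cmod t)\<^sup>2) * s g g"
        unfolding ff complex_norm_square by (simp only: add_0_left)
      finally show ?thesis by (simp only: plus_complex.sel Re_complex_of_real Re_of_real_mult)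
    qed
    then show "s g f = 0" by (rule zero_of_quadratic_bound) (rule gg(2))
    then show "s f g = 0" using fg by simp
  qed
  show ?thesis
  proof (cases "\<exists>f0\<in>V. l f0 \<noteq> 0")
    case False
    then have "s f g = 0" if "f \<in> V" "g \<in> V" for f g
      using null(1)[OF that] dom[OF that(1)] that(1) by blast
    then show ?thesis by (intro exI[of _ 0]) simp
  next
    case True
    then obtain f0 where f0: "f0 \<in> V" "l f0 \<noteq> 0" by blast
    define r where "r f = (\<lambda>x. 1 * f x + (- l f / l f0) * f0 x)" for f
    have r: "r f \<in> V" "s (r f) (r f) = 0" if f: "f \<in> V" for f
    proof -
      show V': "r f \<in> V" unfolding r_def by (rule V[OF f f0(1)])
      have "l (r f) = 0" unfolding r_def l[OF f f0(1)] using f0(2) by simp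
      then show "s (r f) (r f) = 0" by (rule dom[OF V'])
    qed
    have left: "s f g = (l f / l f0) * s f0 g" if f: "f \<in> V" and g: "g \<in> V" for f g
      using null(1)[OF r(1)[OF f] g r(2)[OF f]] unfolding r_def s1[OF f f0(1) g] by simp
    have right: "s f0 g = cnj (l g / l f0) * s f0 f0" if g: "g \<in> V" for g
      using null(2)[OF r(1)[OF g] f0(1) r(2)[OF g]] unfolding r_def s2[OF g f0(1) f0(1)] by simp
    have "s f g = s f0 f0 / (l f0 * cnj (l f0)) * (l f * cnj (l g))" if "f \<in> V" "g \<in> V" for f g
      unfolding left[OF that] right[OF that(2)] by simp
    then show ?thesis by blast
  qed
qed

text \<open>
  The form \<open>(f, g) \<mapsto> \<phi> (|f><g|)\<close> is positive semidefinite and vanishes on the diagonal wherever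
  \<open><p, f>\<close> does.
\<close>

lemma functional_dominated_on_rank1:
  assumes S: "op_space M S" and q: "quasi_state M S \<phi>" and p: "p \<in> l2_space M"
    and V: "V \<subseteq> l2_space M" "\<And>f g a b. f \<in> V \<Longrightarrow> g \<in> V \<Longrightarrow> (\<lambda>x. a * f x + b * g x) \<in> V"
    and R: "\<And>f g. f \<in> V \<Longrightarrow> g \<in> V \<Longrightarrow> rank1 M f g \<in> S"
    and t: "t > 0" and dom: "\<And>f. f \<in> V \<Longrightarrow> t * cmod (\<phi> (rank1 M f f)) \<le> (cmod (l2_inner M p f))\<^sup>2"
  shows "\<exists>c. \<forall>f\<in>V. \<forall>g\<in>V. \<phi> (rank1 M f g) = c * (l2_inner M p f * l2_inner M g p)"
proof -
  note lin = quasi_stateD(1)[OF q]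
  have V2: "f \<in> l2_space M" if "f \<in> V" for f using V(1) that by blast
  have "\<exists>c. \<forall>f\<in>V. \<forall>g\<in>V. \<phi> (rank1 M f g) = c * (l2_inner M p f * cnj (l2_inner M p g))"
  proof (rule form_dominated_by_rank_one[where s = "\<lambda>f g. \<phi> (rank1 M f g)" and l = "l2_inner M p"])
    fix f g h a b assume f: "f \<in> V" and g: "g \<in> V" and h: "h \<in> V"
    have "rank1 M (\<lambda>x. a * f x + b * g x) h = (\<lambda>\<xi> x. a * rank1 M f h \<xi> x + b * rank1 M g h \<xi> x)"
      unfolding rank1_def by (intro ext) (simp add: algebra_simps)
    then show "\<phi> (rank1 M (\<lambda>x. a * f x + b * g x) h) = a * \<phi> (rank1 M f h) + b * \<phi> (rank1 M g h)"
      by (simp only: functional_lincomb[OF lin R[OF f h] R[OF g h]])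
    have "\<phi> (rank1 M h (\<lambda>x. a * f x + b * g x))
        = \<phi> (\<lambda>\<xi> x. cnj a * rank1 M h f \<xi> x + cnj b * rank1 M h g \<xi> x)"
    proof (rule functional_cong[OF S q R[OF h V(2)[OF f g]] op_space_lincomb[OF S R[OF h f] R[OF h g]]])
      fix \<xi> assume "\<xi> \<in> l2_space M"
      from l2_inner_lincomb_left[OF V2[OF f] V2[OF g] this]
      show "rank1 M h (\<lambda>x. a * f x + b * g x) \<xi> = (\<lambda>x. cnj a * rank1 M h f \<xi> x + cnj b * rank1 M h g \<xi> x)"
        unfolding rank1_def by (intro ext) (simp add: algebra_simps)
    qed
    then show "\<phi> (rank1 M h (\<lambda>x. a * f x + b * g x)) = cnj a * \<phi> (rank1 M h f) + cnj b * \<phi> (rank1 M h g)"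
      by (simp only: functional_lincomb[OF lin R[OF h f] R[OF h g]])
  next
    fix f assume f: "f \<in> V"
    show "\<phi> (rank1 M f f) \<in> \<real>\<^sub>\<ge>\<^sub>0" by (rule quasi_stateD(2)[OF q R[OF f f] positive_rank1])
    assume "l2_inner M p f = 0"
    then have "t * cmod (\<phi> (rank1 M f f)) \<le> 0" using dom[OF f] by simp
    then show "\<phi> (rank1 M f f) = 0" using t by (simp add: mult_le_0_iff)
  qed (use V(2) l2_inner_lincomb_right[OF V2 V2 p] in blast)+
  then show ?thesis by (simp only: l2_inner_commute[of M _ p, symmetric])
qed

lemma l2_inner_cutoff_self:
  "l2_inner M p (\<lambda>x. indicator A x * p x) = of_real ((l2_norm M (\<lambda>x. indicator A x * p x))\<^sup>2)"
  unfolding l2_inner_self[symmetric] l2_inner_def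
  by (rule Bochner_Integration.integral_cong) (auto simp: indicator_def)

lemma l2_inner_zero_AE:
  assumes "f \<in> l2_space M" "g \<in> l2_space M" "AE x in M. f x = 0 \<or> g x = 0"
  shows "l2_inner M f g = 0"
proof -
  have "AE x in M. cnj (f x) * g x = 0" using assms(3) by eventually_elim auto
  then have "(LINT x|M. cnj (f x) * g x) = (LINT x|M. 0)"
    using l2_inner_integrable[OF assms(1,2)] by (intro integral_cong_AE) auto
  then show ?thesis by (simp add: l2_inner_def)
qed

context radon_metric_space
begin

lemma small_open_ball: "small_open \<epsilon> (ball y (\<epsilon> / 2))"
  using small_open_balls[of y y "\<epsilon> / 2" \<epsilon>] by simp

lemma cutoff_l2:
  "p \<in> l2_space \<mu> \<Longrightarrow> open U \<Longrightarrow> (\<lambda>x. indicator U x * p x) \<in> l2_on \<mu> U"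
  by (intro l2_on_cutoff open_sets order_refl)

lemma inner_cutoff_nonzero:
  assumes p: "p \<in> l2_space \<mu>" and U: "open U" and y: "y \<in> U" "y \<in> ess_support \<mu> p"
  shows "l2_inner \<mu> p (\<lambda>x. indicator U x * p x) \<noteq> 0"
proof
  assume "l2_inner \<mu> p (\<lambda>x. indicator U x * p x) = 0"
  then have "l2_norm \<mu> (\<lambda>x. indicator U x * p x) = 0" unfolding l2_inner_cutoff_self by simp
  then have "AE x in \<mu>. indicator U x * p x = 0"
    using l2_norm_eq_0_AE[OF l2_on_l2[OF cutoff_l2[OF p U]]] by simp
  then have "AE x in \<mu>. x \<in> U \<longrightarrow> p x = 0" by eventually_elim (auto simp: indicator_def)
  then show False using y U unfolding ess_support_def by blast
qed

lemma inner_off_support_zero: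
  assumes p: "p \<in> l2_space \<mu>" and f: "f \<in> l2_on \<mu> U" and dis: "U \<inter> ess_support \<mu> p = {}"
  shows "l2_inner \<mu> p f = 0"
proof (rule l2_inner_zero_AE[OF p l2_on_l2[OF f]])
  show "AE x in \<mu>. p x = 0 \<or> f x = 0"
    using AE_zero_off_ess_support[OF p]
  proof eventually_elim
    case (elim x)
    have "x \<notin> ess_support \<mu> p \<or> x \<notin> U" using dis by blast
    then show ?case using elim f by (auto simp: l2_on_def)
  qed
qed

text \<open>
  The principle by which \<open>\<epsilon>\<close>-connectedness enters: quantities \<open>R\<close> and \<open>N\<close> that are proportional over
  each small open set are globally proportional, for the factor cannot change from one point of the
  support to another at distance less than \<open>\<epsilon>\<close>, both points having a common small neighbourhood.
\<close>

lemma proportional_along_eps_chains: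
  fixes R N :: "'i \<Rightarrow> complex" and G :: "'a set \<Rightarrow> 'i set"
  assumes conn: "eps_connected \<epsilon> Y"
    and mono: "\<And>U W. U \<subseteq> W \<Longrightarrow> G U \<subseteq> G W"
    and loc: "\<And>U. small_open \<epsilon> U \<Longrightarrow> \<exists>c. \<forall>i\<in>G U. R i = c * N i"
    and nz: "\<And>U y. small_open \<epsilon> U \<Longrightarrow> y \<in> U \<Longrightarrow> y \<in> Y \<Longrightarrow> \<exists>i\<in>G U. N i \<noteq> 0"
    and z: "\<And>U i. small_open \<epsilon> U \<Longrightarrow> U \<inter> Y = {} \<Longrightarrow> i \<in> G U \<Longrightarrow> N i = 0"
  shows "\<exists>c. \<forall>U i. small_open \<epsilon> U \<longrightarrow> i \<in> G U \<longrightarrow> R i = c * N i"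
proof -
  define r where "r = {(y, y'). y \<in> Y \<and> y' \<in> Y \<and> dist y y' < \<epsilon>}"
  define C where "C y c \<longleftrightarrow> (\<exists>U. small_open \<epsilon> U \<and> y \<in> U \<and> (\<forall>i\<in>G U. R i = c * N i))" for y c
  have small_Int: "small_open \<epsilon> (U \<inter> W)" if "small_open \<epsilon> U" "small_open \<epsilon> W" for U W :: "'a set"
    using that unfolding small_open_def by (auto intro: open_Int)
  have uniq: "c = c'" if y: "y \<in> Y" and c: "C y c" "C y c'" for y c c'
  proof -
    obtain U where U: "small_open \<epsilon> U" "y \<in> U" "\<forall>i\<in>G U. R i = c * N i" using c(1) unfolding C_def by blast
    obtain W where W: "small_open \<epsilon> W" "y \<in> W" "\<forall>i\<in>G W. R i = c' * N i" using c(2) unfolding C_def by blast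
    have "y \<in> U \<inter> W" using U(2) W(2) by blast
    from nz[OF small_Int[OF U(1) W(1)] this y] obtain i where i: "i \<in> G (U \<inter> W)" "N i \<noteq> 0" by blast
    have "i \<in> G U" "i \<in> G W" using i(1) mono[of "U \<inter> W" U] mono[of "U \<inter> W" W] by blast+
    then have "c * N i = c' * N i" using U(3) W(3) by metis
    then show ?thesis using i(2) by simp
  qed
  have step: "C y' c" if yy: "(y, y') \<in> r" and c: "C y c" for y y' c
  proof -
    have y: "y \<in> Y" and d: "dist y y' < \<epsilon>" using yy by (auto simp: r_def)
    \<comment> \<open>The largest radius for which the union of the balls about both points is small.\<close>
    define \<rho> where "\<rho> = (\<epsilon> - dist y y') / 2"
    have \<rho>: "\<rho> > 0" using d by (simp add: \<rho>_def)
    have sm: "small_open \<epsilon> (ball y \<rho> \<union> ball y' \<rho>)" by (rule small_open_balls) (simp add: \<rho>_def field_simps)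
    obtain c' where c': "\<forall>i\<in>G (ball y \<rho> \<union> ball y' \<rho>). R i = c' * N i" using loc[OF sm] by blast
    have "C y c'" "C y' c'" unfolding C_def using sm c' \<rho> by (auto intro!: exI[of _ "ball y \<rho> \<union> ball y' \<rho>"])
    then show ?thesis using uniq[OF y c] by simp
  qed
  have chain: "C y' c" if "(y, y') \<in> r\<^sup>+" "C y c" for y y' c
    using that by (induction rule: trancl_induct) (auto intro: step)
  obtain Q where Q: "Y // r\<^sup>+ = {Q}" using conn unfolding eps_connected_def r_def[symmetric] is_singleton_def by blast
  have related: "(y, y') \<in> r\<^sup>+" if "y \<in> Y" "y' \<in> Y" for y y'
  proof -
    have "(y', y') \<in> r\<^sup>+" using that(2) eps by (auto simp: r_def)
    moreover have "r\<^sup>+ `` {y} = r\<^sup>+ `` {y'}"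
      using quotientI[OF that(1), of "r\<^sup>+"] quotientI[OF that(2), of "r\<^sup>+"] Q by simp
    ultimately show ?thesis by blast
  qed
  obtain y0 where y0: "y0 \<in> Y" using Q unfolding quotient_def by blast
  obtain c where c: "\<forall>i\<in>G (ball y0 (\<epsilon> / 2)). R i = c * N i" using loc[OF small_open_ball] by blast
  have C0: "C y0 c" unfolding C_def using c small_open_ball eps
    by (intro exI[of _ "ball y0 (\<epsilon> / 2)"]) simp
  have "R i = c * N i" if U: "small_open \<epsilon> U" and i: "i \<in> G U" for U i
  proof -
    obtain c' where c': "\<forall>i\<in>G U. R i = c' * N i" using loc[OF U] by blast
    show ?thesis
    proof (cases "U \<inter> Y = {}")
      case True
      then show ?thesis using z[OF U True i] c' i by simp
    next
      case False
      then obtain y where y: "y \<in> U" "y \<in> Y" by blast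
      have "C y c'" unfolding C_def using U y(1) c' by blast
      then have "c' = c" using uniq[OF y(2)] chain[OF related[OF y0 y(2)] C0] by blast
      then show ?thesis using c' i by simp
    qed
  qed
  then show ?thesis by blast
qed

section \<open>Purity of vector states\<close>

text \<open>
  A component of a convex decomposition is dominated, on the positive operators \<open>|f><f|\<close>, by a multiple of
  the vector functional. If this forces it to be proportional to the vector functional on the
  generators, then it is so on \<open>S\<close>, with factor one since both are positive of norm one.
\<close>

lemma vector_functional_pure:
  assumes gen: "rank1_generated \<mu> S G" and ES: "E_op \<mu> \<epsilon> \<subseteq> S"
    and p: "p \<in> l2_space \<mu>" "l2_norm \<mu> p = 1"
    and diag: "\<And>f g. (f, g) \<in> G \<Longrightarrow> (f, f) \<in> G"
    and rigid: "\<And>\<phi> t. quasi_state \<mu> S \<phi> \<Longrightarrow> t > 0 \<Longrightarrow>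
      (\<And>f. (f, f) \<in> G \<Longrightarrow> t * cmod (\<phi> (rank1 \<mu> f f)) \<le> (cmod (l2_inner \<mu> p f))\<^sup>2) \<Longrightarrow>
      \<exists>c. \<forall>f g. (f, g) \<in> G \<longrightarrow> \<phi> (rank1 \<mu> f g) = c * (l2_inner \<mu> p f * l2_inner \<mu> g p)"
  shows "(\<lambda>T\<in>S. l2_inner \<mu> p (T p)) \<in> pure_states \<mu> S"
proof -
  have S: "op_space \<mu> S" and GS: "\<And>f g. (f, g) \<in> G \<Longrightarrow> rank1 \<mu> f g \<in> S"
    using gen unfolding rank1_generated_def by auto
  define \<omega> where "\<omega> T = l2_inner \<mu> p (T p)" for T
  have st: "restrict \<omega> S \<in> states \<mu> S" unfolding \<omega>_def by (rule vector_functional_state[OF S ES p])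
  have q\<omega>: "quasi_state \<mu> S \<omega>" unfolding \<omega>_def by (rule vector_functional_quasi_state[OF S p(1)]) (simp add: p(2))
  have \<omega>R: "\<omega> (rank1 \<mu> f g) = l2_inner \<mu> p f * l2_inner \<mu> g p" for f g
    unfolding \<omega>_def by (rule l2_inner_rank1)
  have "\<exists>f g. (f, g) \<in> G \<and> l2_inner \<mu> p f \<noteq> 0"
  proof (rule ccontr)
    assume neg: "\<not> ?thesis"
    obtain T where T: "T \<in> S" "0 < cmod (restrict \<omega> S T)" using states_norm_attained[OF S st, of 0] by auto
    have "\<omega> T = 0 * \<omega> T"
    proof (rule functionals_proportional_if_on_generators[OF gen q\<omega> q\<omega> _ T(1)])
      fix f g assume "(f, g) \<in> G"
      then have "l2_inner \<mu> p f = 0" using neg by blast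
      then show "\<omega> (rank1 \<mu> f g) = 0 * \<omega> (rank1 \<mu> f g)" by (simp add: \<omega>R)
    qed
    then show False using T by simp
  qed
  then obtain f0 g0 where f0: "(f0, g0) \<in> G" "l2_inner \<mu> p f0 \<noteq> 0" by blast
  have component: "\<phi>1 = restrict \<omega> S"
    if \<phi>1: "\<phi>1 \<in> states \<mu> S" and \<phi>2: "\<phi>2 \<in> states \<mu> S" and t: "0 < t" "t < 1"
      and comb: "\<And>T. T \<in> S \<Longrightarrow> \<omega> T = of_real t * \<phi>1 T + of_real (1 - t) * \<phi>2 T"
    for \<phi>1 \<phi>2 and t :: real
  proof -
    have q1: "quasi_state \<mu> S \<phi>1" and q2: "quasi_state \<mu> S \<phi>2"
      by (rule states_imp_quasi_state[OF S \<phi>1], rule states_imp_quasi_state[OF S \<phi>2])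
    have dom: "t * cmod (\<phi>1 (rank1 \<mu> f f)) \<le> (cmod (l2_inner \<mu> p f))\<^sup>2" if ff: "(f, f) \<in> G" for f
    proof -
      note RS = GS[OF ff]
      have "\<phi>1 (rank1 \<mu> f f) \<in> \<real>\<^sub>\<ge>\<^sub>0" "\<phi>2 (rank1 \<mu> f f) \<in> \<real>\<^sub>\<ge>\<^sub>0"
        by (rule quasi_stateD(2)[OF q1 RS positive_rank1], rule quasi_stateD(2)[OF q2 RS positive_rank1])
      then obtain a b where a: "a \<ge> 0" "\<phi>1 (rank1 \<mu> f f) = of_real a"
        and b: "b \<ge> 0" "\<phi>2 (rank1 \<mu> f f) = of_real b" by (elim nonneg_Reals_cases)
      have "\<omega> (rank1 \<mu> f f) = of_real ((cmod (l2_inner \<mu> p f))\<^sup>2)"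
        unfolding \<omega>R complex_norm_square by (subst l2_inner_commute[of \<mu> f p]) (rule refl)
      then have "complex_of_real ((cmod (l2_inner \<mu> p f))\<^sup>2) = of_real (t * a + (1 - t) * b)"
        using comb[OF RS] unfolding a(2) b(2) by simp
      then have "(cmod (l2_inner \<mu> p f))\<^sup>2 = t * a + (1 - t) * b" unfolding of_real_eq_iff .
      moreover have "0 \<le> (1 - t) * b" using t b(1) by simp
      ultimately show ?thesis using a by (simp add: a(2))
    qed
    from rigid[OF q1 t(1) this] obtain c where
      c: "\<And>f g. (f, g) \<in> G \<Longrightarrow> \<phi>1 (rank1 \<mu> f g) = c * \<omega> (rank1 \<mu> f g)" unfolding \<omega>R by blast
    have scaled: "\<phi>1 T = c * \<omega> T" if "T \<in> S" for T
      by (rule functionals_proportional_if_on_generators[OF gen q1 q\<omega> c that])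
    have "cmod c \<le> 1"
    proof (rule ccontr)
      assume "\<not> cmod c \<le> 1"
      then have c1: "cmod c > 1" by simp
      then have c0: "0 < cmod c" by linarith
      then have "1 / cmod c < 1" using c1 by (simp only: divide_less_eq_1_pos)
      from states_norm_attained[OF S st this] obtain T where
        T: "T \<in> S" "op_norm \<mu> T \<le> 1" "1 / cmod c < cmod (restrict \<omega> S T)" by blast
      have "1 < cmod c * cmod (\<omega> T)" using T(1,3) by (simp only: restrict_apply' pos_divide_less_eq[OF c0] mult.commute)
      also have "\<dots> = cmod (\<phi>1 T)" unfolding scaled[OF T(1)] norm_mult ..
      also have "\<dots> \<le> 1" by (rule quasi_state_le_1[OF q1 T(1,2)])
      finally show False by simp
    qed
    moreover have "1 \<le> cmod c"
    proof (rule dense_le)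
      fix e :: real assume "e < 1"
      from states_norm_attained[OF S \<phi>1 this] obtain T where
        T: "T \<in> S" "op_norm \<mu> T \<le> 1" "e < cmod (\<phi>1 T)" by blast
      have "cmod (\<phi>1 T) = cmod c * cmod (\<omega> T)" unfolding scaled[OF T(1)] norm_mult ..
      also have "\<dots> \<le> cmod c * 1" by (intro mult_left_mono quasi_state_le_1[OF q\<omega> T(1,2)]) simp
      finally show "e \<le> cmod c" using T(3) by simp
    qed
    moreover have "c = of_real (cmod c)"
    proof -
      note ff = diag[OF f0(1)]
      define a where "a = (cmod (l2_inner \<mu> p f0))\<^sup>2"
      have a: "a > 0" using f0(2) by (simp add: a_def)
      have "\<omega> (rank1 \<mu> f0 f0) = of_real a"
        unfolding \<omega>R a_def complex_norm_square by (subst l2_inner_commute[of \<mu> f0 p]) (rule refl)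
      then have "c * of_real a \<in> \<real>\<^sub>\<ge>\<^sub>0"
        using quasi_stateD(2)[OF q1 GS[OF ff] positive_rank1] c[OF ff] by simp
      then have "Re c * a \<ge> 0 \<and> Im c * a = 0" by (simp add: complex_nonneg_Reals_iff)
      then have "Re c \<ge> 0" "Im c = 0" using a by (auto simp: zero_le_mult_iff)
      then show ?thesis by (simp add: complex_eq_iff cmod_eq_Re)
    qed
    ultimately have "c = 1" by simp
    show ?thesis
    proof (rule extensionalityI[of _ S])
      show "\<phi>1 \<in> extensional S" using \<phi>1 unfolding states_iff by blast
      fix T assume "T \<in> S"
      then show "\<phi>1 T = restrict \<omega> S T" using scaled \<open>c = 1\<close> by simp
    qed simp
  qed
  have "\<phi>1 = restrict \<omega> S \<and> \<phi>2 = restrict \<omega> S"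
    if \<phi>1: "\<phi>1 \<in> states \<mu> S" and \<phi>2: "\<phi>2 \<in> states \<mu> S"
      and t: "0 < t \<and> t < 1 \<and> (\<forall>T\<in>S. restrict \<omega> S T = of_real t * \<phi>1 T + of_real (1 - t) * \<phi>2 T)"
    for \<phi>1 \<phi>2 and t :: real
  proof -
    have comb: "\<omega> T = of_real t * \<phi>1 T + of_real (1 - t) * \<phi>2 T" if "T \<in> S" for T
      using t that by (metis restrict_apply')
    have comb': "\<omega> T = of_real (1 - t) * \<phi>2 T + of_real (1 - (1 - t)) * \<phi>1 T" if "T \<in> S" for T
      using comb[OF that] by simp
    have t': "0 < t" "t < 1" "0 < 1 - t" "1 - t < 1" using t by auto
    show ?thesis
      using component[OF \<phi>1 \<phi>2 t'(1,2) comb] component[OF \<phi>2 \<phi>1 t'(3,4) comb'] by blast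
  qed
  then have "restrict \<omega> S \<in> pure_states \<mu> S" unfolding pure_states_def using st by blast
  then show ?thesis unfolding \<omega>_def .
qed

lemma E_op_subset_compact: "E_op \<mu> \<epsilon> \<subseteq> compact_ops \<mu>"
  using E_op_compact by blast

lemma vector_state_pure_on_compact:
  assumes p: "p \<in> l2_space \<mu>" "l2_norm \<mu> p = 1"
  shows "vector_state \<mu> p \<in> pure_states \<mu> (compact_ops \<mu>)"
  unfolding vector_state_def
proof (rule vector_functional_pure[OF compact_ops_generated E_op_subset_compact p])
  have S: "op_space \<mu> (compact_ops \<mu>)"
    using compact_ops_generated[of \<mu>] unfolding rank1_generated_def by blast
  show "(f, f) \<in> all_pairs \<mu>" if "(f, g) \<in> all_pairs \<mu>" for f g using that by (simp add: all_pairs_def)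
  fix \<phi> and t :: real assume q: "quasi_state \<mu> (compact_ops \<mu>) \<phi>" and t: "t > 0"
    and dom: "\<And>f. (f, f) \<in> all_pairs \<mu> \<Longrightarrow> t * cmod (\<phi> (rank1 \<mu> f f)) \<le> (cmod (l2_inner \<mu> p f))\<^sup>2"
  have "\<exists>c. \<forall>f\<in>l2_space \<mu>. \<forall>g\<in>l2_space \<mu>. \<phi> (rank1 \<mu> f g) = c * (l2_inner \<mu> p f * l2_inner \<mu> g p)"
    by (rule functional_dominated_on_rank1[OF S q p(1) order_refl l2_lincomb rank1_compact t])
      (auto intro: dom simp: all_pairs_def)
  then show "\<exists>c. \<forall>f g. (f, g) \<in> all_pairs \<mu> \<longrightarrow> \<phi> (rank1 \<mu> f g) = c * (l2_inner \<mu> p f * l2_inner \<mu> g p)"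
    by (auto simp: all_pairs_def)
qed

text \<open>
  Domination gives proportionality over each small open set, and connectedness of the support makes
  the factor global.
\<close>

lemma vector_state_pure_on_E:
  assumes p: "p \<in> l2_space \<mu>" "l2_norm \<mu> p = 1" and conn: "eps_connected \<epsilon> (ess_support \<mu> p)"
  shows "(\<lambda>T\<in>E_op \<mu> \<epsilon>. l2_inner \<mu> p (T p)) \<in> pure_states \<mu> (E_op \<mu> \<epsilon>)"
proof (rule vector_functional_pure[OF E_op_generated order_refl p])
  show "(f, f) \<in> local_pairs" if "(f, g) \<in> local_pairs" for f g using that by (auto simp: local_pairs_def)
  fix \<phi> and t :: real assume q: "quasi_state \<mu> (E_op \<mu> \<epsilon>) \<phi>" and t: "t > 0"
    and dom: "\<And>f. (f, f) \<in> local_pairs \<Longrightarrow> t * cmod (\<phi> (rank1 \<mu> f f)) \<le> (cmod (l2_inner \<mu> p f))\<^sup>2"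
  have "\<exists>c. \<forall>U i. small_open \<epsilon> U \<longrightarrow> i \<in> l2_on \<mu> U \<times> l2_on \<mu> U \<longrightarrow>
      \<phi> (rank1 \<mu> (fst i) (snd i)) = c * (l2_inner \<mu> p (fst i) * l2_inner \<mu> (snd i) p)"
  proof (rule proportional_along_eps_chains[OF conn])
    show "l2_on \<mu> U \<times> l2_on \<mu> U \<subseteq> l2_on \<mu> W \<times> l2_on \<mu> W" if "U \<subseteq> W" for U W
      using l2_on_mono[OF that] by blast
  next
    fix U :: "'a set" assume U: "small_open \<epsilon> U"
    have "\<exists>c. \<forall>f\<in>l2_on \<mu> U. \<forall>g\<in>l2_on \<mu> U. \<phi> (rank1 \<mu> f g) = c * (l2_inner \<mu> p f * l2_inner \<mu> g p)"
    proof (rule functional_dominated_on_rank1[OF op_space_E q p(1) _ l2_on_lincomb _ t])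
      show "l2_on \<mu> U \<subseteq> l2_space \<mu>" by (auto simp: l2_on_def)
      show "rank1 \<mu> f g \<in> E_op \<mu> \<epsilon>" if "f \<in> l2_on \<mu> U" "g \<in> l2_on \<mu> U" for f g
        by (rule rank1_in_E_op[OF local_pairsI[OF U that]])
      show "t * cmod (\<phi> (rank1 \<mu> f f)) \<le> (cmod (l2_inner \<mu> p f))\<^sup>2" if "f \<in> l2_on \<mu> U" for f
        by (rule dom[OF local_pairsI[OF U that that]])
    qed
    then show "\<exists>c. \<forall>i\<in>l2_on \<mu> U \<times> l2_on \<mu> U.
        \<phi> (rank1 \<mu> (fst i) (snd i)) = c * (l2_inner \<mu> p (fst i) * l2_inner \<mu> (snd i) p)"
      by auto
  next
    fix U y assume U: "small_open \<epsilon> U" "y \<in> U" "y \<in> ess_support \<mu> p"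
    have oU: "open U" using U(1) by (simp add: small_open_def)
    let ?f = "\<lambda>x. indicator U x * p x"
    have nz: "l2_inner \<mu> p ?f \<noteq> 0" by (rule inner_cutoff_nonzero[OF p(1) oU U(2,3)])
    then have "l2_inner \<mu> ?f p \<noteq> 0" by (subst l2_inner_commute) simp
    then show "\<exists>i\<in>l2_on \<mu> U \<times> l2_on \<mu> U. l2_inner \<mu> p (fst i) * l2_inner \<mu> (snd i) p \<noteq> 0"
      using nz cutoff_l2[OF p(1) oU] by (intro bexI[of _ "(?f, ?f)"]) auto
  next
    fix U i assume "small_open \<epsilon> U" "U \<inter> ess_support \<mu> p = {}" "i \<in> l2_on \<mu> U \<times> l2_on \<mu> U"
    then show "l2_inner \<mu> p (fst i) * l2_inner \<mu> (snd i) p = 0"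
      using inner_off_support_zero[OF p(1), of "fst i" U] by auto
  qed
  then obtain c where c: "\<And>U i. small_open \<epsilon> U \<Longrightarrow> i \<in> l2_on \<mu> U \<times> l2_on \<mu> U \<Longrightarrow>
      \<phi> (rank1 \<mu> (fst i) (snd i)) = c * (l2_inner \<mu> p (fst i) * l2_inner \<mu> (snd i) p)" by blast
  have "\<phi> (rank1 \<mu> f g) = c * (l2_inner \<mu> p f * l2_inner \<mu> g p)" if "(f, g) \<in> local_pairs" for f g
  proof -
    obtain U where U: "small_open \<epsilon> U" "(f, g) \<in> l2_on \<mu> U \<times> l2_on \<mu> U"
      using \<open>(f, g) \<in> local_pairs\<close> unfolding local_pairs_def by blast
    from c[OF U] show ?thesis by simp
  qed
  then show "\<exists>c. \<forall>f g. (f, g) \<in> local_pairs \<longrightarrow> \<phi> (rank1 \<mu> f g) = c * (l2_inner \<mu> p f * l2_inner \<mu> g p)"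
    by blast
qed

end

section \<open>The bijection\<close>

lemma quasi_state_normalised_vector:
  assumes S: "op_space M S" and p: "p \<in> l2_space M" and n: "l2_norm M p = n" "n > 0"
  shows "quasi_state M S (\<lambda>T. of_real (1 / n\<^sup>2) * l2_inner M p (T p))"
proof -
  define P where "P = (\<lambda>x. of_real (1 / n) * p x)"
  have P2: "P \<in> l2_space M" unfolding P_def by (rule l2_scale[OF p])
  have Pn: "l2_norm M P = 1" unfolding P_def l2_norm_scale norm_of_real n(1) using n(2) by simp
  have q: "quasi_state M S (\<lambda>T. l2_inner M P (T P))"
    by (rule vector_functional_quasi_state[OF S P2]) (simp add: Pn)
  have eq: "l2_inner M P (T P) = of_real (1 / n\<^sup>2) * l2_inner M p (T p)" if T: "T \<in> S" for T
  proof -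
    have "l2_inner M P (T P) = of_real (1 / n) * l2_inner M P (T p)"
      using l2_inner_op_lincomb[OF op_space_bounded[OF S T] p p P2, of "of_real (1 / n)" 0]
      unfolding P_def by simp
    also have "l2_inner M P (T p) = of_real (1 / n) * l2_inner M p (T p)"
      unfolding P_def l2_inner_scale_left by simp
    finally show ?thesis by (simp add: power2_eq_square)
  qed
  show ?thesis
    unfolding quasi_state_def linear_functional_on_def
  proof (intro conjI ballI allI impI)
    fix T U a b assume T: "T \<in> S" and U: "U \<in> S"
    show "of_real (1 / n\<^sup>2) * l2_inner M p (\<lambda>x. a * T p x + b * U p x)
        = a * (of_real (1 / n\<^sup>2) * l2_inner M p (T p)) + b * (of_real (1 / n\<^sup>2) * l2_inner M p (U p))"
      using functional_lincomb[OF quasi_stateD(1)[OF q] T U, of a b]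
      unfolding eq[OF T] eq[OF U] eq[OF op_space_lincomb[OF S T U]] .
  next
    fix T assume T: "T \<in> S" and "positive_op M T"
    then show "of_real (1 / n\<^sup>2) * l2_inner M p (T p) \<in> \<real>\<^sub>\<ge>\<^sub>0"
      using quasi_stateD(2)[OF q T] unfolding eq[OF T] by blast
  next
    fix T assume T: "T \<in> S"
    show "cmod (of_real (1 / n\<^sup>2) * l2_inner M p (T p)) \<le> op_norm M T"
      using quasi_stateD(3)[OF q T] unfolding eq[OF T] .
  qed
qed

context radon_metric_space
begin

text \<open>
  If the support falls apart into \<open>A\<close> and a part at distance at least \<open>\<epsilon>\<close> from it, then no operator
  in the operator space has matrix entries between the two parts of \<open>p\<close>, so that the state is a
  mixture of two states, which differ at a rank-one operator supported near \<open>A\<close>.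
\<close>

lemma pure_vector_state_eps_connected:
  assumes pure: "\<phi> \<in> pure_states \<mu> (E_op \<mu> \<epsilon>)" and p: "p \<in> l2_space \<mu>" "l2_norm \<mu> p = 1"
    and rep: "\<And>T. T \<in> E_op \<mu> \<epsilon> \<Longrightarrow> \<phi> T = l2_inner \<mu> p (T p)"
  shows "eps_connected \<epsilon> (ess_support \<mu> p)"
proof (rule ccontr)
  define Y where "Y = ess_support \<mu> p"
  define r where "r = {(y, y'). y \<in> Y \<and> y' \<in> Y \<and> dist y y' < \<epsilon>}"
  assume "\<not> eps_connected \<epsilon> (ess_support \<mu> p)"
  then have nc: "\<not> is_singleton (Y // r\<^sup>+)" unfolding eps_connected_def Y_def r_def .
  have AE_Y: "AE x in \<mu>. x \<notin> Y \<longrightarrow> p x = 0" unfolding Y_def by (rule AE_zero_off_ess_support[OF p(1)])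
  have nonnull: "\<not> (AE x in \<mu>. x \<in> ball y \<epsilon> \<longrightarrow> p x = 0)" if "y \<in> Y" for y
  proof
    assume "AE x in \<mu>. x \<in> ball y \<epsilon> \<longrightarrow> p x = 0"
    moreover have "y \<in> ball y \<epsilon>" using eps by simp
    ultimately show False using that unfolding Y_def ess_support_def by blast
  qed
  have "Y \<noteq> {}"
  proof
    assume "Y = {}"
    then have "AE x in \<mu>. p x = 0" using AE_Y by simp
    then have "l2_norm \<mu> p = 0" using l2_norm_eq_0_AE[OF p(1)] by simp
    then show False using p(2) by simp
  qed
  then obtain y0 where y0: "y0 \<in> Y" by blast
  define A where "A = r\<^sup>+ `` {y0}"
  have r_sub: "r\<^sup>+ \<subseteq> Y \<times> Y" by (rule trancl_subset_Sigma) (auto simp: r_def)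
  have AY: "A \<subseteq> Y" using r_sub unfolding A_def by blast
  have y0A: "y0 \<in> A" using y0 eps by (auto simp: A_def r_def)
  have closed: "y' \<in> A" if "y \<in> A" "y' \<in> Y" "dist y y' < \<epsilon>" for y y'
  proof -
    have "(y, y') \<in> r" using that AY by (auto simp: r_def)
    then show ?thesis using that(1) unfolding A_def by (auto intro: trancl_into_trancl)
  qed
  have "A \<noteq> Y"
  proof
    assume AeqY: "A = Y"
    have "sym r" by (auto simp: sym_def r_def dist_commute)
    then have symt: "sym (r\<^sup>+)" by (rule sym_trancl)
    have "r\<^sup>+ `` {y} = Y" if y: "y \<in> Y" for y
    proof
      show "r\<^sup>+ `` {y} \<subseteq> Y" using r_sub by blast
      have "(y0, y) \<in> r\<^sup>+" using y AeqY unfolding A_def by blast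
      then have yy0: "(y, y0) \<in> r\<^sup>+" using symt by (blast dest: symD)
      show "Y \<subseteq> r\<^sup>+ `` {y}"
      proof
        fix y' assume "y' \<in> Y"
        then have "(y0, y') \<in> r\<^sup>+" using AeqY unfolding A_def by blast
        then show "y' \<in> r\<^sup>+ `` {y}" using yy0 by (blast intro: trancl_trans)
      qed
    qed
    then have "Y // r\<^sup>+ = {Y}" using y0 unfolding quotient_def by blast
    then show False using nc by (simp add: is_singleton_def)
  qed
  then obtain b0 where b0: "b0 \<in> Y" "b0 \<notin> A" using AY by blast
  \<comment> \<open>An open set that meets the support precisely in the chain component \<open>A\<close>.\<close>
  define W where "W = (\<Union>a\<in>A. ball a \<epsilon>)"
  have W: "open W" unfolding W_def by blast
  have AW: "A \<subseteq> W" unfolding W_def using eps by auto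
  have WY: "x \<in> A" if "x \<in> W" "x \<in> Y" for x
    using that closed unfolding W_def by auto
  define pA where "pA = (\<lambda>x. indicator W x * p x)"
  define pB where "pB = (\<lambda>x. indicator (- W) x * p x)"
  have mW: "W \<in> sets \<mu>" by (rule open_sets[OF W])
  have mW': "- W \<in> sets \<mu>" using sets.compl_sets[OF mW] by (simp add: Compl_eq_Diff_UNIV)
  have pA: "pA \<in> l2_space \<mu>" unfolding pA_def by (rule l2_cutoff[OF p(1) mW])
  have pB: "pB \<in> l2_space \<mu>" unfolding pB_def by (rule l2_cutoff[OF p(1) mW'])
  have psum: "p = (\<lambda>x. 1 * pA x + 1 * pB x)"
    by (rule ext) (simp add: pA_def pB_def indicator_def)
  have orth: "l2_inner \<mu> pA pB = 0"
    by (rule l2_inner_zero_AE[OF pA pB]) (simp add: pA_def pB_def indicator_def)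
  have "(l2_norm \<mu> (\<lambda>x. pA x + 1 * pB x))\<^sup>2 = (l2_norm \<mu> pA)\<^sup>2 + (l2_norm \<mu> pB)\<^sup>2"
    unfolding l2_norm_lincomb_squared[OF pA pB] orth by simp
  moreover have "(\<lambda>x. pA x + 1 * pB x) = p" using psum by simp
  ultimately have norms: "(l2_norm \<mu> pA)\<^sup>2 + (l2_norm \<mu> pB)\<^sup>2 = 1" using p(2) by simp
  have zA: "AE x in \<mu>. pA x = 0 \<or> x \<in> A"
    using AE_Y by eventually_elim (use WY in \<open>auto simp: pA_def indicator_def\<close>)
  have zB: "AE x in \<mu>. pB x = 0 \<or> (x \<in> Y \<and> x \<notin> A)"
    using AE_Y by eventually_elim (use AW in \<open>auto simp: pB_def indicator_def\<close>)
  have nA: "l2_norm \<mu> pA \<noteq> 0"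
  proof
    assume "l2_norm \<mu> pA = 0"
    then have "AE x in \<mu>. pA x = 0" using l2_norm_eq_0_AE[OF pA] by simp
    then have "AE x in \<mu>. x \<in> ball y0 \<epsilon> \<longrightarrow> p x = 0"
      by eventually_elim (use y0A in \<open>auto simp: pA_def W_def indicator_def split: if_splits\<close>)
    then show False using nonnull[OF y0] by blast
  qed
  have nB: "l2_norm \<mu> pB \<noteq> 0"
  proof
    assume "l2_norm \<mu> pB = 0"
    then have "AE x in \<mu>. pB x = 0" using l2_norm_eq_0_AE[OF pB] by simp
    then have "AE x in \<mu>. x \<in> ball b0 \<epsilon> \<longrightarrow> p x = 0"
      using AE_Y
    proof eventually_elim
      case (elim x)
      show ?case
      proof
        assume x: "x \<in> ball b0 \<epsilon>"
        show "p x = 0"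
        proof (rule ccontr)
          assume px: "p x \<noteq> 0"
          then have "x \<in> Y" using elim(2) by blast
          moreover have "x \<in> W" using elim(1) px by (auto simp: pB_def indicator_def split: if_splits)
          ultimately have "x \<in> A" using WY by blast
          then have "b0 \<in> A" using closed b0(1) x by (auto simp: dist_commute)
          then show False using b0(2) by blast
        qed
      qed
    qed
    then show False using nonnull[OF b0(1)] by blast
  qed
  define a where "a = l2_norm \<mu> pA"
  define b where "b = l2_norm \<mu> pB"
  have ab: "a > 0" "b > 0"
    using nA nB l2_norm_nonneg[of \<mu> pA] l2_norm_nonneg[of \<mu> pB] unfolding a_def b_def by linarith+
  define \<alpha> where "\<alpha> T = of_real (1 / a\<^sup>2) * l2_inner \<mu> pA (T pA)" for T
  define \<beta> where "\<beta> T = of_real (1 / b\<^sup>2) * l2_inner \<mu> pB (T pB)" for T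
  have qA: "quasi_state \<mu> (E_op \<mu> \<epsilon>) \<alpha>"
    unfolding \<alpha>_def by (rule quasi_state_normalised_vector[OF op_space_E pA a_def[symmetric] ab(1)])
  have qB: "quasi_state \<mu> (E_op \<mu> \<epsilon>) \<beta>"
    unfolding \<beta>_def by (rule quasi_state_normalised_vector[OF op_space_E pB b_def[symmetric] ab(2)])
  have t: "0 < a\<^sup>2" "a\<^sup>2 < 1" and b2: "1 - a\<^sup>2 = b\<^sup>2"
  proof -
    have "0 < a\<^sup>2" "0 < b\<^sup>2" using ab by simp_all
    then show "0 < a\<^sup>2" "a\<^sup>2 < 1" "1 - a\<^sup>2 = b\<^sup>2" using norms[folded a_def b_def] by linarith+
  qed
  have AB: "of_real (a\<^sup>2) * \<alpha> T = l2_inner \<mu> pA (T pA)" "of_real (1 - a\<^sup>2) * \<beta> T = l2_inner \<mu> pB (T pB)" for T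
    unfolding b2 \<alpha>_def \<beta>_def mult.assoc[symmetric] of_real_mult[symmetric] using ab by simp_all
  have one_zero: "U \<inter> A = {} \<or> U \<inter> (Y - A) = {}" if U: "small_open \<epsilon> U" for U
  proof (rule ccontr)
    assume "\<not> ?thesis"
    then obtain x y where xy: "x \<in> U" "x \<in> A" "y \<in> U" "y \<in> Y" "y \<notin> A" by blast
    then have "dist x y < \<epsilon>" using U by (auto simp: small_open_def tolerance_def)
    then show False using closed xy by blast
  qed
  have zero_A: "l2_inner \<mu> pA f = 0" if "f \<in> l2_on \<mu> U" "U \<inter> A = {}" for f U
  proof (rule l2_inner_zero_AE[OF pA l2_on_l2[OF that(1)]])
    show "AE x in \<mu>. pA x = 0 \<or> f x = 0"
      using zA by eventually_elim (use that in \<open>auto simp: l2_on_def\<close>)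
  qed
  have zero_B: "l2_inner \<mu> pB f = 0" if "f \<in> l2_on \<mu> U" "U \<inter> (Y - A) = {}" for f U
  proof (rule l2_inner_zero_AE[OF pB l2_on_l2[OF that(1)]])
    show "AE x in \<mu>. pB x = 0 \<or> f x = 0"
      using zB by eventually_elim (use that in \<open>auto simp: l2_on_def\<close>)
  qed
  \<comment> \<open>The cross terms, which vanish on \<open>E_op \<mu> \<epsilon>\<close>.\<close>
  define R where "R T = l2_inner \<mu> pA (T pB) + l2_inner \<mu> pB (T pA)" for T
  have split: "\<phi> T = l2_inner \<mu> pA (T pA) + l2_inner \<mu> pB (T pB) + R T" if T: "T \<in> E_op \<mu> \<epsilon>" for T
  proof -
    note Tb = E_op_bounded[OF T]
    have "\<phi> T = 1 * l2_inner \<mu> p (T pA) + 1 * l2_inner \<mu> p (T pB)"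
      unfolding rep[OF T] using l2_inner_op_lincomb[OF Tb pA pB p(1), of 1 1] psum[symmetric] by simp
    moreover have "l2_inner \<mu> p h = cnj 1 * l2_inner \<mu> pA h + cnj 1 * l2_inner \<mu> pB h" if "h \<in> l2_space \<mu>" for h
      using l2_inner_lincomb_left[OF pA pB that, of 1 1] psum[symmetric] by simp
    ultimately show ?thesis
      using bounded_opsD(1)[OF Tb pA] bounded_opsD(1)[OF Tb pB] by (simp add: R_def)
  qed
  have qphi: "quasi_state \<mu> (E_op \<mu> \<epsilon>) \<phi>"
    using pure states_imp_quasi_state[OF op_space_E] unfolding pure_states_def by blast
  define \<psi> where "\<psi> T = of_real (a\<^sup>2) * \<alpha> T + of_real (1 - a\<^sup>2) * \<beta> T" for T
  have qpsi: "quasi_state \<mu> (E_op \<mu> \<epsilon>) \<psi>"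
    unfolding quasi_state_def linear_functional_on_def
  proof (intro conjI ballI allI impI)
    fix T U c d assume T: "T \<in> E_op \<mu> \<epsilon>" and U: "U \<in> E_op \<mu> \<epsilon>"
    show "\<psi> (\<lambda>\<xi> x. c * T \<xi> x + d * U \<xi> x) = c * \<psi> T + d * \<psi> U"
      unfolding \<psi>_def functional_lincomb[OF quasi_stateD(1)[OF qA] T U]
        functional_lincomb[OF quasi_stateD(1)[OF qB] T U] by (simp add: algebra_simps)
  next
    fix T assume T: "T \<in> E_op \<mu> \<epsilon>" "positive_op \<mu> T"
    have "complex_of_real (a\<^sup>2) \<in> \<real>\<^sub>\<ge>\<^sub>0" "complex_of_real (1 - a\<^sup>2) \<in> \<real>\<^sub>\<ge>\<^sub>0"
      using t by (simp_all only: nonneg_Reals_of_real_iff)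
    then show "\<psi> T \<in> \<real>\<^sub>\<ge>\<^sub>0" unfolding \<psi>_def
      by (intro nonneg_Reals_add_I nonneg_Reals_mult_I quasi_stateD(2)[OF qA T] quasi_stateD(2)[OF qB T])
  next
    fix T assume T: "T \<in> E_op \<mu> \<epsilon>"
    have "cmod (\<psi> T) \<le> cmod (of_real (a\<^sup>2) * \<alpha> T) + cmod (of_real (1 - a\<^sup>2) * \<beta> T)"
      unfolding \<psi>_def by (rule norm_triangle_ineq)
    also have "\<dots> = a\<^sup>2 * cmod (\<alpha> T) + (1 - a\<^sup>2) * cmod (\<beta> T)"
      unfolding norm_mult norm_of_real using t by simp
    also have "\<dots> \<le> a\<^sup>2 * op_norm \<mu> T + (1 - a\<^sup>2) * op_norm \<mu> T"
      using t by (intro add_mono mult_left_mono quasi_stateD(3)[OF qA T] quasi_stateD(3)[OF qB T]) auto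
    finally show "cmod (\<psi> T) \<le> op_norm \<mu> T" by (simp add: algebra_simps)
  qed
  have on_gen: "\<phi> (rank1 \<mu> f g) = 1 * \<psi> (rank1 \<mu> f g)" if fg: "(f, g) \<in> local_pairs" for f g
  proof -
    obtain U where U: "small_open \<epsilon> U" and f: "f \<in> l2_on \<mu> U" and g: "g \<in> l2_on \<mu> U"
      using fg unfolding local_pairs_def by blast
    have gA: "l2_inner \<mu> g pA = cnj (l2_inner \<mu> pA g)" and gB: "l2_inner \<mu> g pB = cnj (l2_inner \<mu> pB g)"
      by (rule l2_inner_commute)+
    have "R (rank1 \<mu> f g) = 0"
      using one_zero[OF U]
    proof
      assume "U \<inter> A = {}"
      then show ?thesis unfolding R_def l2_inner_rank1 gA using zero_A[OF f] zero_A[OF g] by simp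
    next
      assume "U \<inter> (Y - A) = {}"
      then show ?thesis unfolding R_def l2_inner_rank1 gB using zero_B[OF f] zero_B[OF g] by simp
    qed
    then show ?thesis unfolding split[OF rank1_in_E_op[OF fg]] \<psi>_def AB by simp
  qed
  have comb: "\<phi> T = of_real (a\<^sup>2) * \<alpha> T + of_real (1 - a\<^sup>2) * \<beta> T" if "T \<in> E_op \<mu> \<epsilon>" for T
    using functionals_proportional_if_on_generators[OF E_op_generated qphi qpsi on_gen that]
    unfolding \<psi>_def by simp
  have eq: "\<alpha> T = \<beta> T" if T: "T \<in> E_op \<mu> \<epsilon>" for T
    using pure_state_convex_component[OF op_space_E pure qA qB t comb T] by simp
  define U where "U = ball y0 (\<epsilon> / 2)"
  have U: "small_open \<epsilon> U" "open U" unfolding U_def by (rule small_open_ball) simp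
  have UW: "U \<subseteq> W" unfolding U_def W_def using y0A eps by force
  define f where "f = (\<lambda>x. indicator U x * p x)"
  have f: "f \<in> l2_on \<mu> U" unfolding f_def by (rule cutoff_l2[OF p(1) U(2)])
  have "l2_inner \<mu> p f \<noteq> 0" unfolding f_def
    by (rule inner_cutoff_nonzero[OF p(1) U(2)]) (use y0 eps in \<open>simp_all add: U_def Y_def\<close>)
  moreover have fB: "l2_inner \<mu> pB f = 0"
    by (rule l2_inner_zero_AE[OF pB l2_on_l2[OF f]])
      (use UW in \<open>auto simp: pB_def f_def indicator_def\<close>)
  moreover have "l2_inner \<mu> p f = l2_inner \<mu> pA f + l2_inner \<mu> pB f"
    using l2_inner_lincomb_left[OF pA pB l2_on_l2[OF f], of 1 1] psum[symmetric] by simp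
  ultimately have fA: "l2_inner \<mu> pA f \<noteq> 0" by simp
  have fE: "rank1 \<mu> f f \<in> E_op \<mu> \<epsilon>" by (rule rank1_in_E_op[OF local_pairsI[OF U(1) f f]])
  have "\<beta> (rank1 \<mu> f f) = 0" unfolding \<beta>_def l2_inner_rank1 fB by simp
  moreover have "\<alpha> (rank1 \<mu> f f) \<noteq> 0"
    unfolding \<alpha>_def l2_inner_rank1 using fA ab by (subst l2_inner_commute[of \<mu> f pA]) simp
  ultimately show False using eq[OF fE] by simp
qed

text \<open>
  On small open sets \<open>p'\<close> is a multiple of \<open>p\<close>, by comparing rank-one operators. The factors agree
  along \<open>\<epsilon>\<close>-chains, so that \<open>p'\<close> is a multiple of \<open>p\<close> almost everywhere.
\<close>

lemma vector_state_determined_by_restriction: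
  assumes p: "p \<in> l2_space \<mu>" "l2_norm \<mu> p = 1" and p': "p' \<in> l2_space \<mu>" "l2_norm \<mu> p' = 1"
    and conn: "eps_connected \<epsilon> (ess_support \<mu> p)"
    and eq: "\<And>T. T \<in> E_op \<mu> \<epsilon> \<Longrightarrow> l2_inner \<mu> p (T p) = l2_inner \<mu> p' (T p')"
  shows "vector_state \<mu> p = vector_state \<mu> p'"
proof -
  have "\<exists>c. \<forall>U i. small_open \<epsilon> U \<longrightarrow> i \<in> l2_on \<mu> U \<longrightarrow> l2_inner \<mu> p' i = c * l2_inner \<mu> p i"
  proof (rule proportional_along_eps_chains[OF conn l2_on_mono])
    fix U :: "'a set" assume U: "small_open \<epsilon> U"
    have e: "l2_inner \<mu> p f * l2_inner \<mu> g p = l2_inner \<mu> p' f * l2_inner \<mu> g p'"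
      if "f \<in> l2_on \<mu> U" "g \<in> l2_on \<mu> U" for f g
      using eq[OF rank1_in_E_op[OF local_pairsI[OF U that]]] unfolding l2_inner_rank1 .
    have flip: "l2_inner \<mu> f q = 0 \<longleftrightarrow> l2_inner \<mu> q f = 0" for f q
      by (subst l2_inner_commute) simp
    show "\<exists>c. \<forall>i\<in>l2_on \<mu> U. l2_inner \<mu> p' i = c * l2_inner \<mu> p i"
    proof (cases "\<exists>f0\<in>l2_on \<mu> U. l2_inner \<mu> p f0 \<noteq> 0")
      case False
      then have "l2_inner \<mu> p' f = 0" if "f \<in> l2_on \<mu> U" for f
        using e[OF that that] flip[of f p'] that by auto
      then show ?thesis by (intro exI[of _ 0]) simp
    next
      case True
      then obtain f0 where f0: "f0 \<in> l2_on \<mu> U" "l2_inner \<mu> p f0 \<noteq> 0" by blast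
      have n: "l2_inner \<mu> f0 p' \<noteq> 0" using e[OF f0(1) f0(1)] f0(2) flip[of f0 p] by auto
      have "l2_inner \<mu> p' f = (l2_inner \<mu> f0 p / l2_inner \<mu> f0 p') * l2_inner \<mu> p f" if "f \<in> l2_on \<mu> U" for f
        using e[OF that f0(1)] n by (simp add: field_simps)
      then show ?thesis by blast
    qed
  next
    fix U y assume U: "small_open \<epsilon> U" "y \<in> U" "y \<in> ess_support \<mu> p"
    have oU: "open U" using U(1) by (simp add: small_open_def)
    show "\<exists>i\<in>l2_on \<mu> U. l2_inner \<mu> p i \<noteq> 0"
      by (intro bexI[of _ "\<lambda>x. indicator U x * p x"] inner_cutoff_nonzero[OF p(1) oU U(2,3)]
          cutoff_l2[OF p(1) oU])
  next
    fix U i assume "small_open \<epsilon> U" "U \<inter> ess_support \<mu> p = {}" "i \<in> l2_on \<mu> U"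
    then show "l2_inner \<mu> p i = 0" by (intro inner_off_support_zero[OF p(1)])
  qed
  then obtain c where c: "\<And>U f. small_open \<epsilon> U \<Longrightarrow> f \<in> l2_on \<mu> U \<Longrightarrow> l2_inner \<mu> p' f = c * l2_inner \<mu> p f"
    by blast
  define d where "d = (\<lambda>x. 1 * p' x + (- cnj c) * p x)"
  have d: "d \<in> l2_space \<mu>" unfolding d_def by (rule l2_lincomb[OF p'(1) p(1)])
  have "ess_support \<mu> d = {}"
  proof (rule ccontr)
    assume "ess_support \<mu> d \<noteq> {}"
    then obtain y where y: "y \<in> ess_support \<mu> d" by blast
    define U where "U = ball y (\<epsilon> / 2)"
    have U: "small_open \<epsilon> U" "open U" "y \<in> U" unfolding U_def using small_open_ball eps by simp_all
    define f where "f = (\<lambda>x. indicator U x * d x)"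
    have f: "f \<in> l2_on \<mu> U" unfolding f_def by (rule cutoff_l2[OF d U(2)])
    have "l2_inner \<mu> d f = cnj 1 * l2_inner \<mu> p' f + cnj (- cnj c) * l2_inner \<mu> p f"
      unfolding d_def by (rule l2_inner_lincomb_left[OF p'(1) p(1) l2_on_l2[OF f]])
    then have "l2_inner \<mu> d f = 0" using c[OF U(1) f] by simp
    then show False using inner_cutoff_nonzero[OF d U(2,3) y] unfolding f_def by blast
  qed
  then have "AE x in \<mu>. d x = 0" using AE_zero_off_ess_support[OF d] by simp
  then have d0: "l2_norm \<mu> d = 0" using l2_norm_eq_0_AE[OF d] by simp
  have p'd: "p' = (\<lambda>x. 1 * d x + cnj c * p x)" unfolding d_def by simp
  have zl: "l2_inner \<mu> d h = 0" if "h \<in> l2_space \<mu>" for h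
    using l2_cauchy_schwarz[OF d that] d0 by simp
  have left: "l2_inner \<mu> p' h = c * l2_inner \<mu> p h" if "h \<in> l2_space \<mu>" for h
    using l2_inner_lincomb_left[OF d p(1) that, of 1 "cnj c"] zl[OF that] p'd[symmetric] by simp
  have "l2_inner \<mu> p' p' = c * cnj (c * l2_inner \<mu> p p)"
    using left[OF p'(1)] left[OF p(1)] l2_inner_commute[of \<mu> p p'] by simp
  then have cc: "c * cnj c = 1" using p(2) p'(2) by (simp add: l2_inner_self)
  have "l2_inner \<mu> p' (T p') = l2_inner \<mu> p (T p)" if T: "T \<in> compact_ops \<mu>" for T
  proof -
    note Tb = compact_ops_bounded[OF T]
    have "cmod (l2_inner \<mu> p' (T d)) \<le> 0" using l2_inner_op_bound[OF Tb p'(1) d] d0 by simp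
    then have "l2_inner \<mu> p' (T p') = cnj c * l2_inner \<mu> p' (T p)"
      using l2_inner_op_lincomb[OF Tb d p(1) p'(1), of 1 "cnj c"] p'd[symmetric] by simp
    also have "\<dots> = (c * cnj c) * l2_inner \<mu> p (T p)"
      using left[OF bounded_opsD(1)[OF Tb p(1)]] by (simp add: mult.assoc mult.left_commute)
    finally show ?thesis using cc by simp
  qed
  then show ?thesis unfolding vector_state_def by (intro restrict_ext) simp
qed

lemma restrict_vector_state:
  "restrict (vector_state \<mu> p) (E_op \<mu> \<epsilon>) = (\<lambda>T\<in>E_op \<mu> \<epsilon>. l2_inner \<mu> p (T p))"
  unfolding vector_state_def by (intro restrict_ext) (simp add: E_op_compact)

end

theorem theorem4p18:
  fixes \<mu> :: "'a::metric_space measure" and \<epsilon> :: real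
  assumes "locally compact (UNIV :: 'a set)"
    and "radon_measure \<mu>"
    and "full_support \<mu>"
    and "\<epsilon> > 0"
  shows "bij_betw (\<lambda>\<omega>. restrict \<omega> (E_op \<mu> \<epsilon>))
           (eps_connected_pure_states \<mu> \<epsilon>) (pure_states \<mu> (E_op \<mu> \<epsilon>))"
proof -
  interpret radon_metric_space \<mu> \<epsilon>
    by unfold_locales (fact assms)+
  show ?thesis
    unfolding bij_betw_def
  proof (intro conjI inj_onI subset_antisym subsetI)
    fix \<omega> \<omega>' assume \<omega>: "\<omega> \<in> eps_connected_pure_states \<mu> \<epsilon>" and \<omega>': "\<omega>' \<in> eps_connected_pure_states \<mu> \<epsilon>"
      and eq: "restrict \<omega> (E_op \<mu> \<epsilon>) = restrict \<omega>' (E_op \<mu> \<epsilon>)"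
    obtain p where p: "p \<in> l2_space \<mu>" "l2_norm \<mu> p = 1" "\<omega> = vector_state \<mu> p"
      "eps_connected \<epsilon> (ess_support \<mu> p)"
      using \<omega> unfolding eps_connected_pure_states_def by blast
    obtain p' where p': "p' \<in> l2_space \<mu>" "l2_norm \<mu> p' = 1" "\<omega>' = vector_state \<mu> p'"
      using \<omega>' unfolding eps_connected_pure_states_def by blast
    have "l2_inner \<mu> p (T p) = l2_inner \<mu> p' (T p')" if "T \<in> E_op \<mu> \<epsilon>" for T
      using fun_cong[OF eq, of T] that unfolding p(3) p'(3) restrict_vector_state by simp
    then show "\<omega> = \<omega>'"
      unfolding p(3) p'(3) by (rule vector_state_determined_by_restriction[OF p(1,2) p'(1,2) p(4)])
  next
    fix \<phi> assume "\<phi> \<in> (\<lambda>\<omega>. restrict \<omega> (E_op \<mu> \<epsilon>)) ` eps_connected_pure_states \<mu> \<epsilon>"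
    then obtain p where p: "p \<in> l2_space \<mu>" "l2_norm \<mu> p = 1"
      "\<phi> = restrict (vector_state \<mu> p) (E_op \<mu> \<epsilon>)" "eps_connected \<epsilon> (ess_support \<mu> p)"
      unfolding eps_connected_pure_states_def by blast
    show "\<phi> \<in> pure_states \<mu> (E_op \<mu> \<epsilon>)"
      unfolding p(3) restrict_vector_state by (rule vector_state_pure_on_E[OF p(1,2,4)])
  next
    fix \<phi> assume \<phi>: "\<phi> \<in> pure_states \<mu> (E_op \<mu> \<epsilon>)"
    obtain p where p: "p \<in> l2_space \<mu>" "l2_norm \<mu> p = 1"
      and rep: "\<And>T. T \<in> E_op \<mu> \<epsilon> \<Longrightarrow> \<phi> T = l2_inner \<mu> p (T p)"
      using pure_state_is_vector_state[OF \<phi>] by blast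
    have mem: "vector_state \<mu> p \<in> eps_connected_pure_states \<mu> \<epsilon>"
      using p vector_state_pure_on_compact[OF p] pure_vector_state_eps_connected[OF \<phi> p rep]
      unfolding eps_connected_pure_states_def by blast
    have res: "\<phi> = restrict (vector_state \<mu> p) (E_op \<mu> \<epsilon>)"
    proof (rule extensionalityI[of _ "E_op \<mu> \<epsilon>"])
      show "\<phi> \<in> extensional (E_op \<mu> \<epsilon>)" using \<phi> unfolding pure_states_def states_iff by blast
      fix T assume "T \<in> E_op \<mu> \<epsilon>"
      then show "\<phi> T = restrict (vector_state \<mu> p) (E_op \<mu> \<epsilon>) T"
        unfolding restrict_vector_state by (simp add: rep)
    qed simp
    show "\<phi> \<in> (\<lambda>\<omega>. restrict \<omega> (E_op \<mu> \<epsilon>)) ` eps_connected_pure_states \<mu> \<epsilon>"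
      by (rule image_eqI) (rule res, rule mem)
  qed
qed

end
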